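(* Let $a>0$ and $\max(\tfrac12,\,2a-\tfrac12)<c<2a+\tfrac12$, where additionally $0<a<\tfrac12$ is required in the case $c=\tfrac12$. Let $\{a_n\}_{n\ge1}$ be a complex sequence such that for some $\delta\in[0,\pi/2)$ $$\sum_{m=1}^\infty \frac{|a_m|\,e^{-\delta m}}{|\Gamma(a+\tfrac{im}{2})|^2}<\infty,$$ and define, for $x>0$, $$f(x)=\sum_{n=1}^\infty a_n\,{}_2F_1\!\left(a+\tfrac{in}{2},\;a-\tfrac{in}{2};\;c;\;-x^2\right).$$ Then for every $n\in\mathbb{N}$, $$a_n=\frac{4^{a-c}}{\pi^2}\,\Gamma(2(c-a)+1)\left|\frac{\Gamma(a+\tfrac{in}{2})}{\Gamma(c)}\right|^2\sinh(\pi n)\int_0^\infty x^{2c-1}\,\Phi_n(x)\,f(x)\,dx,$$ where the integral converges absolutely and $$\Phi_n(x)=\int_{-\pi}^{\pi}{}_2F_1\!\left(c-a+\tfrac12,\;c-a+1;\;c;\;-\frac{x^2}{\cosh^2 u}\right)\frac{\tanh(u)\,\sin(nu)}{[\cosh u]^{2(c-a)}}\,du,\qquad x>0.$$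
   Context: ${}_2F_1(\alpha,\beta;\gamma;z)$ denotes the Gauss hypergeometric function (analytically continued to $z\in(-\infty,0]$), $\Gamma$ is Euler's gamma function, and $i$ is the imaginary unit. *)

theory Defs
  imports "HOL-Analysis.Analysis"
begin

definition hyp2F1_series :: "complex \<Rightarrow> complex \<Rightarrow> complex \<Rightarrow> complex \<Rightarrow> complex" where
  "hyp2F1_series \<alpha> \<beta> \<gamma> w =
     (\<Sum>k. pochhammer \<alpha> k * pochhammer \<beta> k / (pochhammer \<gamma> k * fact k) * w ^ k)"

text \<open>Analytic continuation of 2F1 to real z \<le> 0 via the Pfaff transformation
  2F1(\<alpha>,\<beta>;\<gamma>;z) = (1-z)^(-\<alpha>) 2F1(\<alpha>,\<gamma>-\<beta>;\<gamma>;z/(z-1)); for z \<le> 0 we have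
  z/(z-1) \<in> [0,1) and 1 - z \<ge> 1 > 0, so the right-hand side is given by the convergent series
  with the principal power.\<close>
definition hyp2F1 :: "complex \<Rightarrow> complex \<Rightarrow> complex \<Rightarrow> real \<Rightarrow> complex" where
  "hyp2F1 \<alpha> \<beta> \<gamma> z =
     complex_of_real (1 - z) powr (- \<alpha>) * hyp2F1_series \<alpha> (\<gamma> - \<beta>) \<gamma> (complex_of_real (z / (z - 1)))"

end

theory Submission
  imports Defs
begin

text \<open>
  Write \<open>\<phi>\<^sub>t(x)\<close> for the hypergeometric function with parameters \<open>a \<plusminus> it/2; c\<close> at \<open>-x\<^sup>2\<close> and put
  \<open>p = c - a\<close>. The kernel in the definition of \<open>\<Phi>\<^sub>n\<close> is \<open>k(P, x) = P\<^bsup>-2p-1\<^esup> g(x/P)\<close> with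
  \<open>P = cosh u\<close>, up to the factor \<open>sinh u sin(nu)\<close>, and everything follows from
  \<open>\<integral> x\<^bsup>2c-1\<^esup> k(cosh u, x) \<phi>\<^sub>t(x) dx = K(t) sin(tu) / sinh u\<close> and the orthogonality of the sines.

  To evaluate this integral without Bessel functions, let \<open>l(Q, x) = Q\<^bsup>-2a\<^esup> h(x/Q)\<close> with
  \<open>h(x) = \<^sub>2F\<^sub>1(a, a+1/2; c; -x\<^sup>2)\<close>. Both \<open>k\<close> and \<open>l\<close> are homogeneous and harmonic for
  \<open>\<partial>\<^sub>P\<^sup>2 + \<partial>\<^sub>x\<^sup>2 + (2c-1)/x \<partial>\<^sub>x\<close>. Consequently the cosine transform of \<open>v \<mapsto> l(cosh v, x)\<close> satisfies the
  equation of \<open>\<phi>\<^sub>t\<close> and is a multiple of it, and \<open>J(P) = \<integral> x\<^bsup>2c-1\<^esup> k(P, x) h(x) dx\<close> satisfies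
  \<open>((1 - P\<^sup>2) J)'' = 0\<close>, so \<open>J(P)\<close> is a multiple of \<open>1/(1 + P)\<close>. The pairing of \<open>k(cosh u, \<cdot>)\<close> with \<open>\<phi>\<^sub>t\<close>
  is thereby reduced to the Fourier transform of \<open>1/(cosh u + cosh v)\<close>.

  An energy argument gives uniqueness of regular solutions and the bound
  \<open>|\<phi>\<^sub>t(x)| \<le> C (1 + x\<^sup>2)\<^bsup>-a\<^esup>\<close> uniformly in \<open>t \<ge> 1\<close>; with the exponential decay of
  \<open>\<Gamma>(a + im/2)\<close> this justifies the termwise integration of \<open>f\<close>.
\<close>


section \<open>The hypergeometric series\<close>

text \<open>The degrees are matched. In (P, x) the kernels k and l are homogeneous of degrees -2p-1
  and -2a, and the weight x^(2c-1) dx has degree 2c, so the pairing of k(P, .) with l(Q, .) has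
  degree -1. A single function J of one variable therefore carries all pairings, and they equal 2
  J(1)/(P + Q). The constant J(1) is read off from the behaviour of P J(P) as P tends to infinity.
  There only the leading coefficient of h at infinity and a Mellin integral of g survive, and the
  latter is the integral of an exact derivative by a contiguous relation. This is why limits of
  Pfaff series at w = 1 are needed in addition to bounds. The factors of the coefficient formula
  arise as follows: |Gamma(a + in/2)|^2 from the value at x = 0 of the cosine transform, sinh(pi n)
  from the Fourier integral, the Gamma factors in c and 2(c-a)+1 from J(1), and one factor pi from
  the squared norm of a sine on [-pi, pi].\<close>

definition fps_2F1 :: "complex \<Rightarrow> complex \<Rightarrow> complex \<Rightarrow> complex fps" where
  "fps_2F1 A B C = Abs_fps (\<lambda>k. pochhammer A k * pochhammer B k / (pochhammer C k * fact k))"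

lemma fps_2F1_nth: "fps_nth (fps_2F1 A B C) (k) = pochhammer A k * pochhammer B k / (pochhammer C k * fact k)"
  by (simp add: fps_2F1_def)

lemma hyp2F1_series_eq_eval: "hyp2F1_series A B C w = eval_fps (fps_2F1 A B C) w"
  by (simp add: hyp2F1_series_def eval_fps_def fps_2F1_nth)

lemma of_real_notin_nonpos_Ints:
  assumes "s > 0"
  shows "complex_of_real s \<notin> \<int>\<^sub>\<le>\<^sub>0"
proof
  assume "complex_of_real s \<in> \<int>\<^sub>\<le>\<^sub>0"
  then obtain n where "complex_of_real s = of_int n" "n \<le> 0" by (rule nonpos_Ints_cases)
  hence "s = of_int n" by (metis of_real_eq_iff of_real_of_int_eq)
  thus False using \<open>n \<le> 0\<close> assms by simp
qed

section \<open>Size of the coefficients and growth of the sum at w = 1\<close>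

lemma pochhammer_rGamma_series:
  fixes z :: complex
  shows "pochhammer z (Suc k) = rGamma_series z k * fact k * exp (z * of_real (ln (real k)))"
  by (simp add: rGamma_series_def)

lemma pochhammer_nonpos_Ints_nonzero:
  fixes C :: complex
  assumes "C \<notin> \<int>\<^sub>\<le>\<^sub>0"
  shows "pochhammer C k \<noteq> 0"
  using assms by (auto simp: pochhammer_eq_0_iff)

text \<open>Each Pochhammer symbol is split into its growth and a convergent factor
  \<open>rGamma_series\<close>, which shows the coefficient to be at most of order k^(Re(A+B-C)-1).
  The index is \<open>Suc k\<close> because \<open>rGamma_series\<close> at k contains a Pochhammer
  symbol of length k + 1.\<close>

lemma fps_2F1_nth_Suc:
  assumes "C \<notin> \<int>\<^sub>\<le>\<^sub>0"
  shows "fps_nth (fps_2F1 A B C) (Suc k) = rGamma_series A k * rGamma_series B k / rGamma_series C k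
            * exp ((A + B - C) * of_real (ln (real k))) / of_nat (Suc k)"
proof -
  have nz: "rGamma_series C k \<noteq> 0"
    using pochhammer_nonpos_Ints_nonzero[OF assms, of "Suc k"] by (simp add: rGamma_series_def)
  show ?thesis
    unfolding fps_2F1_nth pochhammer_rGamma_series
    using nz by (simp add: divide_simps exp_add exp_diff ring_distribs del: of_nat_Suc)
qed

lemma rGamma_quotient_tendsto:
  fixes A B C D :: complex
  assumes "C \<notin> \<int>\<^sub>\<le>\<^sub>0" "D \<notin> \<int>\<^sub>\<le>\<^sub>0"
  shows "(\<lambda>k. rGamma_series A k * rGamma_series B k / (rGamma_series C k * rGamma_series D k))
           \<longlonglongrightarrow> rGamma A * rGamma B * Gamma C * Gamma D"
proof -
  have "(\<lambda>k. rGamma_series A k * rGamma_series B k / (rGamma_series C k * rGamma_series D k))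
           \<longlonglongrightarrow> rGamma A * rGamma B / (rGamma C * rGamma D)"
    using assms by (intro tendsto_intros) (auto simp: rGamma_eq_zero_iff)
  thus ?thesis by (simp add: Gamma_def field_simps)
qed

lemma binomial_series_sums:
  fixes s w :: real
  assumes "\<bar>w\<bar> < 1"
  shows "(\<lambda>k. pochhammer s k / fact k * w ^ k) sums (1 - w) powr (- s)"
proof -
  have "(\<lambda>k. ((-s) gchoose k) * (-w) ^ k) sums (1 + (-w)) powr (-s)"
    by (rule gen_binomial_real) (use assms in auto)
  moreover have "((-s) gchoose k) * (-w) ^ k = pochhammer s k / fact k * w ^ k" for k
  proof -
    have "(-1::real) ^ k * (-1) ^ k = 1" by (simp flip: power_mult_distrib)
    thus ?thesis
      by (simp add: gbinomial_pochhammer power_minus[of w] algebra_simps)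
  qed
  ultimately show ?thesis by simp
qed

text \<open>The coefficients of (1 - w)^(-s) grow like k^(s-1), so the quotient of the two sequences
  is a convergent product of \<open>rGamma_series\<close> factors times a power of k whose exponent
  has non-positive real part. This one majorant yields both the radius of convergence and the growth
  as w -> 1.\<close>

lemma fps_2F1_nth_le_binomial:
  assumes C: "C \<notin> \<int>\<^sub>\<le>\<^sub>0" and s: "s > 0" "Re (A + B - C) \<le> s"
  obtains K where "K > 0" "\<And>k. norm (fps_nth (fps_2F1 A B C) k) \<le> K * (pochhammer s k / fact k)"
proof -
  define S where "S = complex_of_real s"
  have S: "S \<notin> \<int>\<^sub>\<le>\<^sub>0" using of_real_notin_nonpos_Ints[OF s(1)] by (simp add: S_def)
  let ?r = "\<lambda>k. rGamma_series A k * rGamma_series B k / (rGamma_series C k * rGamma_series S k)"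
  have "Bseq ?r"
    by (rule convergent_imp_Bseq, rule convergentI, rule rGamma_quotient_tendsto[OF C S])
  then obtain K0 where K0: "K0 > 0" "\<And>k. norm (?r k) \<le> K0" by (auto elim: BseqE)
  \<comment> \<open>\<open>K0\<close> serves the indices from 2 on, where ln j >= 0; the entry 1
    serves index 0 and the last entry index 1, where the coefficient of the majorant is s.\<close>
  define K where "K = max 1 (max K0 (norm (fps_nth (fps_2F1 A B C) (1)) / s))"
  have "norm (fps_nth (fps_2F1 A B C) k) \<le> K * (pochhammer s k / fact k)" for k
  proof (cases k)
    case 0
    thus ?thesis by (simp add: fps_2F1_nth K_def)
  next
    case (Suc j)
    show ?thesis
    proof (cases "j = 0")
      case True
      have "norm (fps_nth (fps_2F1 A B C) (1)) / s \<le> K" by (simp add: K_def)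
      thus ?thesis using True Suc s by (simp add: field_simps)
    next
      case False
      have nz: "rGamma_series S j \<noteq> 0"
        using pochhammer_nonpos_Ints_nonzero[OF S, of "Suc j"] by (simp add: rGamma_series_def)
      have pS: "complex_of_real (pochhammer s (Suc j) / fact (Suc j))
          = rGamma_series S j * exp (S * of_real (ln (real j))) / of_nat (Suc j)"
        using pochhammer_rGamma_series[of S j] by (simp add: S_def pochhammer_of_real)
      have "fps_nth (fps_2F1 A B C) (Suc j) = ?r j * exp ((A + B - C - S) * of_real (ln (real j)))
             * complex_of_real (pochhammer s (Suc j) / fact (Suc j))"
        unfolding pS fps_2F1_nth_Suc[OF C] using nz
        by (simp add: divide_simps exp_add exp_diff ring_distribs del: of_nat_Suc)
      hence "norm (fps_nth (fps_2F1 A B C) (Suc j)) = norm (?r j) * norm (exp ((A + B - C - S) * of_real (ln (real j))))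
             * \<bar>pochhammer s (Suc j) / fact (Suc j)\<bar>"
        by (simp only: norm_mult norm_of_real)
      also have "\<dots> \<le> K0 * 1 * \<bar>pochhammer s (Suc j) / fact (Suc j)\<bar>"
      proof (intro mult_mono)
        have "Re (A + B - C - S) * ln (real j) \<le> 0"
          using False s by (intro mult_nonpos_nonneg) (auto simp: S_def)
        thus "norm (exp ((A + B - C - S) * of_real (ln (real j)))) \<le> 1" by simp
      qed (use K0 in auto)
      also have "\<bar>pochhammer s (Suc j) / fact (Suc j)\<bar> = pochhammer s (Suc j) / fact (Suc j)"
        using pochhammer_pos[OF s(1), of "Suc j"] by (intro abs_of_nonneg divide_nonneg_nonneg) auto
      also have "K0 * 1 * \<dots> \<le> K * (pochhammer s (Suc j) / fact (Suc j))"
        using pochhammer_pos[OF s(1), of "Suc j"]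
        by (intro mult_right_mono divide_nonneg_nonneg) (auto simp: K_def)
      finally show ?thesis using Suc by simp
    qed
  qed
  moreover have "K > 0" by (simp add: K_def)
  ultimately show ?thesis using that by blast
qed

lemma fps_conv_radius_2F1:
  assumes "C \<notin> \<int>\<^sub>\<le>\<^sub>0"
  shows "fps_conv_radius (fps_2F1 A B C) \<ge> 1"
proof -
  define s where "s = max 1 (Re (A + B - C))"
  have "s > 0" "Re (A + B - C) \<le> s" by (auto simp: s_def)
  then obtain K where K: "K > 0" "\<And>k. norm (fps_nth (fps_2F1 A B C) k) \<le> K * (pochhammer s k / fact k)"
    by (rule fps_2F1_nth_le_binomial[OF assms, of s A B]) blast
  show ?thesis unfolding fps_conv_radius_def
  proof (rule conv_radius_geI_ex)
    fix r :: real assume r: "0 < r" "ereal r < 1"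
    have "summable (\<lambda>n. K * (pochhammer s n / fact n * r ^ n))"
      using binomial_series_sums[of r s] r by (intro summable_mult) (auto simp: summable_def)
    hence "summable (\<lambda>n. norm (fps_nth (fps_2F1 A B C) (n) * of_real r ^ n))"
    proof (rule summable_comparison_test')
      fix n :: nat
      have "norm (fps_nth (fps_2F1 A B C) n) * r ^ n \<le> K * (pochhammer s n / fact n) * r ^ n"
        using K r by (intro mult_right_mono) auto
      thus "norm (norm (fps_nth (fps_2F1 A B C) n * of_real r ^ n)) \<le> K * (pochhammer s n / fact n * r ^ n)"
        using r by (simp add: norm_mult norm_power mult.assoc)
    qed
    thus "\<exists>z. norm z = r \<and> summable (\<lambda>n. fps_nth (fps_2F1 A B C) (n) * z ^ n)"
      using r by (intro exI[of _ "of_real r"]) (auto dest: summable_norm_cancel)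
  qed
qed

lemma norm_eval_2F1_le:
  assumes C: "C \<notin> \<int>\<^sub>\<le>\<^sub>0" and s: "s > 0" "Re (A + B - C) \<le> s"
  obtains K where "K > 0"
    "\<And>w::real. 0 \<le> w \<Longrightarrow> w < 1 \<Longrightarrow> norm (eval_fps (fps_2F1 A B C) (of_real w)) \<le> K * (1 - w) powr (- s)"
proof -
  obtain K where K: "K > 0" "\<And>k. norm (fps_nth (fps_2F1 A B C) k) \<le> K * (pochhammer s k / fact k)"
    by (rule fps_2F1_nth_le_binomial[OF C s]) blast
  show ?thesis
  proof (rule that[OF K(1)])
    fix w :: real assume w: "0 \<le> w" "w < 1"
    have sm: "(\<lambda>k. K * (pochhammer s k / fact k * w ^ k)) sums (K * (1 - w) powr (- s))"
      using w by (intro sums_mult binomial_series_sums) auto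
    have "norm (\<Sum>k. fps_nth (fps_2F1 A B C) (k) * of_real w ^ k) \<le> (\<Sum>k. K * (pochhammer s k / fact k * w ^ k))"
    proof (rule norm_suminf_le)
      fix n :: nat
      have "norm (fps_nth (fps_2F1 A B C) n) * w ^ n \<le> K * (pochhammer s n / fact n) * w ^ n"
        using K w by (intro mult_right_mono) auto
      thus "norm (fps_nth (fps_2F1 A B C) n * of_real w ^ n) \<le> K * (pochhammer s n / fact n * w ^ n)"
        using w by (simp add: norm_mult norm_power mult.assoc)
    qed (use sm in \<open>simp add: sums_iff\<close>)
    thus "norm (eval_fps (fps_2F1 A B C) (of_real w)) \<le> K * (1 - w) powr (- s)"
      using sums_unique[OF sm] by (simp add: eval_fps_def)
  qed
qed

text \<open>The coefficients are at most of order k^(Re(A+B-C)-1) with an exponent below -1, so the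
  sum of their absolute values is finite and bounds the function up to w = 1.\<close>

lemma norm_eval_2F1_bounded:
  assumes C: "C \<notin> \<int>\<^sub>\<le>\<^sub>0" and s: "Re (A + B - C) < 0"
  obtains K where "K > 0"
    "\<And>w::real. 0 \<le> w \<Longrightarrow> w < 1 \<Longrightarrow> norm (eval_fps (fps_2F1 A B C) (of_real w)) \<le> K"
proof -
  let ?r = "\<lambda>k. rGamma_series A k * rGamma_series B k / rGamma_series C k"
  have "?r \<longlonglongrightarrow> rGamma A * rGamma B / rGamma C"
    using C by (intro tendsto_intros) (auto simp: rGamma_eq_zero_iff)
  hence "Bseq ?r" by (intro convergent_imp_Bseq convergentI)
  then obtain K0 where K0: "K0 > 0" "\<And>k. norm (?r k) \<le> K0" by (auto elim: BseqE)
  define t where "t = Re (A + B - C)"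
  have "summable (\<lambda>k. K0 * real k powr (t - 1))"
    using s by (intro summable_mult) (simp add: summable_real_powr_iff t_def)
  hence "summable (\<lambda>k. norm (fps_nth (fps_2F1 A B C) (Suc k)))"
  proof (rule summable_comparison_test'[where N = 1])
    fix k :: nat assume k: "k \<ge> 1"
    have "norm (fps_nth (fps_2F1 A B C) (Suc k)) = norm (?r k) * exp (t * ln (real k)) / real (Suc k)"
      unfolding fps_2F1_nth_Suc[OF C] by (simp add: norm_mult norm_divide t_def del: of_nat_Suc)
    also have "\<dots> \<le> K0 * exp (t * ln (real k)) / real k"
      using k K0 by (intro frac_le mult_right_mono mult_nonneg_nonneg) auto
    also have "\<dots> = K0 * real k powr (t - 1)"
      using k by (simp add: powr_def left_diff_distrib exp_diff)
    finally show "norm (norm (fps_nth (fps_2F1 A B C) (Suc k))) \<le> K0 * real k powr (t - 1)" by simp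
  qed
  hence sm: "summable (\<lambda>k. norm (fps_nth (fps_2F1 A B C) k))" by (subst (asm) summable_Suc_iff)
  define K where "K = 1 + (\<Sum>k. norm (fps_nth (fps_2F1 A B C) k))"
  show ?thesis
  proof (rule that[of K])
    show "K > 0" unfolding K_def using suminf_nonneg[OF sm] by simp
    fix w :: real assume w: "0 \<le> w" "w < 1"
    have "norm (\<Sum>k. fps_nth (fps_2F1 A B C) k * of_real w ^ k) \<le> (\<Sum>k. norm (fps_nth (fps_2F1 A B C) k))"
      by (rule norm_suminf_le[OF _ sm])
         (use w in \<open>auto simp: norm_mult norm_power intro!: mult_left_le power_le_one\<close>)
    thus "norm (eval_fps (fps_2F1 A B C) (of_real w)) \<le> K" by (simp add: eval_fps_def K_def)
  qed
qed

text \<open>Abel summation, by comparison of the coefficients with those of \<open>(1 - w)\<^bsup>-s\<^esup>\<close>.\<close>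
lemma eval_2F1_at_1:
  assumes C: "C \<notin> \<int>\<^sub>\<le>\<^sub>0" and s: "s > 0" "A + B - C = of_real s"
  shows "((\<lambda>w::real. of_real ((1 - w) powr s) * eval_fps (fps_2F1 A B C) (of_real w))
           \<longlongrightarrow> rGamma A * rGamma B * Gamma C * Gamma (of_real s)) (at_left 1)"
proof -
  define S where "S = complex_of_real s"
  have S: "S \<notin> \<int>\<^sub>\<le>\<^sub>0" using of_real_notin_nonpos_Ints[OF s(1)] by (simp add: S_def)
  define L where "L = rGamma A * rGamma B * Gamma C * Gamma S"
  define b where "b = (\<lambda>k. pochhammer s k / fact k)"
  have b_pos: "b k > 0" for k using pochhammer_pos[OF s(1)] by (auto simp: b_def)
  define f where "f = (\<lambda>k. fps_nth (fps_2F1 A B C) k)"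
  let ?r = "\<lambda>k. rGamma_series A k * rGamma_series B k / (rGamma_series C k * rGamma_series S k)"
  have lim: "?r \<longlonglongrightarrow> L" unfolding L_def by (rule rGamma_quotient_tendsto[OF C S])
  have f_Suc: "f (Suc k) = ?r k * of_real (b (Suc k))" for k
  proof -
    have nz: "rGamma_series S k \<noteq> 0"
      using pochhammer_nonpos_Ints_nonzero[OF S, of "Suc k"] by (simp add: rGamma_series_def)
    have pS: "complex_of_real (b (Suc k))
        = rGamma_series S k * exp (S * of_real (ln (real k))) / of_nat (Suc k)"
      using pochhammer_rGamma_series[of S k] by (simp add: b_def S_def pochhammer_of_real)
    show ?thesis
      unfolding pS f_def fps_2F1_nth_Suc[OF C] using nz s
      by (simp add: divide_simps S_def del: of_nat_Suc)
  qed
  have bsums: "(\<lambda>k. b k * w ^ k) sums (1 - w) powr (-s)" if "0 \<le> w" "w < 1" for w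
    unfolding b_def using that by (intro binomial_series_sums) auto
  have eval: "eval_fps (fps_2F1 A B C) (of_real w) = (\<Sum>k. f k * of_real w ^ k)"
    and fsum: "summable (\<lambda>k. f k * of_real w ^ k)" if "0 \<le> w" "w < 1" for w :: real
  proof -
    have "ereal (norm (complex_of_real w)) < fps_conv_radius (fps_2F1 A B C)"
      using that by (intro less_le_trans[OF _ fps_conv_radius_2F1[OF C, of A B]]) simp
    thus "summable (\<lambda>k. f k * of_real w ^ k)" unfolding f_def by (rule summable_fps)
  qed (simp add: eval_fps_def f_def)
  show ?thesis
    unfolding S_def[symmetric] L_def[symmetric]
  proof (rule tendstoI)
    fix e :: real assume e: "e > 0"
    obtain N where N: "\<And>k. k \<ge> N \<Longrightarrow> norm (?r k - L) < e / 2"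
      using LIMSEQ_D[OF lim, of "e/2"] e by auto
    \<comment> \<open>Past N the coefficients differ from L times those of (1 - w)^(-s) by at most
      e/2 times the latter. M collects the finitely many remaining terms, which the factor (1 - w)^s
      removes in the limit.\<close>
    define M where "M = (\<Sum>k<Suc N. norm (f k - L * of_real (b k)))"
    have bound: "norm (of_real ((1 - w) powr s) * eval_fps (fps_2F1 A B C) (of_real w) - L)
                   \<le> (1 - w) powr s * M + e / 2" if w: "0 \<le> w" "w < 1" for w
    proof -
      define d where "d = (\<lambda>k. (f k - L * of_real (b k)) * of_real w ^ k)"
      have sb: "(\<lambda>k. L * (of_real (b k * w ^ k))) sums (L * of_real ((1 - w) powr (-s)))"
        by (intro sums_mult sums_of_real bsums w)
      have ds: "d sums (eval_fps (fps_2F1 A B C) (of_real w) - L * of_real ((1 - w) powr (-s)))"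
        using sums_diff[OF summable_sums[OF fsum[OF w]] sb] unfolding eval[OF w] d_def
        by (simp add: algebra_simps)
      define g where "g = (\<lambda>k. (if k < Suc N then norm (f k - L * of_real (b k)) else 0) + e / 2 * (b k * w ^ k))"
      have gs: "g sums (M + e / 2 * (1 - w) powr (-s))"
        unfolding g_def M_def
        using sums_If_finite_set[of "{..<Suc N}" "\<lambda>k. norm (f k - L * of_real (b k))"]
        by (intro sums_add sums_mult bsums w) (simp add: lessThan_def)
      have le: "norm (d k) \<le> g k" for k
      proof (cases "k < Suc N")
        case True
        have "norm (d k) \<le> norm (f k - L * of_real (b k)) * 1"
          unfolding d_def norm_mult using w by (intro mult_left_mono) (auto simp: norm_power power_le_one)
        thus ?thesis using True w b_pos[of k] e by (auto simp: g_def intro!: add_increasing2)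
      next
        case False
        then obtain j where j: "k = Suc j" "j \<ge> N" by (cases k) auto
        have "d k = (?r j - L) * of_real (b k * w ^ k)"
          by (simp add: d_def j f_Suc algebra_simps)
        hence "norm (d k) = norm (?r j - L) * (b k * w ^ k)"
          using w b_pos[of k] by (simp only: norm_mult norm_of_real) (simp add: abs_mult)
        also have "\<dots> \<le> e / 2 * (b k * w ^ k)"
          using w b_pos[of k] N[OF j(2)] by (intro mult_right_mono) auto
        finally show ?thesis using False by (simp add: g_def)
      qed
      have "norm (suminf d) \<le> suminf g" by (rule norm_suminf_le[OF le]) (use gs in \<open>auto simp: sums_iff\<close>)
      hence le2: "norm (eval_fps (fps_2F1 A B C) (of_real w) - L * of_real ((1 - w) powr (-s)))
              \<le> M + e / 2 * (1 - w) powr (-s)" using ds gs by (simp add: sums_iff)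
      have pw: "(1 - w) powr s * (1 - w) powr (-s) = 1" using w by (simp flip: powr_add)
      have "of_real ((1 - w) powr s) * eval_fps (fps_2F1 A B C) (of_real w) - L
          = of_real ((1 - w) powr s) * (eval_fps (fps_2F1 A B C) (of_real w) - L * of_real ((1 - w) powr (-s)))"
        using pw by (simp add: algebra_simps flip: of_real_mult)
      hence "norm (of_real ((1 - w) powr s) * eval_fps (fps_2F1 A B C) (of_real w) - L)
          \<le> (1 - w) powr s * (M + e / 2 * (1 - w) powr (-s))"
        using le2 by (simp only: norm_mult norm_of_real) (simp add: mult_left_mono)
      also have "\<dots> = (1 - w) powr s * M + e / 2" using pw by (simp add: algebra_simps)
      finally show ?thesis .
    qed
    have "((\<lambda>w. (1 - w) powr s * M + e / 2) \<longlongrightarrow> (1 - 1) powr s * M + e / 2) (at_left (1::real))"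
      using s by (intro tendsto_intros tendsto_powr2) (auto intro!: eventually_at_leftI[of 0])
    hence "eventually (\<lambda>w. (1 - w) powr s * M + e / 2 < e) (at_left (1::real))"
      by (rule order_tendstoD) (use e s in auto)
    moreover have "eventually (\<lambda>w. w \<in> {0<..<1}) (at_left (1::real))"
      by (rule eventually_at_left_real) auto
    ultimately show "eventually (\<lambda>w. dist (of_real ((1 - w) powr s) * eval_fps (fps_2F1 A B C) (of_real w)) L < e) (at_left 1)"
    proof eventually_elim
      case (elim w)
      thus ?case using bound[of w] by (simp add: dist_norm)
    qed
  qed
qed

section \<open>Derivatives, hypergeometric equation and a contiguous relation\<close>

lemma fps_deriv_2F1:
  assumes C: "C \<notin> \<int>\<^sub>\<le>\<^sub>0"
  shows "fps_deriv (fps_2F1 A B C) = fps_const (A * B / C) * fps_2F1 (A + 1) (B + 1) (C + 1)"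
proof (rule fps_ext)
  fix k
  show "fps_nth (fps_deriv (fps_2F1 A B C)) k = fps_nth (fps_const (A * B / C) * fps_2F1 (A + 1) (B + 1) (C + 1)) k"
    using of_nat_neq_0[of k, where 'a = complex]
    by (simp add: fps_2F1_nth pochhammer_rec fact_Suc divide_simps del: of_nat_Suc)
qed

lemma fps_2F1_rec:
  assumes C: "C \<notin> \<int>\<^sub>\<le>\<^sub>0"
  shows "of_nat (Suc k) * (C + of_nat k) * fps_nth (fps_2F1 A B C) (Suc k)
     = (A + of_nat k) * (B + of_nat k) * fps_nth (fps_2F1 A B C) k"
proof -
  have "C + of_nat k \<noteq> 0" "pochhammer C k \<noteq> 0"
    using pochhammer_nonpos_Ints_nonzero[OF C, of "Suc k"] by (auto simp: pochhammer_rec')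
  thus ?thesis using of_nat_neq_0[of k, where 'a = complex]
    by (simp add: fps_2F1_nth pochhammer_rec' fact_Suc divide_simps del: of_nat_Suc)
qed

lemma fps_2F1_ode:
  fixes A B C :: complex
  assumes C: "C \<notin> \<int>\<^sub>\<le>\<^sub>0"
  defines "f \<equiv> fps_2F1 A B C"
  shows "fps_X * fps_deriv (fps_deriv f) - fps_X * (fps_X * fps_deriv (fps_deriv f))
     + fps_const C * fps_deriv f - fps_const (A + B + 1) * (fps_X * fps_deriv f) = fps_const (A * B) * f"
proof (rule fps_ext)
  fix k
  have rec: "(of_nat k + 1) * (C + of_nat k) * fps_nth f (Suc k) = (A + of_nat k) * (B + of_nat k) * fps_nth f k"
    using fps_2F1_rec[OF C, of k A B] by (simp add: f_def add.commute)
  \<comment> \<open>Two factors \<open>fps_X\<close> shift the index by 2; the cases 0 and 1 are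
    those in which a shifted coefficient is absent.\<close>
  consider "k = 0" | "k = 1" | j where "k = Suc (Suc j)"
    by (cases k; cases "k - 1") auto
  thus "fps_nth (fps_X * fps_deriv (fps_deriv f) - fps_X * (fps_X * fps_deriv (fps_deriv f))
     + fps_const C * fps_deriv f - fps_const (A + B + 1) * (fps_X * fps_deriv f)) k = fps_nth (fps_const (A * B) * f) k"
    by cases (use rec in \<open>simp_all add: algebra_simps\<close>)
qed

text \<open>A first-order operator lowers B by one. In the Pfaff form C - B stands in this place, so
  the operator raises the second parameter of the original function; this later makes the Mellin
  integrand of \<open>g\<close> an exact derivative.\<close>

lemma fps_2F1_contiguous:
  fixes A B C :: complex
  assumes C: "C \<notin> \<int>\<^sub>\<le>\<^sub>0"
  defines "f \<equiv> fps_2F1 A B C"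
  shows "fps_const (C - B) * f - fps_const A * (fps_X * f) + fps_X * fps_deriv f - fps_X * (fps_X * fps_deriv f)
     = fps_const (C - B) * fps_2F1 A (B - 1) C"
proof (rule fps_ext)
  fix k
  show "fps_nth (fps_const (C - B) * f - fps_const A * (fps_X * f) + fps_X * fps_deriv f - fps_X * (fps_X * fps_deriv f)) k
     = fps_nth (fps_const (C - B) * fps_2F1 A (B - 1) C) k"
  proof (cases k)
    case 0
    thus ?thesis by (simp add: f_def fps_2F1_nth)
  next
    case (Suc j)
    \<comment> \<open>The common factor of the three coefficients involved; once it is taken out,
      the claim is a polynomial identity in A, B, C and j.\<close>
    define e where "e = pochhammer A j * pochhammer B j / (pochhammer C (Suc j) * fact (Suc j))"
    have Cj: "C + of_nat j \<noteq> 0" "pochhammer C j \<noteq> 0"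
      using pochhammer_nonpos_Ints_nonzero[OF C, of "Suc j"] by (auto simp: pochhammer_rec')
    have 1: "fps_nth f (Suc j) = (A + of_nat j) * (B + of_nat j) * e"
      by (simp add: f_def fps_2F1_nth e_def pochhammer_rec' del: fact_Suc)
    have 2: "fps_nth f j = (C + of_nat j) * (of_nat j + 1) * e"
      using Cj of_nat_neq_0[of j, where 'a = complex]
      by (simp add: f_def fps_2F1_nth e_def pochhammer_rec' fact_Suc divide_simps add.commute)
    have 3: "fps_nth (fps_2F1 A (B - 1) C) (Suc j) = (A + of_nat j) * (B - 1) * e"
      by (simp add: fps_2F1_nth e_def pochhammer_rec'[of A] pochhammer_rec[of "B-1"] del: fact_Suc)
    have 4: "fps_nth (fps_X * (fps_X * fps_deriv f)) (Suc j) = of_nat j * fps_nth f j"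
      by (cases j) simp_all
    have "fps_nth (fps_const (C - B) * f - fps_const A * (fps_X * f) + fps_X * fps_deriv f - fps_X * (fps_X * fps_deriv f)) k
       = (C - B) * fps_nth f (Suc j) - A * fps_nth f j + (of_nat j + 1) * fps_nth f (Suc j) - of_nat j * fps_nth f j"
      unfolding Suc fps_add_nth fps_sub_nth 4 by (simp add: algebra_simps)
    also have "\<dots> = (C - B) * ((A + of_nat j) * (B - 1) * e)"
      unfolding 1 2 by (simp add: algebra_simps)
    finally show ?thesis by (simp add: Suc 3)
  qed
qed

text \<open>Differentiation takes place on the formal series, so that equations are proved by
  comparing coefficients and evaluated in the unit disc only afterwards.\<close>

definition S2F1 :: "complex \<Rightarrow> complex \<Rightarrow> complex \<Rightarrow> nat \<Rightarrow> complex \<Rightarrow> complex" where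
  "S2F1 A B C n w = eval_fps ((fps_deriv ^^ n) (fps_2F1 A B C)) w"

lemma fps_conv_radius_2F1_deriv:
  assumes "C \<notin> \<int>\<^sub>\<le>\<^sub>0"
  shows "fps_conv_radius ((fps_deriv ^^ n) (fps_2F1 A B C)) \<ge> 1"
proof (induction n)
  case (Suc n)
  thus ?case using fps_conv_radius_deriv[of "(fps_deriv ^^ n) (fps_2F1 A B C)"] by simp
qed (use fps_conv_radius_2F1[OF assms] in simp)

lemma has_field_derivative_S2F1:
  assumes C: "C \<notin> \<int>\<^sub>\<le>\<^sub>0" and z: "norm (g z) < 1"
    and g: "(g has_field_derivative g') (at z)"
  shows "((\<lambda>z. S2F1 A B C n (g z)) has_field_derivative S2F1 A B C (Suc n) (g z) * g') (at z)"
proof -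
  have "ereal (norm (g z)) < fps_conv_radius ((fps_deriv ^^ n) (fps_2F1 A B C))"
    by (rule less_le_trans[OF _ fps_conv_radius_2F1_deriv[OF C]]) (use z in simp)
  hence "(S2F1 A B C n has_field_derivative S2F1 A B C (Suc n) (g z)) (at (g z))"
    unfolding S2F1_def by (auto intro: has_field_derivative_eval_fps)
  from DERIV_chain2[OF this g] show ?thesis .
qed

lemma conv_radius_arith:
  fixes f g :: "complex fps"
  assumes "ereal r < fps_conv_radius f" "ereal r < fps_conv_radius g"
  shows "ereal r < fps_conv_radius (f * g)" "ereal r < fps_conv_radius (f + g)" "ereal r < fps_conv_radius (f - g)"
  using assms fps_conv_radius_mult[of f g] fps_conv_radius_add[of f g] fps_conv_radius_diff[of f g]
  by (auto intro: less_le_trans[of _ "min (fps_conv_radius f) (fps_conv_radius g)"])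

lemma S2F1_ode:
  assumes C: "C \<notin> \<int>\<^sub>\<le>\<^sub>0" and w: "norm w < 1"
  shows "w * (1 - w) * S2F1 A B C 2 w + (C - (A + B + 1) * w) * S2F1 A B C 1 w = A * B * S2F1 A B C 0 w"
proof -
  let ?f = "fps_2F1 A B C"
  have r: "ereal (norm w) < fps_conv_radius ((fps_deriv ^^ n) ?f)" for n
    by (rule less_le_trans[OF _ fps_conv_radius_2F1_deriv[OF C]]) (use w in simp)
  note r = r[of 0, simplified] r[of 1, simplified] r[of 2, unfolded numeral_2_eq_2, simplified]
  have "eval_fps (fps_X * fps_deriv (fps_deriv ?f) - fps_X * (fps_X * fps_deriv (fps_deriv ?f))
     + fps_const C * fps_deriv ?f - fps_const (A + B + 1) * (fps_X * fps_deriv ?f)) w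
     = eval_fps (fps_const (A * B) * ?f) w"
    by (subst fps_2F1_ode[OF C]) (rule refl)
  thus ?thesis
    by (simp add: eval_fps_add eval_fps_diff eval_fps_mult conv_radius_arith r S2F1_def numeral_2_eq_2 algebra_simps
             del: fps_const_mult fps_const_add)
qed

lemma S2F1_contiguous:
  assumes C: "C \<notin> \<int>\<^sub>\<le>\<^sub>0" and w: "norm w < 1"
  shows "(C - B - A * w) * S2F1 A B C 0 w + w * (1 - w) * S2F1 A B C 1 w = (C - B) * S2F1 A (B - 1) C 0 w"
proof -
  let ?f = "fps_2F1 A B C"
  have r: "ereal (norm w) < fps_conv_radius ((fps_deriv ^^ n) (fps_2F1 A B C))" for n A B
    by (rule less_le_trans[OF _ fps_conv_radius_2F1_deriv[OF C]]) (use w in simp)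
  note r = r[of 0, simplified] r[of 1, simplified]
  have "eval_fps (fps_const (C - B) * ?f - fps_const A * (fps_X * ?f) + fps_X * fps_deriv ?f - fps_X * (fps_X * fps_deriv ?f)) w
     = eval_fps (fps_const (C - B) * fps_2F1 A (B - 1) C) w"
    by (subst fps_2F1_contiguous[OF C]) (rule refl)
  thus ?thesis
    by (simp add: eval_fps_add eval_fps_diff eval_fps_mult conv_radius_arith r S2F1_def algebra_simps
             del: fps_const_mult fps_const_add fps_const_sub)
qed

text \<open>The function \<open>\<^sub>2F\<^sub>1(A, B; C; -z\<^sup>2)\<close> in Pfaff's form and its first two derivatives in \<open>z\<close>.
  With \<open>q = 1 + z\<^sup>2\<close> and \<open>w = z\<^sup>2/q\<close> one has \<open>dw/dz = 2z/q\<^sup>2\<close> and \<open>1 - w = 1/q\<close>.\<close>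

definition Y2F1 :: "complex \<Rightarrow> complex \<Rightarrow> complex \<Rightarrow> complex \<Rightarrow> complex" where
  "Y2F1 A B C z = exp (- A * Ln (1 + z\<^sup>2)) * S2F1 A (C - B) C 0 (z\<^sup>2 / (1 + z\<^sup>2))"

definition Y2F1' :: "complex \<Rightarrow> complex \<Rightarrow> complex \<Rightarrow> complex \<Rightarrow> complex" where
  "Y2F1' A B C z = (let q = 1 + z\<^sup>2; S = (\<lambda>n. S2F1 A (C - B) C n (z\<^sup>2 / q)) in
     exp (- A * Ln q) * (2 * z) * (- A * S 0 / q + S 1 / q\<^sup>2))"

definition Y2F1'' :: "complex \<Rightarrow> complex \<Rightarrow> complex \<Rightarrow> complex \<Rightarrow> complex" where
  "Y2F1'' A B C z = (let q = 1 + z\<^sup>2; S = (\<lambda>n. S2F1 A (C - B) C n (z\<^sup>2 / q)) in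
     exp (- A * Ln q) * (- A * (2 * z) / q * (2 * z) * (- A * S 0 / q + S 1 / q\<^sup>2)
       + 2 * (- A * S 0 / q + S 1 / q\<^sup>2)
       + 2 * z * (A * S 0 * (2 * z) / q\<^sup>2 - A * S 1 * (2 * z) / q ^ 3
           + S 2 * (2 * z) / q ^ 4 - S 1 * (4 * z) / q ^ 3)))"

section \<open>The Pfaff form at real points, where Ln stays off its cut and w lies in [0,
  1)\<close>

context
  fixes x :: real and z :: complex
  assumes z_eq: "z = complex_of_real x"
begin

lemma q_pos: "0 < 1 + x\<^sup>2"
  using zero_le_power2[of x] by linarith

lemma q_eq: "1 + z\<^sup>2 = complex_of_real (1 + x\<^sup>2)"
  by (simp add: z_eq)

lemma q_nz: "1 + z\<^sup>2 \<noteq> 0"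
  unfolding q_eq using q_pos by (metis less_irrefl of_real_eq_0_iff)

lemma q_nonpos: "1 + z\<^sup>2 \<notin> \<real>\<^sub>\<le>\<^sub>0"
  unfolding q_eq using q_pos by (simp only: complex_nonpos_Reals_iff) auto

lemma w_eq: "z\<^sup>2 / (1 + z\<^sup>2) = complex_of_real (x\<^sup>2 / (1 + x\<^sup>2))"
  unfolding q_eq by (simp add: z_eq)

lemma w_norm: "norm (z\<^sup>2 / (1 + z\<^sup>2)) < 1"
  unfolding w_eq norm_of_real using q_pos by simp

lemma w_deriv: "((\<lambda>z. z\<^sup>2 / (1 + z\<^sup>2)) has_field_derivative 2 * z / (1 + z\<^sup>2)\<^sup>2) (at z)"
  using q_nz by (auto intro!: derivative_eq_intros simp: field_simps power2_eq_square)

lemmas S_deriv = has_field_derivative_S2F1[where g = "\<lambda>z. z\<^sup>2 / (1 + z\<^sup>2)", OF _ w_norm w_deriv]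

lemma Y2F1_deriv:
  assumes C: "C \<notin> \<int>\<^sub>\<le>\<^sub>0"
  shows "(Y2F1 A B C has_field_derivative Y2F1' A B C z) (at z)"
  unfolding Y2F1_def [abs_def] Y2F1'_def Let_def using q_nz q_nonpos
  by (auto intro!: derivative_eq_intros S_deriv[OF C] simp: divide_simps) (simp add: algebra_simps power2_eq_square)

lemma Y2F1'_deriv:
  assumes C: "C \<notin> \<int>\<^sub>\<le>\<^sub>0"
  shows "(Y2F1' A B C has_field_derivative Y2F1'' A B C z) (at z)"
proof -
  define q where "q = 1 + z\<^sup>2"
  have qnz: "q \<noteq> 0" using q_nz by (simp add: q_def)
  define E S0 S1 S2 where "E = exp (- (A * Ln (1 + z\<^sup>2)))" "S0 = S2F1 A (C - B) C 0 (z\<^sup>2 / (1 + z\<^sup>2))"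
     "S1 = S2F1 A (C - B) C 1 (z\<^sup>2 / (1 + z\<^sup>2))" "S2 = S2F1 A (C - B) C 2 (z\<^sup>2 / (1 + z\<^sup>2))"
  note defs = q_def this
  show ?thesis
  unfolding Y2F1'_def [abs_def] Y2F1''_def Let_def
  apply (rule derivative_eq_intros S_deriv[OF C] refl q_nonpos | (use q_nz in \<open>force\<close>))+
  unfolding mult_minus_left numeral_2_eq_2[symmetric] One_nat_def[symmetric] Suc_1 unfolding defs[symmetric]
  using qnz by (simp add: field_simps power2_eq_square power3_eq_cube power4_eq_xxxx)
qed

lemma Y2F1''_isCont:
  assumes C: "C \<notin> \<int>\<^sub>\<le>\<^sub>0"
  shows "isCont (Y2F1'' A B C) z"
proof -
  have [continuous_intros]: "isCont (\<lambda>z. S2F1 A (C - B) C n (z\<^sup>2 / (1 + z\<^sup>2))) z" for n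
    using S_deriv[OF C] by (rule DERIV_isCont)
  show ?thesis unfolding Y2F1''_def [abs_def] Let_def
    using q_nz q_nonpos by (auto intro!: continuous_intros)
qed

text \<open>The hypergeometric equation with parameters A, C - B, C is pulled back along w = z^2/q,
  and the prefactor q^(-A) restores the parameters A, B. The equation is kept multiplied by z, so
  that it also makes sense at z = 0.\<close>

lemma Y2F1_ode:
  assumes C: "C \<notin> \<int>\<^sub>\<le>\<^sub>0"
  shows "z * (1 + z\<^sup>2) * Y2F1'' A B C z + ((2 * C - 1) + (2 * (A + B) + 1) * z\<^sup>2) * Y2F1' A B C z
           + 4 * A * B * z * Y2F1 A B C z = 0"
proof -
  define q where "q = 1 + z\<^sup>2"
  have q: "q \<noteq> 0" "z\<^sup>2 = q - 1" using q_nz by (simp_all add: q_def)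
  define S where "S = (\<lambda>n. S2F1 A (C - B) C n (z\<^sup>2 / q))"
  have "z\<^sup>2 / q * (1 - z\<^sup>2 / q) * S 2 + (C - (A + (C - B) + 1) * (z\<^sup>2 / q)) * S 1 = A * (C - B) * S 0"
    unfolding S_def q_def by (rule S2F1_ode[OF C w_norm])
  hence e1: "q\<^sup>2 * ((q - 1) / q * (1 - (q - 1) / q) * S 2 + (C - (A + (C - B) + 1) * ((q - 1) / q)) * S 1) = q\<^sup>2 * (A * (C - B) * S 0)"
    unfolding q(2) by (rule arg_cong)
  have e2: "q\<^sup>2 * ((q - 1) / q * (1 - (q - 1) / q) * S 2 + (C - (A + (C - B) + 1) * ((q - 1) / q)) * S 1)
     = (q - 1) * S 2 + (C * q - (A + (C - B) + 1) * (q - 1)) * q * S 1"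
    using q(1) by (simp add: field_simps power2_eq_square)
  have "(q - 1) * S 2 + (C * q - (A + (C - B) + 1) * (q - 1)) * q * S 1 = q\<^sup>2 * (A * (C - B) * S 0)"
    using e2[symmetric] e1 by (rule trans)
  \<comment> \<open>\<open>S 2\<close> enters \<open>U\<close> only together with z^2 = q - 1, so
    the equation is solved for this product and no division by z occurs.\<close>
  hence S2: "(q - 1) * S 2 = A * (C - B) * q\<^sup>2 * S 0 - (C * q - (A + (C - B) + 1) * (q - 1)) * q * S 1"
    by (simp add: algebra_simps)
  define T where "T = - A * S 0 / q + S 1 / q\<^sup>2"
  define U where "U = - A * (2 * z) / q * (2 * z) * T + 2 * T
       + 2 * z * (A * S 0 * (2 * z) / q\<^sup>2 - A * S 1 * (2 * z) / q ^ 3 + S 2 * (2 * z) / q ^ 4 - S 1 * (4 * z) / q ^ 3)"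
  define E where "E = exp (- A * Ln q)"
  have Y: "Y2F1 A B C z = E * S 0" "Y2F1' A B C z = E * (2 * z) * T" "Y2F1'' A B C z = E * U"
    unfolding Y2F1_def Y2F1'_def Y2F1''_def Let_def q_def[symmetric] U_def T_def E_def S_def by simp_all
  have "U = - 4 * A * z\<^sup>2 / q * T + 2 * T + 4 * A * z\<^sup>2 * S 0 / q\<^sup>2 - 4 * A * z\<^sup>2 * S 1 / q ^ 3
           + 4 * (z\<^sup>2 * S 2) / q ^ 4 - 8 * z\<^sup>2 * S 1 / q ^ 3"
    unfolding U_def using q(1) by (simp add: field_simps power2_eq_square)
  hence U: "U = - 4 * A * (q - 1) / q * T + 2 * T + 4 * A * (q - 1) * S 0 / q\<^sup>2 - 4 * A * (q - 1) * S 1 / q ^ 3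
           + 4 * ((q - 1) * S 2) / q ^ 4 - 8 * (q - 1) * S 1 / q ^ 3"
    unfolding q(2) .
  have bracket: "q * U + ((2 * C - 1) + (2 * (A + B) + 1) * (q - 1)) * (2 * T) + 4 * A * B * S 0 = 0"
    unfolding U S2 T_def using q(1)
    by (simp add: field_simps power2_eq_square power3_eq_cube power4_eq_xxxx)
  have "z * q * Y2F1'' A B C z + ((2 * C - 1) + (2 * (A + B) + 1) * z\<^sup>2) * Y2F1' A B C z
           + 4 * A * B * z * Y2F1 A B C z
     = z * E * (q * U + ((2 * C - 1) + (2 * (A + B) + 1) * z\<^sup>2) * (2 * T) + 4 * A * B * S 0)"
    unfolding Y by (simp add: algebra_simps)
  also have "\<dots> = 0" unfolding q(2) bracket by simp
  finally show ?thesis unfolding q_def .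
qed

lemma Y2F1_of_real:
  "Y2F1 A B C z = of_real (1 + x\<^sup>2) powr (- A) * hyp2F1_series A (C - B) C (of_real (x\<^sup>2 / (1 + x\<^sup>2)))"
  unfolding Y2F1_def hyp2F1_series_eq_eval S2F1_def q_eq
  using q_nz unfolding q_eq powr_def by (simp add: z_eq)

end

lemma hyp2F1_eq_Y2F1: "hyp2F1 A B C (- (x\<^sup>2)) = Y2F1 A B C (of_real x)"
proof -
  have "- (x\<^sup>2) / (- (x\<^sup>2) - 1) = x\<^sup>2 / (1 + x\<^sup>2)"
    by (metis minus_add_distrib minus_divide_divide diff_conv_add_uminus add.commute)
  thus ?thesis unfolding hyp2F1_def Y2F1_of_real[OF refl] by simp
qed

section \<open>Energy estimates and regular solutions\<close>

text \<open>The function \<open>v = (1 + x\<^sup>2)\<^bsup>a\<^esup> y\<close> satisfies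
  \<open>(1 + x\<^sup>2) v'' + (x + (2c-1)/x) v' + (t\<^sup>2 - 4a(c-a)/(1 + x\<^sup>2)) v = 0\<close>. Since the coefficient
  \<open>(2c-1)/x\<close> is a damping, the energy \<open>(1 + x\<^sup>2) v'\<^sup>2 + t\<^sup>2 v\<^sup>2\<close> grows at most like
  \<open>exp (4a|c-a|/t arctan x)\<close>. For \<open>y0 = 0\<close> this is the uniqueness of regular solutions.\<close>
lemma energy_bound_real:
  fixes y y' y'' :: "real \<Rightarrow> real" and a c t y0 :: real
  assumes D: "\<And>x. x > 0 \<Longrightarrow> (y has_real_derivative y' x) (at x)"
    and D': "\<And>x. x > 0 \<Longrightarrow> (y' has_real_derivative y'' x) (at x)"
    and ode: "\<And>x. x > 0 \<Longrightarrow> (1 + x\<^sup>2) * y'' x + ((2*c-1) / x + (4*a+1) * x) * y' x + (4*a\<^sup>2 + t\<^sup>2) * y x = 0"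
    and lim: "(y \<longlongrightarrow> y0) (at_right 0)" "(y' \<longlongrightarrow> 0) (at_right 0)"
    and a: "a > 0" and c: "c \<ge> 1/2" and t: "t > 0" and x: "x > 0"
  shows "\<bar>y x\<bar> \<le> \<bar>y0\<bar> * exp (pi * a * \<bar>c - a\<bar> / t) * (1 + x\<^sup>2) powr (- a)"
proof -
  define q where "q = (\<lambda>x::real. 1 + x\<^sup>2)"
  have q: "q x \<ge> 1" "q x > 0" "q x \<noteq> 0" for x
    using zero_le_power2[of x] by (simp_all add: q_def add_nonneg_eq_0_iff add_pos_nonneg)
  have Dq: "(q has_real_derivative 2 * x) (at x)" for x
    unfolding q_def by (auto intro!: derivative_eq_intros)
  define v where "v = (\<lambda>x. q x powr a * y x)"
  define v' where "v' = (\<lambda>x. q x powr a * (y' x + 2 * a * x / q x * y x))"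
  define v'' where "v'' = (\<lambda>x. q x powr a * (2 * a * x / q x * (y' x + 2 * a * x / q x * y x)
        + (y'' x + 2 * a * (1 / q x - 2 * x\<^sup>2 / (q x)\<^sup>2) * y x + 2 * a * x / q x * y' x)))"
  have pw: "q x powr (a - 1) = q x powr a / q x" for x
    using q[of x] by (simp add: powr_diff)
  have Dv: "(v has_real_derivative v' x) (at x)" if "x > 0" for x
    unfolding v_def v'_def using q[of x]
    by (auto intro!: derivative_eq_intros D[OF that] Dq simp: pw field_simps)
  have Dv': "(v' has_real_derivative v'' x) (at x)" if "x > 0" for x
  proof -
    define u where "u = (\<lambda>x. y' x + 2 * a * x / q x * y x)"
    define u' where "u' = y'' x + 2 * a * (1 / q x - 2 * x\<^sup>2 / (q x)\<^sup>2) * y x + 2 * a * x / q x * y' x"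
    have Du: "(u has_real_derivative u') (at x)"
      unfolding u_def u'_def
      by (rule derivative_eq_intros D[OF that] D'[OF that] Dq refl q(3))+ (use q(3)[of x] in \<open>simp add: power2_eq_square field_simps\<close>)
    have Dp: "((\<lambda>x. q x powr a) has_real_derivative q x powr a * (2 * a * x / q x)) (at x)"
      by (rule DERIV_cong[OF DERIV_fun_powr[OF Dq q(2)]]) (use q(3)[of x] in \<open>simp add: pw\<close>)
    show ?thesis unfolding v'_def v''_def u_def[symmetric] u'_def[symmetric]
      using DERIV_mult[OF Dp Du] by (simp add: u_def algebra_simps)
  qed
  have v_ode: "q x * v'' x = - (x + (2*c-1) / x) * v' x - (t\<^sup>2 - 4 * a * (c - a) / q x) * v x" if x: "x > 0" for x
  proof -
    have x2: "x\<^sup>2 = q x - 1" by (simp add: q_def)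
    have o: "q x * y'' x = - ((2*c-1) / x + (4*a+1) * x) * y' x - (4*a\<^sup>2 + t\<^sup>2) * y x"
      using ode[OF x] by (simp add: q_def algebra_simps)
    define Q where "Q = q x"
    have Q: "Q > 0" using q[of x] by (simp add: Q_def)
    \<comment> \<open>Quotients are replaced by letters subject to x^2 i = 1 - i, Q i = 1 and r x =
      2c - 1, which makes the computation polynomial.\<close>
    define i r where "i = 1 / Q" and "r = (2 * c - 1) / x"
    have i: "x\<^sup>2 * i = 1 - i" "Q * i = 1" using Q x2 by (simp_all add: i_def Q_def field_simps)
    have r: "r * x = 2 * c - 1" using x by (simp add: r_def)
    have "Q * (2 * a * x * i * (y' x + 2 * a * x * i * y x)
        + (y'' x + 2 * a * (i - 2 * x\<^sup>2 * i\<^sup>2) * y x + 2 * a * x * i * y' x))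
        = 2 * a * x * (Q * i) * (y' x + 2 * a * x * i * y x) + Q * y'' x
            + 2 * a * (Q * i - 2 * x\<^sup>2 * i * (Q * i)) * y x + 2 * a * x * (Q * i) * y' x"
      by (simp add: algebra_simps power2_eq_square)
    also have "\<dots> = (4 * a * x - r - (4*a+1) * x) * y' x
        + ((4 * a\<^sup>2 - 4 * a) * (x\<^sup>2 * i) + 2 * a - 4 * a\<^sup>2 - t\<^sup>2) * y x"
      unfolding o[folded Q_def r_def] i(2) by (simp add: algebra_simps power2_eq_square)
    also have "\<dots> = - (x + r) * y' x - (2 * a * (x\<^sup>2 * i) + 2 * a * (2 * c - 1) * i + (t\<^sup>2 - 4 * a * (c - a) * i)) * y x"
      unfolding i(1) by (simp add: algebra_simps power2_eq_square)
    also have "\<dots> = - (x + r) * (y' x + 2 * a * x * i * y x) - (t\<^sup>2 - 4 * a * (c - a) * i) * y x"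
      unfolding r[symmetric] by (simp add: algebra_simps power2_eq_square)
    finally have eq: "Q * (2 * a * x / Q * (y' x + 2 * a * x / Q * y x)
        + (y'' x + 2 * a * (1 / Q - 2 * x\<^sup>2 / Q\<^sup>2) * y x + 2 * a * x / Q * y' x))
        = - (x + r) * (y' x + 2 * a * x / Q * y x) - (t\<^sup>2 - 4 * a * (c - a) / Q) * y x"
      by (simp add: i_def power_one_over)
    have "q x * v'' x = q x powr a * (Q * (2 * a * x / Q * (y' x + 2 * a * x / Q * y x)
        + (y'' x + 2 * a * (1 / Q - 2 * x\<^sup>2 / Q\<^sup>2) * y x + 2 * a * x / Q * y' x)))"
      unfolding v''_def Q_def by (simp only: mult.left_commute)
    also have "\<dots> = - (x + r) * v' x - (t\<^sup>2 - 4 * a * (c - a) / q x) * v x"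
      unfolding eq unfolding v_def v'_def Q_def by (simp add: algebra_simps)
    finally show ?thesis unfolding r_def .
  qed
  \<comment> \<open>Young's inequality gives |v v'| <= E/(2t), so the perturbation 4a(c-a)/q of the
    potential contributes at most (k/q) E to E'. As 1/q is the derivative of arctan, the factor
    exp(-k arctan x) makes the energy non-increasing, and arctan <= pi/2 produces the exponential
    constant.\<close>
  define k where "k = 4 * a * \<bar>c - a\<bar> / t"
  define E where "E = (\<lambda>x. q x * (v' x)\<^sup>2 + t\<^sup>2 * (v x)\<^sup>2)"
  define F where "F = (\<lambda>x. E x * exp (- k * arctan x))"
  define F' where "F' = (\<lambda>x. (2 * x * (v' x)\<^sup>2 + 2 * v' x * (q x * v'' x) + 2 * t\<^sup>2 * v x * v' x - k / q x * E x) * exp (- k * arctan x))"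
  have DF: "(F has_real_derivative F' x) (at x)" if "x > 0" for x
  proof -
    define R where "R = exp (- k * arctan x)"
    have DE: "(E has_real_derivative 2 * x * (v' x)\<^sup>2 + 2 * v' x * (q x * v'' x) + 2 * t\<^sup>2 * v x * v' x) (at x)"
      unfolding E_def by (rule derivative_eq_intros Dv[OF that] Dv'[OF that] Dq refl)+ (simp add: algebra_simps)
    have DR: "((\<lambda>x. exp (- k * arctan x)) has_real_derivative - k / q x * R) (at x)"
      unfolding R_def by (rule derivative_eq_intros refl)+ (simp add: q_def field_simps)
    show ?thesis unfolding F_def F'_def R_def[symmetric]
      by (rule DERIV_cong[OF DERIV_mult[OF DE DR]]) (simp add: algebra_simps R_def)
  qed
  have F'_le: "F' x \<le> 0" if x: "x > 0" for x
  proof -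
    have "2 * x * (v' x)\<^sup>2 + 2 * v' x * (q x * v'' x) + 2 * t\<^sup>2 * v x * v' x
        = - 2 * ((2*c-1) / x * (v' x)\<^sup>2) + 8 * a * (c - a) / q x * (v x * v' x)"
    proof -
      define r where "r = (2 * c - 1) / x"
      show ?thesis unfolding v_ode[OF x] r_def[symmetric] by (simp add: algebra_simps power2_eq_square)
    qed
    also have "\<dots> \<le> 0 + 8 * a * \<bar>c - a\<bar> / q x * (E x / (2 * t))"
    proof (intro add_mono)
      show "- 2 * ((2*c-1) / x * (v' x)\<^sup>2) \<le> 0" using c x by simp
      have "0 \<le> (\<bar>v' x\<bar> - t * \<bar>v x\<bar>)\<^sup>2" by simp
      hence "2 * t * \<bar>v x * v' x\<bar> \<le> (v' x)\<^sup>2 + t\<^sup>2 * (v x)\<^sup>2"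
        by (simp add: power2_eq_square abs_mult algebra_simps)
      also have "(v' x)\<^sup>2 \<le> q x * (v' x)\<^sup>2" using q[of x] by (simp add: mult_le_cancel_right1)
      finally have le: "\<bar>v x * v' x\<bar> \<le> E x / (2 * t)" using t by (simp add: E_def field_simps)
      have "8 * a * (c - a) / q x * (v x * v' x) \<le> \<bar>8 * a * (c - a) / q x\<bar> * \<bar>v x * v' x\<bar>"
        by (metis abs_ge_self abs_mult)
      also have "\<dots> \<le> 8 * a * \<bar>c - a\<bar> / q x * (E x / (2 * t))"
      proof -
        have "\<bar>8 * a * (c - a) / q x\<bar> = 8 * a * \<bar>c - a\<bar> / q x" using a q[of x] by (simp add: abs_mult)
        thus "\<bar>8 * a * (c - a) / q x\<bar> * \<bar>v x * v' x\<bar> \<le> 8 * a * \<bar>c - a\<bar> / q x * (E x / (2 * t))"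
          using le a q[of x] by (intro mult_mono) auto
      qed
      finally show "8 * a * (c - a) / q x * (v x * v' x) \<le> 8 * a * \<bar>c - a\<bar> / q x * (E x / (2 * t))" .
    qed
    also have "\<dots> = k / q x * E x" using t q[of x] by (simp add: k_def field_simps)
    finally show ?thesis unfolding F'_def by (intro mult_nonpos_nonneg) auto
  qed
  have dec: "F x \<le> F e" if "0 < e" "e < x" for e
  proof (rule DERIV_nonpos_imp_decreasing_open[of e x F])
    show "e \<le> x" using that by simp
    fix u assume "e < u" "u < x"
    thus "\<exists>z. DERIV F u :> z \<and> z \<le> 0"
      using DF[of u] F'_le[of u] \<open>0 < e\<close> by (auto intro!: exI[of _ "F' u"])
  next
    show "continuous_on {e..x} F"
      using that by (intro continuous_at_imp_continuous_on ballI DERIV_isCont[OF DF]) auto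
  qed
  have q0: "(q \<longlongrightarrow> 1) (at_right 0)" unfolding q_def by (auto intro!: tendsto_eq_intros)
  have "(v \<longlongrightarrow> 1 powr a * y0) (at_right 0)"
    unfolding v_def by (intro tendsto_intros lim q0) auto
  moreover have "(v' \<longlongrightarrow> 1 powr a * (0 + 2 * a * 0 / 1 * y0)) (at_right 0)"
    unfolding v'_def by (intro tendsto_intros lim q0) auto
  ultimately have "(F \<longlongrightarrow> (1 * 0\<^sup>2 + t\<^sup>2 * y0\<^sup>2) * exp (- k * arctan 0)) (at_right 0)"
    unfolding F_def E_def by (intro tendsto_intros q0) auto
  moreover have "eventually (\<lambda>e. F x \<le> F e) (at_right 0)"
    using dec x by (auto simp: eventually_at_right)
  ultimately have "F x \<le> t\<^sup>2 * y0\<^sup>2"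
    using tendsto_lowerbound[of F "t\<^sup>2 * y0\<^sup>2" "at_right 0" "F x"] by simp
  hence "E x \<le> t\<^sup>2 * y0\<^sup>2 * exp (k * arctan x)"
    unfolding F_def by (simp add: exp_minus field_simps)
  also have "\<dots> \<le> t\<^sup>2 * y0\<^sup>2 * exp (k * (pi / 2))"
  proof -
    have "k * arctan x \<le> k * (pi / 2)"
      using a t arctan_ubound[of x] by (intro mult_left_mono) (auto simp: k_def)
    thus ?thesis by (intro mult_left_mono) auto
  qed
  finally have le: "E x \<le> t\<^sup>2 * y0\<^sup>2 * exp (k * (pi / 2))" .
  have "t\<^sup>2 * (v x)\<^sup>2 \<le> E x"
    unfolding E_def using q(2)[of x] by (simp add: less_imp_le)
  also note le
  finally have "(v x)\<^sup>2 \<le> y0\<^sup>2 * exp (k * (pi / 2))" using t by (simp add: mult.assoc)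
  also have "\<dots> = (\<bar>y0\<bar> * exp (pi * a * \<bar>c - a\<bar> / t))\<^sup>2"
  proof -
    have "k * (pi / 2) = 2 * (pi * a * \<bar>c - a\<bar> / t)" by (simp add: k_def)
    thus ?thesis by (simp only: power_mult_distrib exp_double power2_abs)
  qed
  finally have "\<bar>v x\<bar> \<le> \<bar>\<bar>y0\<bar> * exp (pi * a * \<bar>c - a\<bar> / t)\<bar>"
    by (simp only: abs_le_square_iff)
  hence "\<bar>y x\<bar> * q x powr a \<le> \<bar>y0\<bar> * exp (pi * a * \<bar>c - a\<bar> / t)"
    by (simp add: v_def abs_mult mult.commute)
  thus ?thesis using q[of x] by (simp add: powr_minus divide_simps q_def)
qed

text \<open>The equation has real coefficients, so real and imaginary part obey the real estimate
  separately; adding the squares keeps the same constant.\<close>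

lemma energy_bound:
  fixes y y' y'' :: "real \<Rightarrow> complex" and a c t :: real
  assumes D: "\<And>x. x > 0 \<Longrightarrow> (y has_vector_derivative y' x) (at x)"
    and D': "\<And>x. x > 0 \<Longrightarrow> (y' has_vector_derivative y'' x) (at x)"
    and ode: "\<And>x. x > 0 \<Longrightarrow> of_real (1 + x\<^sup>2) * y'' x + of_real ((2*c-1) / x + (4*a+1) * x) * y' x + of_real (4*a\<^sup>2 + t\<^sup>2) * y x = 0"
    and lim: "(y \<longlongrightarrow> y0) (at_right 0)" "(y' \<longlongrightarrow> 0) (at_right 0)"
    and a: "a > 0" and c: "c \<ge> 1/2" and t: "t > 0" and x: "x > 0"
  shows "norm (y x) \<le> norm y0 * exp (pi * a * \<bar>c - a\<bar> / t) * (1 + x\<^sup>2) powr (- a)"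
proof -
  let ?K = "exp (pi * a * \<bar>c - a\<bar> / t) * (1 + x\<^sup>2) powr (- a)"
  have part: "(L (y x))\<^sup>2 \<le> (\<bar>L y0\<bar> * ?K)\<^sup>2"
    if L: "bounded_linear L" "\<And>r z. L (of_real r * z) = r * L z" for L :: "complex \<Rightarrow> real"
  proof -
    have "\<bar>L (y x)\<bar> \<le> \<bar>L y0\<bar> * exp (pi * a * \<bar>c - a\<bar> / t) * (1 + x\<^sup>2) powr (- a)"
    proof (rule energy_bound_real[OF _ _ _ _ _ a c t x])
      show "((\<lambda>x. L (y x)) \<longlongrightarrow> L y0) (at_right 0)" "((\<lambda>x. L (y' x)) \<longlongrightarrow> 0) (at_right 0)"
        using bounded_linear.tendsto[OF L(1) lim(1)] bounded_linear.tendsto[OF L(1) lim(2)]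
        by (simp_all add: linear_0[OF bounded_linear.linear[OF L(1)]])
      fix x :: real assume x: "x > 0"
      show "((\<lambda>x. L (y x)) has_real_derivative L (y' x)) (at x)" "((\<lambda>x. L (y' x)) has_real_derivative L (y'' x)) (at x)"
        unfolding has_real_derivative_iff_has_vector_derivative
        by (intro bounded_linear.has_vector_derivative[OF L(1)] D D' x)+
      show "(1 + x\<^sup>2) * L (y'' x) + ((2 * c - 1) / x + (4 * a + 1) * x) * L (y' x) + (4 * a\<^sup>2 + t\<^sup>2) * L (y x) = 0"
        using arg_cong[OF ode[OF x], of L]
        by (simp only: linear_add[OF bounded_linear.linear[OF L(1)]] linear_0[OF bounded_linear.linear[OF L(1)]] L(2))
    qed
    thus ?thesis by (intro power2_le_iff_abs_le[THEN iffD2]) (auto simp: mult.assoc)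
  qed
  note re = part[OF bounded_linear_Re] and im = part[OF bounded_linear_Im]
  have "(norm (y x))\<^sup>2 \<le> (norm y0 * ?K)\<^sup>2"
    using re im by (simp add: cmod_power2 power_mult_distrib algebra_simps)
  hence "norm (y x) \<le> norm y0 * ?K" by (rule power2_le_imp_le) simp
  thus ?thesis by (simp add: mult.assoc)
qed


text \<open>Solutions that are regular at \<open>0\<close> of the equation satisfied by
  \<open>\<^sub>2F\<^sub>1(\<mu>/2, (\<mu>+1)/2; c; -x\<^sup>2)\<close>. Equivalently, \<open>(P, x) \<mapsto> P\<^sup>-\<^sup>\<mu> y(x/P)\<close> is harmonic
  for \<open>\<partial>\<^sub>P\<^sup>2 + \<partial>\<^sub>x\<^sup>2 + (2c-1)/x \<partial>\<^sub>x\<close>.\<close>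

locale radial_solution =
  fixes c \<mu> :: real and y y' y'' :: "real \<Rightarrow> real"
  assumes deriv: "\<And>x. (y has_real_derivative y' x) (at x)"
    and deriv': "\<And>x. (y' has_real_derivative y'' x) (at x)"
    and cont'': "\<And>x. isCont y'' x"
    and ode: "\<And>x. x * (1 + x\<^sup>2) * y'' x + ((2*c - 1) + (2*\<mu> + 2) * x\<^sup>2) * y' x + \<mu> * (\<mu> + 1) * x * y x = 0"
    and ex_bound: "\<exists>K>0. \<forall>x. \<bar>y x\<bar> \<le> K * (1 + x\<^sup>2) powr (-\<mu>/2) \<and> \<bar>y' x\<bar> \<le> K * \<bar>x\<bar> * (1 + x\<^sup>2) powr (-\<mu>/2 - 1)"
    and mu_pos: "\<mu> > 0"
begin

lemma continuous: "isCont y x" "isCont y' x"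
  using deriv deriv' by (blast intro: DERIV_isCont)+

text \<open>Away from 0 the equation is divided by x to bound y''; this is possible because the
  bound for y' in \<open>ex_bound\<close> carries the factor |x|. At 0 the equation says nothing
  about y'', whose value there is added to the constant.\<close>

lemma bounds:
  obtains K where "K > 0" "\<And>x. \<bar>y x\<bar> \<le> K * (1 + x\<^sup>2) powr (-\<mu>/2)"
    "\<And>x. \<bar>y' x\<bar> \<le> K * \<bar>x\<bar> * (1 + x\<^sup>2) powr (-\<mu>/2 - 1)"
    "\<And>x. \<bar>y'' x\<bar> \<le> K * (1 + x\<^sup>2) powr (-\<mu>/2 - 1)"
proof -
  obtain K where K: "K > 0" "\<And>x. \<bar>y x\<bar> \<le> K * (1 + x\<^sup>2) powr (-\<mu>/2)"
    "\<And>x. \<bar>y' x\<bar> \<le> K * \<bar>x\<bar> * (1 + x\<^sup>2) powr (-\<mu>/2 - 1)" using ex_bound by blast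
  define K' where "K' = (\<bar>2 * c - 1\<bar> + (2 * \<mu> + 2)) * K + \<mu> * (\<mu> + 1) * K"
  have K'0: "K' \<ge> 0" using K mu_pos by (simp add: K'_def)
  have b: "\<bar>y'' x\<bar> \<le> (K' + \<bar>y'' 0\<bar>) * (1 + x\<^sup>2) powr (-\<mu>/2 - 1)" for x
  proof (cases "x = 0")
    case True
    thus ?thesis using K'0 by simp
  next
    case False
    define q where "q = 1 + x\<^sup>2"
    have q: "q \<ge> 1" "q > 0" "x\<^sup>2 \<le> q" using zero_le_power2[of x] by (simp_all add: q_def add_pos_nonneg)
    define p where "p = q powr (-\<mu>/2 - 1)"
    have p: "p > 0" "q powr (-\<mu>/2) = q * p" using q by (simp_all add: p_def powr_diff)
    have "\<bar>x\<bar> * (q * \<bar>y'' x\<bar>) = \<bar>x * q * y'' x\<bar>" using q by (simp add: abs_mult)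
    also have "x * q * y'' x = - (((2*c - 1) + (2*\<mu> + 2) * x\<^sup>2) * y' x) + - (\<mu> * (\<mu> + 1) * x * y x)"
      using ode[of x] unfolding q_def by linarith
    also have "\<bar>\<dots>\<bar> \<le> \<bar>(2*c - 1) + (2*\<mu> + 2) * x\<^sup>2\<bar> * \<bar>y' x\<bar> + \<mu> * (\<mu> + 1) * \<bar>x\<bar> * \<bar>y x\<bar>"
      using mu_pos by (intro order.trans[OF abs_triangle_ineq]) (simp add: abs_mult)
    also have "\<dots> \<le> ((\<bar>2*c - 1\<bar> + (2*\<mu> + 2)) * q) * (K * \<bar>x\<bar> * p) + \<mu> * (\<mu> + 1) * \<bar>x\<bar> * (K * (q * p))"
    proof (intro add_mono mult_mono mult_left_mono)
      have "\<bar>(2*c - 1) + (2*\<mu> + 2) * x\<^sup>2\<bar> \<le> \<bar>2*c - 1\<bar> + (2*\<mu> + 2) * x\<^sup>2"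
        using mu_pos by (intro order.trans[OF abs_triangle_ineq]) (simp add: abs_mult)
      also have "\<dots> \<le> \<bar>2*c - 1\<bar> * q + (2*\<mu> + 2) * q"
        using q mu_pos by (intro add_mono mult_left_mono) (auto simp: mult_le_cancel_left1)
      finally show "\<bar>(2*c - 1) + (2*\<mu> + 2) * x\<^sup>2\<bar> \<le> (\<bar>2*c - 1\<bar> + (2*\<mu> + 2)) * q" by (simp add: algebra_simps)
      show "\<bar>y' x\<bar> \<le> K * \<bar>x\<bar> * p" using K(3)[of x] by (simp add: p_def q_def)
      show "\<bar>y x\<bar> \<le> K * (q * p)" using K(2)[of x] p by (simp add: q_def)
    qed (use mu_pos q in auto)
    also have "\<dots> = \<bar>x\<bar> * (q * (K' * p))" by (simp add: K'_def algebra_simps)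
    finally have "\<bar>y'' x\<bar> \<le> K' * p" using q False by simp
    also have "\<dots> \<le> (K' + \<bar>y'' 0\<bar>) * p" using p by (intro mult_right_mono) auto
    finally show ?thesis by (simp add: p_def q_def)
  qed
  show ?thesis
  proof (rule that[of "K + (K' + \<bar>y'' 0\<bar>)"])
    fix x
    show "\<bar>y x\<bar> \<le> (K + (K' + \<bar>y'' 0\<bar>)) * (1 + x\<^sup>2) powr (-\<mu>/2)"
      by (rule order.trans[OF K(2)]) (use K'0 in \<open>auto intro!: mult_right_mono\<close>)
    show "\<bar>y' x\<bar> \<le> (K + (K' + \<bar>y'' 0\<bar>)) * \<bar>x\<bar> * (1 + x\<^sup>2) powr (-\<mu>/2 - 1)"
      by (rule order.trans[OF K(3)]) (use K'0 in \<open>auto intro!: mult_right_mono\<close>)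
    show "\<bar>y'' x\<bar> \<le> (K + (K' + \<bar>y'' 0\<bar>)) * (1 + x\<^sup>2) powr (-\<mu>/2 - 1)"
      by (rule order.trans[OF b]) (use K'0 K(1) in \<open>auto intro!: mult_right_mono\<close>)
  qed (use K'0 K(1) in auto)
qed

text \<open>The operators x d/dx and x^2 d^2/dx^2 preserve the decay of y. They are the only
  combinations of derivatives that occur in the P-derivatives of the homogeneous kernels.\<close>

lemma euler_bounds:
  obtains K where "K > 0" "\<And>x. \<bar>y x\<bar> \<le> K * (1 + x\<^sup>2) powr (-\<mu>/2)"
    "\<And>x. \<bar>x * y' x\<bar> \<le> K * (1 + x\<^sup>2) powr (-\<mu>/2)"
    "\<And>x. \<bar>x\<^sup>2 * y'' x\<bar> \<le> K * (1 + x\<^sup>2) powr (-\<mu>/2)"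
proof -
  obtain K where K: "K > 0" "\<And>x. \<bar>y x\<bar> \<le> K * (1 + x\<^sup>2) powr (-\<mu>/2)"
    "\<And>x. \<bar>y' x\<bar> \<le> K * \<bar>x\<bar> * (1 + x\<^sup>2) powr (-\<mu>/2 - 1)"
    "\<And>x. \<bar>y'' x\<bar> \<le> K * (1 + x\<^sup>2) powr (-\<mu>/2 - 1)" by (rule bounds) blast
  have *: "x\<^sup>2 * (1 + x\<^sup>2) powr (-\<mu>/2 - 1) \<le> (1 + x\<^sup>2) powr (-\<mu>/2)" for x :: real
  proof -
    have q: "1 + x\<^sup>2 > 0" by (simp add: add_pos_nonneg)
    have "x\<^sup>2 * (1 + x\<^sup>2) powr (-\<mu>/2 - 1) \<le> (1 + x\<^sup>2) * (1 + x\<^sup>2) powr (-\<mu>/2 - 1)"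
      by (intro mult_right_mono) auto
    also have "\<dots> = (1 + x\<^sup>2) powr (-\<mu>/2)" using q by (simp add: powr_diff)
    finally show ?thesis .
  qed
  show ?thesis
  proof (rule that[OF K(1,2)])
    fix x
    have "\<bar>x * y' x\<bar> = \<bar>x\<bar> * \<bar>y' x\<bar>" by (rule abs_mult)
    also have "\<dots> \<le> \<bar>x\<bar> * (K * \<bar>x\<bar> * (1 + x\<^sup>2) powr (-\<mu>/2 - 1))"
      using K(3)[of x] by (intro mult_left_mono) auto
    also have "\<dots> = K * (x\<^sup>2 * (1 + x\<^sup>2) powr (-\<mu>/2 - 1))" by (simp add: power2_eq_square abs_mult_self_eq ac_simps)
    also have "\<dots> \<le> K * (1 + x\<^sup>2) powr (-\<mu>/2)" using * K by (intro mult_left_mono) auto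
    finally show "\<bar>x * y' x\<bar> \<le> K * (1 + x\<^sup>2) powr (-\<mu>/2)" .
    have "\<bar>x\<^sup>2 * y'' x\<bar> = x\<^sup>2 * \<bar>y'' x\<bar>" by (simp add: abs_mult)
    also have "\<dots> \<le> x\<^sup>2 * (K * (1 + x\<^sup>2) powr (-\<mu>/2 - 1))"
      using K(4)[of x] by (intro mult_left_mono) auto
    also have "\<dots> = K * (x\<^sup>2 * (1 + x\<^sup>2) powr (-\<mu>/2 - 1))" by simp
    also have "\<dots> \<le> K * (1 + x\<^sup>2) powr (-\<mu>/2)" using * K by (intro mult_left_mono) auto
    finally show "\<bar>x\<^sup>2 * y'' x\<bar> \<le> K * (1 + x\<^sup>2) powr (-\<mu>/2)" .
  qed
qed

end

lemma S2F1_derivs: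
  assumes C: "C \<notin> \<int>\<^sub>\<le>\<^sub>0" and w: "norm w < 1"
  shows "S2F1 A B C 1 w = A * B / C * S2F1 (A + 1) (B + 1) (C + 1) 0 w"
proof -
  have C1: "C + 1 \<notin> \<int>\<^sub>\<le>\<^sub>0"
    using C nonpos_Ints_diff_Nats[of "C + 1" 1] by auto
  have "ereal (norm w) < fps_conv_radius (fps_2F1 (A + 1) (B + 1) (C + 1))"
    by (rule less_le_trans[OF _ fps_conv_radius_2F1[OF C1]]) (use w in simp)
  thus ?thesis by (simp add: S2F1_def fps_deriv_2F1[OF C] eval_fps_mult)
qed

text \<open>The Pfaff form is not visibly symmetric in its first two parameters, and both orders
  occur later. The decay is that of q^(-\<mu>/2) in either case: when the prefactor q^(-\<alpha>)
  decays faster by q^(-s) with s = 1/2, the series grows like (1 - w)^(-s) = q^s and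
  compensates.\<close>

lemma radial_solution_2F1:
  fixes c \<mu> \<alpha> \<beta> :: real
  assumes c: "c > 0" and mu: "\<mu> > 0"
    and ab: "\<alpha> = \<mu>/2 \<and> \<beta> = (\<mu>+1)/2 \<or> \<alpha> = (\<mu>+1)/2 \<and> \<beta> = \<mu>/2"
  shows "radial_solution c \<mu> (\<lambda>x. Re (Y2F1 \<alpha> \<beta> c (of_real x))) (\<lambda>x. Re (Y2F1' \<alpha> \<beta> c (of_real x)))
           (\<lambda>x. Re (Y2F1'' \<alpha> \<beta> c (of_real x)))"
proof
  have C: "complex_of_real c \<notin> \<int>\<^sub>\<le>\<^sub>0" "complex_of_real c + 1 \<notin> \<int>\<^sub>\<le>\<^sub>0"
    using of_real_notin_nonpos_Ints[of c] of_real_notin_nonpos_Ints[of "c + 1"] c by simp_all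
  fix x :: real
  show "((\<lambda>x. Re (Y2F1 \<alpha> \<beta> c (of_real x))) has_real_derivative Re (Y2F1' \<alpha> \<beta> c (of_real x))) (at x)"
    "((\<lambda>x. Re (Y2F1' \<alpha> \<beta> c (of_real x))) has_real_derivative Re (Y2F1'' \<alpha> \<beta> c (of_real x))) (at x)"
    unfolding has_real_derivative_iff_has_vector_derivative
    by (intro bounded_linear.has_vector_derivative[OF bounded_linear_Re] has_vector_derivative_real_field
          Y2F1_deriv[OF refl C(1)] Y2F1'_deriv[OF refl C(1)])+
  show "isCont (\<lambda>x. Re (Y2F1'' \<alpha> \<beta> c (of_real x))) x"
    by (intro isCont_Re isCont_o2[where f = of_real and g = "Y2F1'' \<alpha> \<beta> c"] Y2F1''_isCont[OF refl C(1)] continuous_intros)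
  have sp: "4 * \<alpha> * \<beta> = \<mu> * (\<mu> + 1)" "2 * (\<alpha> + \<beta>) + 1 = 2 * \<mu> + 2"
    using ab by (auto simp: add_divide_distrib algebra_simps)
  have "of_real (x * (1 + x\<^sup>2)) * Y2F1'' \<alpha> \<beta> c (of_real x)
     + of_real ((2 * c - 1) + (2 * (\<alpha> + \<beta>) + 1) * x\<^sup>2) * Y2F1' \<alpha> \<beta> c (of_real x)
           + of_real (4 * \<alpha> * \<beta> * x) * Y2F1 \<alpha> \<beta> c (of_real x) = 0"
    using Y2F1_ode[OF refl C(1), of x "of_real \<alpha>" "of_real \<beta>"] by simp
  from arg_cong[OF this, of Re] show "x * (1 + x\<^sup>2) * Re (Y2F1'' \<alpha> \<beta> c (of_real x))
     + ((2*c - 1) + (2*\<mu> + 2) * x\<^sup>2) * Re (Y2F1' \<alpha> \<beta> c (of_real x)) + \<mu> * (\<mu> + 1) * x * Re (Y2F1 \<alpha> \<beta> c (of_real x)) = 0"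
    unfolding sp by simp
next
  show "\<mu> > 0" by fact
next
  have C: "complex_of_real c \<notin> \<int>\<^sub>\<le>\<^sub>0" "complex_of_real c + 1 \<notin> \<int>\<^sub>\<le>\<^sub>0"
    using of_real_notin_nonpos_Ints[of c] of_real_notin_nonpos_Ints[of "c + 1"] c by simp_all
  define s where "s = \<alpha> - \<mu> / 2"
  have s: "s = 0 \<and> \<alpha> - \<beta> = - 1/2 \<or> s = 1/2 \<and> \<alpha> - \<beta> = s" "\<alpha> = \<mu> / 2 + s" "\<alpha> > 0"
    using ab mu by (auto simp: s_def add_divide_distrib)
  have "\<exists>K>0. \<forall>w. 0 \<le> w \<longrightarrow> w < 1 \<longrightarrow> norm (S2F1 \<alpha> (c - \<beta>) c 0 (of_real w)) \<le> K * (1 - w) powr (-s)"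
  proof (cases "s = 0")
    case True
    hence "\<alpha> - \<beta> < 0" using s(1) by auto
    hence "Re (of_real \<alpha> + of_real (c - \<beta>) - of_real c) < 0" by simp
    then obtain K where K: "K > 0" "\<And>w::real. 0 \<le> w \<Longrightarrow> w < 1 \<Longrightarrow>
        norm (eval_fps (fps_2F1 \<alpha> (of_real (c - \<beta>)) c) (of_real w)) \<le> K"
      by (rule norm_eval_2F1_bounded[OF C(1)]) blast
    show ?thesis using K True by (intro exI[of _ K]) (simp add: S2F1_def)
  next
    case False
    hence "\<alpha> - \<beta> = s" "s > 0" using s(1) by auto
    hence "s > 0" "Re (of_real \<alpha> + of_real (c - \<beta>) - of_real c) \<le> s" by simp_all
    then obtain K where K: "K > 0" "\<And>w::real. 0 \<le> w \<Longrightarrow> w < 1 \<Longrightarrow>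
        norm (eval_fps (fps_2F1 \<alpha> (of_real (c - \<beta>)) c) (of_real w)) \<le> K * (1 - w) powr (-s)"
      by (rule norm_eval_2F1_le[OF C(1)]) blast
    show ?thesis using K by (intro exI[of _ K]) (simp add: S2F1_def)
  qed
  then obtain K1 where K1: "K1 > 0" "\<And>w. 0 \<le> w \<Longrightarrow> w < 1 \<Longrightarrow> norm (S2F1 \<alpha> (c - \<beta>) c 0 (of_real w)) \<le> K1 * (1 - w) powr (-s)"
    by blast
  \<comment> \<open>The derived series has all parameters raised by one and a growth exponent larger
    by one; in \<open>Y2F1'\<close> it comes with 1/q^2 instead of 1/q, which absorbs the
    difference.\<close>
  have "s + 1 > 0" "Re (complex_of_real \<alpha> + 1 + (of_real (c - \<beta>) + 1) - (of_real c + 1)) \<le> s + 1"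
    using s(1) by auto
  then obtain K2 where K2: "K2 > 0" "\<And>w. 0 \<le> w \<Longrightarrow> w < 1 \<Longrightarrow>
      norm (eval_fps (fps_2F1 (complex_of_real \<alpha> + 1) (of_real (c - \<beta>) + 1) (complex_of_real c + 1)) (of_real w)) \<le> K2 * (1 - w) powr (-(s + 1))"
    by (rule norm_eval_2F1_le[OF C(2), of "s + 1" "complex_of_real \<alpha> + 1" "of_real (c - \<beta>) + 1"]) blast
  define K2' where "K2' = \<bar>\<alpha> * (c - \<beta>) / c\<bar> * K2"
  have K2': "K2' \<ge> 0" "norm (S2F1 \<alpha> (c - \<beta>) c 1 (of_real w)) \<le> K2' * (1 - w) powr (-(s+1))" if "0 \<le> w" "w < 1" for w
  proof -
    have "S2F1 \<alpha> (of_real (c - \<beta>)) c 1 (of_real w) = of_real (\<alpha> * (c - \<beta>) / c) * S2F1 (complex_of_real \<alpha> + 1) (of_real (c - \<beta>) + 1) (complex_of_real c + 1) 0 (of_real w)"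
      using S2F1_derivs[OF C(1), of "of_real w" \<alpha> "of_real (c - \<beta>)"] that by simp
    hence "norm (S2F1 \<alpha> (of_real (c - \<beta>)) c 1 (of_real w)) = \<bar>\<alpha> * (c - \<beta>) / c\<bar> * norm (S2F1 (complex_of_real \<alpha> + 1) (of_real (c - \<beta>) + 1) (complex_of_real c + 1) 0 (of_real w))"
      by (simp only: norm_mult norm_of_real)
    also have "\<dots> \<le> \<bar>\<alpha> * (c - \<beta>) / c\<bar> * (K2 * (1 - w) powr (-(s + 1)))"
      using K2(2)[OF that] by (intro mult_left_mono) (auto simp: S2F1_def)
    finally show "norm (S2F1 \<alpha> (c - \<beta>) c 1 (of_real w)) \<le> K2' * (1 - w) powr (-(s+1))"
      by (simp add: K2'_def)
    show "K2' \<ge> 0" using K2 by (simp add: K2'_def)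
  qed
  define K where "K = K1 + 2 * (\<alpha> * K1 + K2')"
  show "\<exists>K>0. \<forall>x. \<bar>Re (Y2F1 \<alpha> \<beta> c (of_real x))\<bar> \<le> K * (1 + x\<^sup>2) powr (-\<mu>/2) \<and>
        \<bar>Re (Y2F1' \<alpha> \<beta> c (of_real x))\<bar> \<le> K * \<bar>x\<bar> * (1 + x\<^sup>2) powr (-\<mu>/2 - 1)"
  proof (intro exI[of _ K] conjI allI)
    have K2p: "K2' \<ge> 0" using K2'(1)[of 0] by simp
    show "K > 0" using K1 s K2p by (simp add: K_def add_pos_nonneg)
    fix x :: real
    define q where "q = 1 + x\<^sup>2"
    define w where "w = x\<^sup>2 / q"
    have q: "q > 0" by (simp add: q_def add_pos_nonneg)
    have w: "0 \<le> w" "w < 1" "1 - w = 1 / q" using q by (simp_all add: w_def) (simp_all add: q_def field_simps)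
    have ww: "(complex_of_real x)\<^sup>2 / (1 + (complex_of_real x)\<^sup>2) = of_real w"
      using w_eq[OF refl, of x] by (simp add: w_def q_def)
    have qq: "1 + (complex_of_real x)\<^sup>2 = of_real q" by (simp add: q_def)
    have wp: "(1 - w) powr (-r) = q powr r" for r
      unfolding w(3) using q by (simp add: powr_divide powr_minus field_simps)
    define S0 where "S0 = S2F1 \<alpha> (of_real c - of_real \<beta>) c 0 (of_real w)"
    define S1 where "S1 = S2F1 \<alpha> (of_real c - of_real \<beta>) c 1 (of_real w)"
    have b0: "norm S0 \<le> K1 * q powr s" using K1(2)[OF w(1,2)] by (simp add: S0_def wp)
    have b1: "norm S1 \<le> K2' * q powr (s + 1)" using K2'(2)[OF w(1,2)] unfolding wp by (simp add: S1_def)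
    have Y: "Y2F1 \<alpha> \<beta> c (of_real x) = exp (- of_real \<alpha> * Ln (of_real q)) * S0"
      unfolding Y2F1_def ww unfolding qq S0_def by simp
    have Y': "Y2F1' \<alpha> \<beta> c (of_real x) = exp (- of_real \<alpha> * Ln (of_real q)) * (2 * of_real x) * (- of_real \<alpha> * S0 / of_real q + S1 / (of_real q)\<^sup>2)"
      unfolding Y2F1'_def Let_def ww unfolding qq S0_def S1_def by simp
    have e: "norm (exp (- of_real \<alpha> * Ln (of_real q))) = q powr (-\<alpha>)"
      using q by (simp add: Ln_of_real powr_def)
    have "\<bar>Re (Y2F1 \<alpha> \<beta> c (of_real x))\<bar> \<le> norm (Y2F1 \<alpha> \<beta> c (of_real x))" by (rule abs_Re_le_cmod)
    also have "\<dots> \<le> q powr (-\<alpha>) * (K1 * q powr s)"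
      unfolding Y norm_mult e using b0 by (intro mult_left_mono) auto
    also have "\<dots> = K1 * q powr (-\<mu>/2)" using s(2) by (simp flip: powr_add)
    also have "\<dots> \<le> K * q powr (-\<mu>/2)" using K2p K1(1) s(3) by (intro mult_right_mono) (auto simp: K_def)
    finally show "\<bar>Re (Y2F1 \<alpha> \<beta> c (of_real x))\<bar> \<le> K * (1 + x\<^sup>2) powr (-\<mu>/2)" by (simp add: q_def)
    have T: "norm (- of_real \<alpha> * S0 / of_real q + S1 / (of_real q)\<^sup>2) \<le> (\<alpha> * K1 + K2') * q powr (s - 1)"
    proof -
      have "norm (- of_real \<alpha> * S0 / of_real q + S1 / (of_real q)\<^sup>2) \<le> \<alpha> * norm S0 / q + norm S1 / q\<^sup>2"
        using q s(3) by (intro order.trans[OF norm_triangle_ineq]) (simp add: norm_mult norm_divide norm_power)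
      also have "\<dots> \<le> \<alpha> * (K1 * q powr s) / q + K2' * q powr (s + 1) / q\<^sup>2"
        using b0 b1 q s(3) by (intro add_mono divide_right_mono mult_left_mono) auto
      also have "\<dots> = (\<alpha> * K1 + K2') * q powr (s - 1)"
        using q by (simp add: powr_diff powr_add field_simps power2_eq_square)
      finally show ?thesis .
    qed
    have "\<bar>Re (Y2F1' \<alpha> \<beta> c (of_real x))\<bar> \<le> norm (Y2F1' \<alpha> \<beta> c (of_real x))" by (rule abs_Re_le_cmod)
    also have "\<dots> \<le> q powr (-\<alpha>) * (2 * \<bar>x\<bar>) * ((\<alpha> * K1 + K2') * q powr (s - 1))"
      unfolding Y' norm_mult e using T by (intro mult_mono) (auto simp: norm_mult)
    also have "\<dots> = 2 * (\<alpha> * K1 + K2') * \<bar>x\<bar> * (q powr (-\<alpha>) * q powr (s - 1))" by simp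
    also have "q powr (-\<alpha>) * q powr (s - 1) = q powr (-\<mu>/2 - 1)" using s(2) by (simp flip: powr_add)
    also have "2 * (\<alpha> * K1 + K2') * \<bar>x\<bar> * q powr (-\<mu>/2 - 1) \<le> K * \<bar>x\<bar> * q powr (-\<mu>/2 - 1)"
      using K2p K1(1) s(3) by (intro mult_right_mono) (auto simp: K_def)
    finally show "\<bar>Re (Y2F1' \<alpha> \<beta> c (of_real x))\<bar> \<le> K * \<bar>x\<bar> * (1 + x\<^sup>2) powr (-\<mu>/2 - 1)" by (simp add: q_def)
  qed
qed

section \<open>Integration lemmas\<close>

text \<open>Dominated convergence for difference quotients along sequences; the mean value
  inequality turns the bound on the derivative into a bound on the quotients.\<close>

lemma has_real_derivative_integral:
  fixes f f' :: "real \<Rightarrow> 'a \<Rightarrow> real"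
  assumes x: "l < x" "x < r"
    and deriv: "\<And>x w. l < x \<Longrightarrow> x < r \<Longrightarrow> w \<in> space M \<Longrightarrow> ((\<lambda>x. f x w) has_real_derivative f' x w) (at x)"
    and int: "\<And>x. l < x \<Longrightarrow> x < r \<Longrightarrow> integrable M (f x)"
    and meas: "f' x \<in> borel_measurable M"
    and bound: "\<And>x w. l < x \<Longrightarrow> x < r \<Longrightarrow> w \<in> space M \<Longrightarrow> \<bar>f' x w\<bar> \<le> g w"
    and g: "integrable M g"
  shows "((\<lambda>x. \<integral>w. f x w \<partial>M) has_real_derivative (\<integral>w. f' x w \<partial>M)) (at x)"
proof -
  have "((\<lambda>y. ((\<integral>w. f y w \<partial>M) - (\<integral>w. f x w \<partial>M)) / (y - x)) \<longlongrightarrow> (\<integral>w. f' x w \<partial>M)) (at x within {l<..<r})"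
    unfolding tendsto_at_iff_sequentially
  proof (intro allI impI)
    fix X assume X: "\<forall>i. X i \<in> {l<..<r} - {x}" "X \<longlonglongrightarrow> x"
    have "(\<lambda>i. \<integral>w. (f (X i) w - f x w) / (X i - x) \<partial>M) \<longlonglongrightarrow> (\<integral>w. f' x w \<partial>M)"
    proof (rule integral_dominated_convergence[where w = g])
      show "f' x \<in> borel_measurable M" by fact
      show "(\<lambda>w. (f (X i) w - f x w) / (X i - x)) \<in> borel_measurable M" for i
        using int[of "X i"] int[of x] X(1) x by (auto intro!: borel_measurable_divide borel_measurable_diff)
      show "integrable M g" by fact
      show "AE w in M. (\<lambda>i. (f (X i) w - f x w) / (X i - x)) \<longlonglongrightarrow> f' x w"
      proof (rule AE_I2)
        fix w assume "w \<in> space M"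
        hence "((\<lambda>y. (f y w - f x w) / (y - x)) \<longlongrightarrow> f' x w) (at x)"
          using deriv[OF x] by (simp add: has_field_derivative_iff)
        thus "(\<lambda>i. (f (X i) w - f x w) / (X i - x)) \<longlonglongrightarrow> f' x w"
          using X unfolding tendsto_at_iff_sequentially comp_def by auto
      qed
      show "AE w in M. norm ((f (X i) w - f x w) / (X i - x)) \<le> g w" for i
      proof (rule AE_I2)
        fix w assume w: "w \<in> space M"
        have Xi: "l < X i" "X i < r" "X i \<noteq> x" using X(1) by auto
        have "\<bar>f (X i) w - f x w\<bar> \<le> g w * \<bar>X i - x\<bar>"
          using field_differentiable_bound[of "{l<..<r}" "\<lambda>y. f y w" "\<lambda>y. f' y w" "g w" "X i" x]
            deriv[OF _ _ w] bound[OF _ _ w] Xi x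
          by (auto intro: has_field_derivative_at_within)
        thus "norm ((f (X i) w - f x w) / (X i - x)) \<le> g w" using Xi by (simp add: field_simps)
      qed
    qed
    moreover have "(\<integral>w. (f (X i) w - f x w) / (X i - x) \<partial>M) = ((\<integral>w. f (X i) w \<partial>M) - (\<integral>w. f x w \<partial>M)) / (X i - x)" for i
      using int[of "X i"] int[of x] X(1) x by (subst Bochner_Integration.integral_diff[symmetric]) auto
    ultimately show "((\<lambda>y. ((\<integral>w. f y w \<partial>M) - (\<integral>w. f x w \<partial>M)) / (y - x)) \<circ> X) \<longlonglongrightarrow> (\<integral>w. f' x w \<partial>M)"
      by (simp only: comp_def)
  qed
  moreover have "at x within {l<..<r} = at x" using x by (intro at_within_open) auto
  ultimately show ?thesis by (simp add: has_field_derivative_iff)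
qed

lemma FTC_Ioi:
  fixes f F :: "real \<Rightarrow> real"
  assumes F: "\<And>x. x > 0 \<Longrightarrow> (F has_real_derivative f x) (at x)"
    and f: "\<And>x. x > 0 \<Longrightarrow> isCont f x"
    and int: "set_integrable lborel {0<..} f"
    and lim: "(F \<longlongrightarrow> A) (at_right 0)" "(F \<longlongrightarrow> B) at_top"
  shows "(LINT x:{0<..}|lborel. f x) = B - A"
proof -
  have "(LBINT x=ereal 0..\<infinity>. f x) = B - A"
  proof (rule interval_integral_FTC_integrable)
    show "(F has_vector_derivative f x) (at x)" if "ereal 0 < ereal x" for x
      using F[of x] that by (simp add: has_real_derivative_iff_has_vector_derivative)
    show "((F \<circ> real_of_ereal) \<longlongrightarrow> A) (at_right (ereal 0))" "((F \<circ> real_of_ereal) \<longlongrightarrow> B) (at_left \<infinity>)"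
      using lim by (simp_all add: ereal_tendsto_simps)
  qed (use f int in \<open>auto simp: zero_ereal_def[symmetric] einterval_def greaterThan_def\<close>)
  thus ?thesis by (simp add: interval_lebesgue_integral_0_infty zero_ereal_def[symmetric])
qed

lemma set_integrable_Ioi_nonneg_derivative:
  fixes f F :: "real \<Rightarrow> real"
  assumes F: "\<And>x. x > 0 \<Longrightarrow> (F has_real_derivative f x) (at x)"
    and f: "\<And>x. x > 0 \<Longrightarrow> isCont f x" "\<And>x. x > 0 \<Longrightarrow> f x \<ge> 0"
    and lim: "(F \<longlongrightarrow> A) (at_right 0)" "(F \<longlongrightarrow> B) at_top"
  shows "set_integrable lborel {0<..} f"
proof -
  have "set_integrable lborel (einterval (ereal 0) \<infinity>) f"
  proof (rule interval_integral_FTC_nonneg)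
    show "((F \<circ> real_of_ereal) \<longlongrightarrow> A) (at_right (ereal 0))" "((F \<circ> real_of_ereal) \<longlongrightarrow> B) (at_left \<infinity>)"
      using lim by (simp_all add: ereal_tendsto_simps)
  qed (use F f in auto)
  thus ?thesis by (simp add: einterval_def zero_ereal_def[symmetric] greaterThan_def)
qed

lemma FTC_real_line:
  fixes f F :: "real \<Rightarrow> real"
  assumes F: "\<And>x. (F has_real_derivative f x) (at x)" and f: "\<And>x. isCont f x"
    and int: "integrable lborel f"
    and lim: "(F \<longlongrightarrow> A) at_bot" "(F \<longlongrightarrow> B) at_top"
  shows "(\<integral>x. f x \<partial>lborel) = B - A"
proof -
  have "(LBINT x=-\<infinity>..\<infinity>. f x) = B - A"
  proof (rule interval_integral_FTC_integrable)
    show "(F has_vector_derivative f x) (at x)" for x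
      using F[of x] by (simp add: has_real_derivative_iff_has_vector_derivative)
    show "((F \<circ> real_of_ereal) \<longlongrightarrow> A) (at_right (-\<infinity>))" "((F \<circ> real_of_ereal) \<longlongrightarrow> B) (at_left \<infinity>)"
      using lim by (simp_all add: ereal_tendsto_simps)
  qed (use f int in \<open>auto simp: set_integrable_def\<close>)
  thus ?thesis by (simp add: interval_lebesgue_integral_def set_lebesgue_integral_def)
qed

lemma integrable_real_line_nonneg_derivative:
  fixes f F :: "real \<Rightarrow> real"
  assumes F: "\<And>x. (F has_real_derivative f x) (at x)" and f: "\<And>x. isCont f x" "\<And>x. f x \<ge> 0"
    and lim: "(F \<longlongrightarrow> A) at_bot" "(F \<longlongrightarrow> B) at_top"
  shows "integrable lborel f"
proof -
  have "set_integrable lborel (einterval (-\<infinity>) \<infinity>) f"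
  proof (rule interval_integral_FTC_nonneg)
    show "((F \<circ> real_of_ereal) \<longlongrightarrow> A) (at_right (-\<infinity>))" "((F \<circ> real_of_ereal) \<longlongrightarrow> B) (at_left \<infinity>)"
      using lim by (simp_all add: ereal_tendsto_simps)
  qed (use F f in auto)
  thus ?thesis by (simp add: set_integrable_def)
qed

section \<open>Integrable majorants on the line and on the half-line\<close>

lemma integrable_sech_squared:
  fixes k :: real
  assumes "k > 0"
  shows "integrable lborel (\<lambda>v. 1 - tanh (k * v) ^ 2)"
proof (rule integrable_real_line_nonneg_derivative)
  fix x :: real
  show "((\<lambda>v. tanh (k * v) / k) has_real_derivative 1 - tanh (k * x) ^ 2) (at x)"
    using assms by (auto intro!: derivative_eq_intros simp: field_simps)
  show "isCont (\<lambda>v. 1 - tanh (k * v) ^ 2) x" by (intro continuous_intros) auto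
  have "tanh (k * x) ^ 2 \<le> 1"
    using tanh_real_bounds[of "k * x"] by (simp add: abs_square_le_1 abs_le_iff)
  thus "0 \<le> 1 - tanh (k * x) ^ 2" by simp
  have 1: "filterlim (\<lambda>v. k * v) at_top at_top"
    using assms by (intro filterlim_tendsto_pos_mult_at_top[OF tendsto_const _ filterlim_ident]) auto
  have 2: "filterlim (\<lambda>v. k * v) at_bot at_bot"
    using assms by (intro filterlim_tendsto_pos_mult_at_bot[OF tendsto_const _ filterlim_ident]) auto
  show "((\<lambda>v. tanh (k * v) / k) \<longlongrightarrow> 1 / k) at_top" "((\<lambda>v. tanh (k * v) / k) \<longlongrightarrow> (-1) / k) at_bot"
    using assms by (intro tendsto_divide tendsto_const filterlim_compose[OF tanh_real_at_top 1]
        filterlim_compose[OF tanh_real_at_bot 2]; simp)+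
qed

lemma one_minus_tanh_square: "1 - tanh (y :: real) ^ 2 = 1 / cosh y ^ 2"
proof -
  have "cosh y ^ 2 = 1 + sinh y ^ 2" by (simp add: cosh_square_eq)
  hence "1 / cosh y ^ 2 = (cosh y ^ 2 - sinh y ^ 2) / cosh y ^ 2" by simp
  also have "\<dots> = 1 - tanh y ^ 2"
    using cosh_real_pos[of y] unfolding diff_divide_distrib by (simp add: tanh_def power_divide)
  finally show ?thesis by simp
qed

text \<open>The right side is a multiple of 1/cosh^2(sv/2), which has a multiple of tanh(sv/2) as
  primitive. Both sides are comparable with exp(-s|v|), and so every negative power of cosh has an
  elementary integrable majorant.\<close>

lemma cosh_powr_le:
  fixes s v :: real
  assumes "s > 0"
  shows "cosh v powr (- s) \<le> 2 powr s * (1 - tanh (s / 2 * v) ^ 2)"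
proof -
  have "exp \<bar>v\<bar> / 2 \<le> cosh v"
    using exp_gt_zero[of v] exp_gt_zero[of "-v"] unfolding cosh_field_def abs_real_def
    by (auto simp: less_imp_le simp del: exp_gt_zero)
  hence "cosh v powr (- s) \<le> (exp \<bar>v\<bar> / 2) powr (- s)"
    using assms by (intro powr_mono2') auto
  also have "\<dots> = 2 powr s * exp (- (s * \<bar>v\<bar>))"
    by (simp add: powr_divide powr_minus exp_powr_real exp_minus field_simps)
  also have "exp (- (s * \<bar>v\<bar>)) \<le> 1 - tanh (s / 2 * v) ^ 2"
  proof -
    have "cosh (s / 2 * v) \<le> exp (s / 2 * \<bar>v\<bar>)"
    proof -
      have "exp (s / 2 * v) \<le> exp (s / 2 * \<bar>v\<bar>)" "exp (- (s / 2 * v)) \<le> exp (s / 2 * \<bar>v\<bar>)"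
        using assms by (auto simp: abs_if)
      hence "exp (s / 2 * v) + exp (- (s / 2 * v)) \<le> exp (s / 2 * \<bar>v\<bar>) + exp (s / 2 * \<bar>v\<bar>)"
        by (rule add_mono)
      thus ?thesis unfolding cosh_field_def by simp
    qed
    hence "cosh (s / 2 * v) ^ 2 \<le> exp (s / 2 * \<bar>v\<bar>) ^ 2" by (intro power_mono) auto
    also have "\<dots> = exp (s * \<bar>v\<bar>)" by (simp flip: exp_double)
    finally have le: "cosh (s / 2 * v) ^ 2 \<le> exp (s * \<bar>v\<bar>)" .
    have "1 - tanh (s / 2 * v) ^ 2 = 1 / cosh (s / 2 * v) ^ 2" by (rule one_minus_tanh_square)
    moreover have "exp (- (s * \<bar>v\<bar>)) = 1 / exp (s * \<bar>v\<bar>)" by (simp add: exp_minus field_simps)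
    moreover have "1 / exp (s * \<bar>v\<bar>) \<le> 1 / cosh (s / 2 * v) ^ 2"
      using le cosh_real_pos[of "s / 2 * v"] by (intro frac_le) auto
    ultimately show ?thesis by simp
  qed
  finally show ?thesis by simp
qed

lemma continuous_borel:
  fixes f :: "real \<Rightarrow> 'b::topological_space"
  assumes "\<And>x. isCont f x"
  shows "f \<in> borel_measurable borel"
  using assms by (intro borel_measurable_continuous_onI continuous_at_imp_continuous_on) auto

lemma integrable_cosh_powr:
  fixes s :: real
  assumes "s > 0"
  shows "integrable lborel (\<lambda>v. cosh v powr (- s))"
proof (rule Bochner_Integration.integrable_bound)
  show "integrable lborel (\<lambda>v. 2 powr s * (1 - tanh (s / 2 * v) ^ 2))"
    using assms by (intro integrable_mult_right integrable_sech_squared) auto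
  show "(\<lambda>v::real. cosh v powr (- s)) \<in> borel_measurable lborel"
    by (simp, intro continuous_borel continuous_intros) auto
  show "AE v in lborel. norm (cosh v powr (- s)) \<le> norm (2 powr s * (1 - tanh (s / 2 * v) ^ 2))"
    using cosh_powr_le[OF assms] by (auto intro!: AE_I2 order.trans[OF _ abs_ge_self])
qed

lemma one_plus_square_pos: "(1::real) + x\<^sup>2 > 0"
  by (simp add: add_pos_nonneg)

lemma filterlim_one_plus_square: "filterlim (\<lambda>x::real. 1 + x\<^sup>2) at_top at_top"
proof (rule filterlim_tendsto_add_at_top[OF tendsto_const])
  show "filterlim (\<lambda>x::real. x\<^sup>2) at_top at_top"
    by (rule filterlim_pow_at_top[OF _ filterlim_ident[of at_top]]) simp
qed

lemma powr_tendsto_at_right_0: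
  fixes r :: real
  assumes "r > 0"
  shows "((\<lambda>x. x powr r) \<longlongrightarrow> 0) (at_right 0)"
proof -
  have "((\<lambda>x::real. x powr r) \<longlongrightarrow> 0 powr r) (at_right 0)"
    using assms by (intro tendsto_powr2 tendsto_intros) (auto intro: eventually_mono[OF eventually_at_right_less])
  thus ?thesis using assms by simp
qed

lemma isCont_at_right: "isCont f (x::real) \<Longrightarrow> (f \<longlongrightarrow> f x) (at_right x)"
  by (simp add: isCont_def filterlim_at_split)

text \<open>Two non-negative functions with bounded primitives serve as majorants: the derivative of
  x^(2c) (1+x^2)^(-c) has the right order at 0, that of -(1+x^2)^(-e) with e = \<kappa> - c at
  infinity. Later decay estimates only have to reach an exponent \<kappa> above c.\<close>

lemma set_integrable_weight:
  fixes c \<kappa> :: real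
  assumes c: "0 < c" "c < \<kappa>"
  shows "set_integrable lborel {0<..} (\<lambda>x. x powr (2*c - 1) * (1 + x\<^sup>2) powr (- \<kappa>))"
proof -
  define e where "e = \<kappa> - c"
  have e: "e > 0" using c by (simp add: e_def)
  have q: "(1::real) + x\<^sup>2 > 0" "(1::real) + x\<^sup>2 \<noteq> 0" for x using one_plus_square_pos[of x] by auto
  note top = filterlim_one_plus_square
  have i1: "set_integrable lborel {0<..} (\<lambda>x. 2 * c * (x powr (2*c - 1) * (1 + x\<^sup>2) powr (- c - 1)))"
  proof (rule set_integrable_Ioi_nonneg_derivative)
    fix x :: real assume x: "x > 0"
    have "((\<lambda>x. x powr (2*c)) has_real_derivative 2 * c * x powr (2*c - 1)) (at x)"
      using x by (auto intro!: derivative_eq_intros)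
    moreover have "((\<lambda>x. (1 + x\<^sup>2) powr (-c)) has_real_derivative (-c) * (1 + x\<^sup>2) powr (-c - 1) * (2 * x)) (at x)"
      using q by (auto intro!: derivative_eq_intros)
    ultimately have D: "((\<lambda>x. x powr (2*c) * (1 + x\<^sup>2) powr (-c)) has_real_derivative
       (2 * c * x powr (2*c - 1)) * (1 + x\<^sup>2) powr (-c) + ((-c) * (1 + x\<^sup>2) powr (-c - 1) * (2 * x)) * x powr (2*c)) (at x)"
      by (rule DERIV_mult)
    have "(1 + x\<^sup>2) powr (-c) = (1 + x\<^sup>2) * (1 + x\<^sup>2) powr (-c - 1)" "x powr (2*c) = x * x powr (2*c - 1)"
      using q x by (simp_all add: powr_diff)
    thus "((\<lambda>x. x powr (2*c) * (1 + x\<^sup>2) powr (-c)) has_real_derivative 2 * c * (x powr (2*c - 1) * (1 + x\<^sup>2) powr (- c - 1))) (at x)"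
      by (intro DERIV_cong[OF D]) (simp add: algebra_simps power2_eq_square)
    show "isCont (\<lambda>x. 2 * c * (x powr (2*c - 1) * (1 + x\<^sup>2) powr (- c - 1))) x"
      using q x by (intro continuous_intros) auto
    show "0 \<le> 2 * c * (x powr (2*c - 1) * (1 + x\<^sup>2) powr (- c - 1))" using c by simp
  next
    have "((\<lambda>x::real. x powr (2*c) * (1 + x\<^sup>2) powr (-c)) \<longlongrightarrow> 0 powr (2*c) * (1 + 0\<^sup>2) powr (-c)) (at_right 0)"
      using c by (intro tendsto_intros tendsto_powr2) (auto simp: eventually_at_right_less intro: eventually_mono[OF eventually_at_right_less])
    thus "((\<lambda>x::real. x powr (2*c) * (1 + x\<^sup>2) powr (-c)) \<longlongrightarrow> 0) (at_right 0)" using c by simp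
    have "((\<lambda>x::real. (1 - inverse (1 + x\<^sup>2)) powr c) \<longlongrightarrow> (1 - 0) powr c) at_top"
      by (intro tendsto_intros tendsto_inverse_0_at_top top) auto
    moreover have "eventually (\<lambda>x::real. (1 - inverse (1 + x\<^sup>2)) powr c = x powr (2*c) * (1 + x\<^sup>2) powr (-c)) at_top"
      using eventually_gt_at_top[of 0]
    proof eventually_elim
      case (elim x)
      have "1 - inverse (1 + x\<^sup>2) = x\<^sup>2 / (1 + x\<^sup>2)" using q[of x] by (simp add: field_simps)
      thus ?case using elim q[of x] by (simp add: powr_divide powr_minus powr_powr field_simps flip: powr_numeral)
    qed
    ultimately show "((\<lambda>x::real. x powr (2*c) * (1 + x\<^sup>2) powr (-c)) \<longlongrightarrow> 1) at_top"
      by (simp add: filterlim_cong)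
  qed
  have i2: "set_integrable lborel {0<..} (\<lambda>x. 2 * e * (x * (1 + x\<^sup>2) powr (- e - 1)))"
  proof (rule set_integrable_Ioi_nonneg_derivative)
    fix x :: real assume x: "x > 0"
    show "((\<lambda>x. - ((1 + x\<^sup>2) powr (-e))) has_real_derivative 2 * e * (x * (1 + x\<^sup>2) powr (- e - 1))) (at x)"
      using q by (auto intro!: derivative_eq_intros)
    show "isCont (\<lambda>x. 2 * e * (x * (1 + x\<^sup>2) powr (- e - 1))) x"
      using q x by (intro continuous_intros) auto
    show "0 \<le> 2 * e * (x * (1 + x\<^sup>2) powr (- e - 1))" using e x by simp
  next
    show "((\<lambda>x::real. - ((1 + x\<^sup>2) powr (-e))) \<longlongrightarrow> - ((1 + 0\<^sup>2) powr (-e))) (at_right 0)"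
      by (intro tendsto_intros) auto
    show "((\<lambda>x::real. - ((1 + x\<^sup>2) powr (-e))) \<longlongrightarrow> - 0) at_top"
      using e by (intro tendsto_minus tendsto_neg_powr top) auto
  qed
  \<comment> \<open>For x <= 1 the first term suffices because 1 + x^2 <= 2. For x > 1 the quotient
    w = x^2/(1+x^2) lies in [1/2, 1], so w^(c-1) is at most 1 or 2^(1-c), hence at most 2.\<close>
  define K where "K = 2 powr (c + 1) + 2"
  have le: "x powr (2*c - 1) * (1 + x\<^sup>2) powr (- \<kappa>) \<le> K * (x powr (2*c - 1) * (1 + x\<^sup>2) powr (- c - 1)) + K * (x * (1 + x\<^sup>2) powr (- e - 1))" if x: "x > 0" for x
  proof (cases "x \<le> 1")
    case True
    hence q2: "1 + x\<^sup>2 \<le> 2" using x by (simp add: power_le_one)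
    have "(1 + x\<^sup>2) powr (- \<kappa>) \<le> (1 + x\<^sup>2) powr 0" using c by (intro powr_mono) auto
    also have "\<dots> = (1 + x\<^sup>2) powr (c + 1) * (1 + x\<^sup>2) powr (- c - 1)" using q by (simp flip: powr_add)
    also have "\<dots> \<le> K * (1 + x\<^sup>2) powr (- c - 1)"
    proof (intro mult_right_mono)
      have "(1 + x\<^sup>2) powr (c + 1) \<le> 2 powr (c + 1)" using q2 q[of x] c by (intro powr_mono2) auto
      thus "(1 + x\<^sup>2) powr (c + 1) \<le> K" by (simp add: K_def)
    qed auto
    finally have "x powr (2*c - 1) * (1 + x\<^sup>2) powr (- \<kappa>) \<le> x powr (2*c - 1) * (K * (1 + x\<^sup>2) powr (- c - 1))"
      by (intro mult_left_mono) auto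
    also have "\<dots> \<le> K * (x powr (2*c - 1) * (1 + x\<^sup>2) powr (- c - 1)) + K * (x * (1 + x\<^sup>2) powr (- e - 1))"
      using x by (simp add: K_def)
    finally show ?thesis .
  next
    case False
    define w where "w = x\<^sup>2 / (1 + x\<^sup>2)"
    have w: "1/2 \<le> w" "w \<le> 1" using False q[of x] by (auto simp: w_def field_simps)
    have A: "x powr (2*c - 1) = x * (x\<^sup>2) powr (c - 1)"
    proof -
      have "x * (x\<^sup>2) powr (c - 1) = x powr 1 * (x powr 2) powr (c - 1)" using x by simp
      also have "\<dots> = x powr (2*c - 1)" by (simp only: powr_powr powr_add[symmetric]) (simp add: algebra_simps)
      finally show ?thesis ..
    qed
    have B: "(1 + x\<^sup>2) powr (- \<kappa>) = (1 + x\<^sup>2) powr (-(c - 1)) * (1 + x\<^sup>2) powr (- e - 1)"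
      by (simp add: e_def flip: powr_add)
    have W: "(x\<^sup>2) powr (c - 1) * (1 + x\<^sup>2) powr (-(c - 1)) = w powr (c - 1)"
      using q[of x] x by (simp add: w_def powr_divide powr_minus_divide del: minus_diff_eq)
    have "x powr (2*c - 1) * (1 + x\<^sup>2) powr (- \<kappa>)
        = ((x\<^sup>2) powr (c - 1) * (1 + x\<^sup>2) powr (-(c - 1))) * (x * (1 + x\<^sup>2) powr (- e - 1))"
      unfolding A B by (simp only: mult_ac)
    also have "\<dots> = w powr (c - 1) * (x * (1 + x\<^sup>2) powr (- e - 1))" unfolding W ..
    also have "\<dots> \<le> K * (x * (1 + x\<^sup>2) powr (- e - 1))"
    proof (intro mult_right_mono)
      show "w powr (c - 1) \<le> K"
      proof (cases "c \<ge> 1")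
        case True
        hence "w powr (c - 1) \<le> 1" using w by (intro powr_le1) auto
        thus ?thesis by (simp add: K_def add_increasing)
      next
        case False
        hence "w powr (c - 1) \<le> (1/2) powr (c - 1)" using w by (intro powr_mono2') auto
        also have "\<dots> = 2 powr (1 - c)" by (simp add: powr_divide powr_diff)
        also have "\<dots> \<le> 2 powr 1" using c by (intro powr_mono) auto
        finally show ?thesis by (simp add: K_def add_increasing)
      qed
    qed (use x in auto)
    also have "\<dots> \<le> K * (x powr (2*c - 1) * (1 + x\<^sup>2) powr (- c - 1)) + K * (x * (1 + x\<^sup>2) powr (- e - 1))"
      by (simp add: K_def)
    finally show ?thesis .
  qed
  have "set_integrable lborel {0<..} (\<lambda>x. K / (2 * c) * (2 * c * (x powr (2*c - 1) * (1 + x\<^sup>2) powr (- c - 1))) + K / (2 * e) * (2 * e * (x * (1 + x\<^sup>2) powr (- e - 1))))"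
    by (intro set_integral_add set_integrable_mult_right i1 i2)
  hence "set_integrable lborel {0<..} (\<lambda>x. K * (x powr (2*c - 1) * (1 + x\<^sup>2) powr (- c - 1)) + K * (x * (1 + x\<^sup>2) powr (- e - 1)))"
    using c e by simp
  thus ?thesis
  proof (rule set_integrable_bound)
    show "set_borel_measurable lborel {0<..} (\<lambda>x. x powr (2*c - 1) * (1 + x\<^sup>2) powr (- \<kappa>))"
      unfolding set_borel_measurable_def by measurable
    show "AE x in lborel. x \<in> {0<..} \<longrightarrow> norm (x powr (2*c - 1) * (1 + x\<^sup>2) powr (- \<kappa>)) \<le>
        norm (K * (x powr (2*c - 1) * (1 + x\<^sup>2) powr (- c - 1)) + K * (x * (1 + x\<^sup>2) powr (- e - 1)))"
      using le by (auto intro!: AE_I2 order.trans[OF _ abs_ge_self])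
  qed
qed

section \<open>Homogeneous kernels and their cosine transform\<close>

context radial_solution
begin

definition ker :: "real \<Rightarrow> real \<Rightarrow> real" where "ker P x = P powr (-\<mu>) * y (x / P)"
definition ker_x :: "real \<Rightarrow> real \<Rightarrow> real" where "ker_x P x = P powr (-\<mu>-1) * y' (x / P)"
definition ker_xx :: "real \<Rightarrow> real \<Rightarrow> real" where "ker_xx P x = P powr (-\<mu>-2) * y'' (x / P)"
definition ker_P :: "real \<Rightarrow> real \<Rightarrow> real" where
  "ker_P P x = - (P powr (-\<mu>-1) * (\<mu> * y (x / P) + x / P * y' (x / P)))"
definition ker_PP :: "real \<Rightarrow> real \<Rightarrow> real" where
  "ker_PP P x = P powr (-\<mu>-2) * (\<mu> * (\<mu> + 1) * y (x / P) + (2 * \<mu> + 2) * (x / P * y' (x / P)) + (x / P)\<^sup>2 * y'' (x / P))"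

lemma powr_shift:
  assumes "P > 0"
  shows "P powr (-\<mu>) = P\<^sup>2 * P powr (-\<mu>-2)" "P powr (-\<mu>-1) = P * P powr (-\<mu>-2)"
    "P powr (-\<mu>-1-1) = P powr (-\<mu>-2)"
proof -
  have "P powr 2 * P powr (-\<mu>-2) = P powr (-\<mu>)" "P powr 1 * P powr (-\<mu>-2) = P powr (-\<mu>-1)"
    unfolding powr_add[symmetric] by (rule arg_cong[where f = "(powr) P"], simp)+
  thus "P powr (-\<mu>) = P\<^sup>2 * P powr (-\<mu>-2)" "P powr (-\<mu>-1) = P * P powr (-\<mu>-2)"
    using assms by simp_all
qed (rule arg_cong[where f = "(powr) P"], simp)

lemma ker_deriv_x:
  assumes P: "P > 0"
  shows "((\<lambda>x. ker P x) has_real_derivative ker_x P x) (at x)"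
    "((\<lambda>x. ker_x P x) has_real_derivative ker_xx P x) (at x)"
proof -
  have *: "((\<lambda>x. x / P) has_real_derivative 1 / P) (at x)"
    using P by (auto intro!: derivative_eq_intros)
  show "((\<lambda>x. ker P x) has_real_derivative ker_x P x) (at x)"
    unfolding ker_def ker_x_def
    by (rule DERIV_cong[OF DERIV_cmult[OF DERIV_chain2[OF deriv *]]]) (use P in \<open>simp add: powr_shift power2_eq_square\<close>)
  show "((\<lambda>x. ker_x P x) has_real_derivative ker_xx P x) (at x)"
    unfolding ker_x_def ker_xx_def
    by (rule DERIV_cong[OF DERIV_cmult[OF DERIV_chain2[OF deriv' *]]]) (use P in \<open>simp add: powr_shift\<close>)
qed

lemma ker_deriv_P:
  assumes P: "P > 0"
  shows "((\<lambda>P. ker P x) has_real_derivative ker_P P x) (at P)"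
    "((\<lambda>P. ker_P P x) has_real_derivative ker_PP P x) (at P)"
proof -
  have xi: "((\<lambda>P. x / P) has_real_derivative - (x / P) / P) (at P)"
    using P by (auto intro!: derivative_eq_intros simp: power2_eq_square)
  have pw: "((\<lambda>P. P powr r) has_real_derivative r * P powr (r - 1)) (at P)" for r
    using P by (rule has_real_derivative_powr)
  note Y = DERIV_chain2[OF deriv xi] and Y' = DERIV_chain2[OF deriv' xi]
  show "((\<lambda>P. ker P x) has_real_derivative ker_P P x) (at P)"
    unfolding ker_def ker_P_def
    by (rule DERIV_cong[OF DERIV_mult[OF pw Y]]) (use P in \<open>simp add: powr_shift field_simps power2_eq_square\<close>)
  have ker_P_eq: "ker_P P x = - (P powr (-\<mu>-1) * T P)" if "T = (\<lambda>P. \<mu> * y (x / P) + x / P * y' (x / P))" for T P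
    by (simp add: ker_P_def that)
  define T where "T = (\<lambda>P. \<mu> * y (x / P) + x / P * y' (x / P))"
  have DT: "(T has_real_derivative - ((\<mu> + 1) * (x / P * y' (x / P)) + (x / P)\<^sup>2 * y'' (x / P)) / P) (at P)"
    unfolding T_def
    by (rule DERIV_cong[OF DERIV_add[OF DERIV_cmult[OF Y] DERIV_mult[OF xi Y']]])
       (use P in \<open>simp add: field_simps power2_eq_square\<close>)
  show "((\<lambda>P. ker_P P x) has_real_derivative ker_PP P x) (at P)"
    unfolding ker_P_eq[OF T_def] ker_PP_def
    by (rule DERIV_cong[OF DERIV_minus[OF DERIV_mult[OF pw DT]]])
       (use P in \<open>simp add: powr_shift(2,3) T_def field_simps power2_eq_square\<close>)
qed

lemma ker_continuous:
  assumes "isCont g v" "isCont h v" "g v > 0"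
  shows "isCont (\<lambda>v. ker (g v) (h v)) v" "isCont (\<lambda>v. ker_x (g v) (h v)) v" "isCont (\<lambda>v. ker_xx (g v) (h v)) v"
    "isCont (\<lambda>v. ker_P (g v) (h v)) v" "isCont (\<lambda>v. ker_PP (g v) (h v)) v"
proof -
  have *: "isCont (\<lambda>v. h v / g v) v" using assms by (intro continuous_intros) auto
  have Y: "isCont (\<lambda>v. y (h v / g v)) v" "isCont (\<lambda>v. y' (h v / g v)) v" "isCont (\<lambda>v. y'' (h v / g v)) v"
    using isCont_o2[OF *] continuous cont'' by blast+
  show "isCont (\<lambda>v. ker (g v) (h v)) v" "isCont (\<lambda>v. ker_x (g v) (h v)) v" "isCont (\<lambda>v. ker_xx (g v) (h v)) v"
    "isCont (\<lambda>v. ker_P (g v) (h v)) v" "isCont (\<lambda>v. ker_PP (g v) (h v)) v"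
    unfolding ker_def ker_x_def ker_xx_def ker_P_def ker_PP_def
    using assms Y * by (intro continuous_intros; simp)+
qed

text \<open>At P = cosh v the bracket on the right is the second derivative of
  \<open>ker (cosh v) x\<close> in v, since P^2 - 1 = sinh^2 v. The identity joins harmonicity with
  homogeneity in (P, x): the difference of the two sides is P^(-\<mu>-1) times the equation of y at
  x/P.\<close>

lemma ker_ode:
  assumes P: "P > 0"
  shows "x * (1 + x\<^sup>2) * ker_xx P x + ((2*c - 1) + (2*\<mu> + 1) * x\<^sup>2) * ker_x P x + \<mu>\<^sup>2 * x * ker P x
     = x * (P * ker_P P x + (P\<^sup>2 - 1) * ker_PP P x)"
proof -
  define \<xi> where "\<xi> = x / P"
  have x: "x = P * \<xi>" using P by (simp add: \<xi>_def)
  define p where "p = P powr (-\<mu>-2)"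
  have o: "\<xi> * (1 + \<xi>\<^sup>2) * y'' \<xi> + ((2*c - 1) + (2*\<mu> + 2) * \<xi>\<^sup>2) * y' \<xi> + \<mu> * (\<mu> + 1) * \<xi> * y \<xi> = 0"
    by (rule ode)
  have k: "ker P x = P\<^sup>2 * p * y \<xi>" "ker_x P x = P * p * y' \<xi>" "ker_xx P x = p * y'' \<xi>"
    "ker_P P x = - (P * p * (\<mu> * y \<xi> + \<xi> * y' \<xi>))"
    "ker_PP P x = p * (\<mu> * (\<mu> + 1) * y \<xi> + (2 * \<mu> + 2) * (\<xi> * y' \<xi>) + \<xi>\<^sup>2 * y'' \<xi>)"
    using powr_shift[OF P]
    by (simp_all add: ker_def ker_x_def ker_xx_def ker_P_def ker_PP_def \<xi>_def p_def)
  have "x * (1 + x\<^sup>2) * ker_xx P x + ((2*c - 1) + (2*\<mu> + 1) * x\<^sup>2) * ker_x P x + \<mu>\<^sup>2 * x * ker P x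
     - x * (P * ker_P P x + (P\<^sup>2 - 1) * ker_PP P x)
     = P * p * (\<xi> * (1 + \<xi>\<^sup>2) * y'' \<xi> + ((2*c - 1) + (2*\<mu> + 2) * \<xi>\<^sup>2) * y' \<xi> + \<mu> * (\<mu> + 1) * \<xi> * y \<xi>)"
    unfolding k unfolding x by (simp add: algebra_simps power2_eq_square power3_eq_cube)
  thus ?thesis unfolding o by simp
qed

section \<open>The cosine transform along P = cosh v\<close>

definition cosT :: "real \<Rightarrow> (real \<Rightarrow> real \<Rightarrow> real) \<Rightarrow> real \<Rightarrow> real" where
  "cosT t k x = (\<integral>v. cos (t * v) * k (cosh v) x \<partial>lborel)"

text \<open>One integrable majorant in v, uniform in x, for everything that occurs under the
  transform; the factors cosh v and cosh^2 v arise from differentiating along P = cosh v. The second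
  bound for \<open>ker_x\<close>, with the factor |x|, gives the vanishing derivative at x =
  0.\<close>

lemma cosh_bounds:
  obtains K where "K > 0" "\<And>v x. \<bar>ker (cosh v) x\<bar> \<le> K * cosh v powr (-\<mu>)"
    "\<And>v x. \<bar>ker_x (cosh v) x\<bar> \<le> K * cosh v powr (-\<mu>)" "\<And>v x. \<bar>ker_x (cosh v) x\<bar> \<le> K * \<bar>x\<bar> * cosh v powr (-\<mu>)"
    "\<And>v x. \<bar>ker_xx (cosh v) x\<bar> \<le> K * cosh v powr (-\<mu>)" "\<And>v x. \<bar>cosh v * ker_P (cosh v) x\<bar> \<le> K * cosh v powr (-\<mu>)"
    "\<And>v x. \<bar>(cosh v)\<^sup>2 * ker_PP (cosh v) x\<bar> \<le> K * cosh v powr (-\<mu>)"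
proof -
  obtain K where K: "K > 0" "\<And>x. \<bar>y x\<bar> \<le> K * (1 + x\<^sup>2) powr (-\<mu>/2)"
    "\<And>x. \<bar>y' x\<bar> \<le> K * \<bar>x\<bar> * (1 + x\<^sup>2) powr (-\<mu>/2 - 1)"
    "\<And>x. \<bar>y'' x\<bar> \<le> K * (1 + x\<^sup>2) powr (-\<mu>/2 - 1)" by (rule bounds) blast
  obtain K' where K': "K' > 0" "\<And>x. \<bar>y x\<bar> \<le> K' * (1 + x\<^sup>2) powr (-\<mu>/2)"
    "\<And>x. \<bar>x * y' x\<bar> \<le> K' * (1 + x\<^sup>2) powr (-\<mu>/2)"
    "\<And>x. \<bar>x\<^sup>2 * y'' x\<bar> \<le> K' * (1 + x\<^sup>2) powr (-\<mu>/2)" by (rule euler_bounds) blast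
  have le1: "(1 + x\<^sup>2) powr r \<le> 1" if "r \<le> 0" for x r :: real
    using powr_mono[of r 0 "1 + x\<^sup>2"] that one_plus_square_pos[of x] by simp
  have mu: "\<mu> > 0" by (rule mu_pos)
  have y0: "\<bar>y x\<bar> \<le> K" for x
    using K(2)[of x] K(1) le1[of "-\<mu>/2" x] mu by (auto intro: order.trans[OF _ mult_left_le])
  have y1: "\<bar>y' x\<bar> \<le> K * \<bar>x\<bar>" for x
    using K(3)[of x] K(1) le1[of "-\<mu>/2-1" x] mu by (auto intro: order.trans[OF _ mult_left_le])
  have y2: "\<bar>y'' x\<bar> \<le> K" for x
    using K(4)[of x] K(1) le1[of "-\<mu>/2-1" x] mu by (auto intro: order.trans[OF _ mult_left_le])
  have z0: "\<bar>y x\<bar> \<le> K'" "\<bar>x * y' x\<bar> \<le> K'" "\<bar>x\<^sup>2 * y'' x\<bar> \<le> K'" for x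
    using K'(2-4)[of x] K'(1) le1[of "-\<mu>/2" x] mu by (auto intro: order.trans[OF _ mult_left_le])
  \<comment> \<open>On |x| <= 1 the factor |x| is harmless, and beyond 1 the bound for x y' is
    stronger than the same bound for y'.\<close>
  have y1': "\<bar>y' x\<bar> \<le> K + K'" for x
  proof (cases "\<bar>x\<bar> \<le> 1")
    case True
    hence "K * \<bar>x\<bar> \<le> K * 1" using K(1) by (intro mult_left_mono) auto
    thus ?thesis using y1[of x] K'(1) by simp
  next
    case False
    hence "1 * \<bar>y' x\<bar> \<le> \<bar>x\<bar> * \<bar>y' x\<bar>" by (intro mult_right_mono) auto
    thus ?thesis using z0(2)[of x] K(1) by (simp add: abs_mult)
  qed
  define M where "M = K + K' + (\<mu> * K' + K') + (\<mu> * (\<mu> + 1) * K' + (2 * \<mu> + 2) * K' + K')"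
  have M: "K \<le> M" "K + K' \<le> M" "\<mu> * K' + K' \<le> M" "\<mu> * (\<mu> + 1) * K' + (2 * \<mu> + 2) * K' + K' \<le> M"
    using K(1) K'(1) mu by (auto simp: M_def)
  have pw: "cosh v powr (-\<mu>-1) \<le> cosh v powr (-\<mu>)" "cosh v powr (-\<mu>-2) \<le> cosh v powr (-\<mu>)" for v :: real
    using cosh_real_ge_1[of v] by (intro powr_mono; simp)+
  show ?thesis
  proof (rule that[of M])
    show "M > 0" using M(1) K(1) by simp
    fix v x :: real
    have cp: "cosh v > 0" by (rule cosh_real_pos)
    have g: "\<bar>cosh v powr r * z\<bar> \<le> M * cosh v powr (-\<mu>)" if "\<bar>z\<bar> \<le> M" "r \<le> -\<mu>" for z r
    proof -
      have "\<bar>cosh v powr r * z\<bar> = cosh v powr r * \<bar>z\<bar>" by (simp add: abs_mult)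
      also have "\<dots> \<le> cosh v powr (-\<mu>) * M"
        using that cosh_real_ge_1[of v] by (intro mult_mono powr_mono) auto
      finally show ?thesis by (simp add: mult.commute)
    qed
    show "\<bar>ker (cosh v) x\<bar> \<le> M * cosh v powr (-\<mu>)"
      unfolding ker_def by (rule g[OF order.trans[OF y0 M(1)]]) simp
    show "\<bar>ker_x (cosh v) x\<bar> \<le> M * cosh v powr (-\<mu>)"
      unfolding ker_x_def by (rule g[OF order.trans[OF y1' M(2)]]) simp
    show "\<bar>ker_xx (cosh v) x\<bar> \<le> M * cosh v powr (-\<mu>)"
      unfolding ker_xx_def by (rule g[OF order.trans[OF y2 M(1)]]) simp
    show "\<bar>ker_x (cosh v) x\<bar> \<le> M * \<bar>x\<bar> * cosh v powr (-\<mu>)"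
    proof -
      have "\<bar>ker_x (cosh v) x\<bar> = cosh v powr (-\<mu>-1) * \<bar>y' (x / cosh v)\<bar>" by (simp add: ker_x_def abs_mult)
      also have "\<dots> \<le> cosh v powr (-\<mu>) * (M * \<bar>x\<bar>)"
      proof (intro mult_mono pw)
        have "\<bar>y' (x / cosh v)\<bar> \<le> K * \<bar>x / cosh v\<bar>" by (rule y1)
        also have "\<dots> \<le> M * \<bar>x\<bar>"
          using M(1) K(1) cosh_real_ge_1[of v] by (intro mult_mono) (auto simp: divide_le_eq mult_le_cancel_left1)
        finally show "\<bar>y' (x / cosh v)\<bar> \<le> M * \<bar>x\<bar>" .
      qed auto
      finally show ?thesis by (simp add: mult_ac)
    qed
    have "cosh v * ker_P (cosh v) x = cosh v powr (-\<mu>) * (- (\<mu> * y (x / cosh v) + x / cosh v * y' (x / cosh v)))"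
      using cp by (simp add: ker_P_def powr_diff algebra_simps)
    also have "\<bar>\<dots>\<bar> \<le> M * cosh v powr (-\<mu>)"
    proof (rule g)
      have "\<bar>- (\<mu> * y (x / cosh v) + x / cosh v * y' (x / cosh v))\<bar> \<le> \<mu> * \<bar>y (x / cosh v)\<bar> + \<bar>x / cosh v * y' (x / cosh v)\<bar>"
        unfolding abs_minus_cancel using mu abs_triangle_ineq[of "\<mu> * y (x / cosh v)" "x / cosh v * y' (x / cosh v)"] by (simp add: abs_mult)
      also have "\<dots> \<le> \<mu> * K' + K'" using mu by (intro add_mono mult_left_mono z0) auto
      finally show "\<bar>- (\<mu> * y (x / cosh v) + x / cosh v * y' (x / cosh v))\<bar> \<le> M" using M(3) by simp
    qed simp
    finally show "\<bar>cosh v * ker_P (cosh v) x\<bar> \<le> M * cosh v powr (-\<mu>)" .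
    define \<xi> where "\<xi> = x / cosh v"
    have "(cosh v)\<^sup>2 * ker_PP (cosh v) x = cosh v powr (-\<mu>) * (\<mu> * (\<mu> + 1) * y \<xi> + (2 * \<mu> + 2) * (\<xi> * y' \<xi>) + \<xi>\<^sup>2 * y'' \<xi>)"
      using cp by (simp add: ker_PP_def powr_diff \<xi>_def)
    also have "\<bar>\<dots>\<bar> \<le> M * cosh v powr (-\<mu>)"
    proof (rule g)
      have "\<bar>\<mu> * (\<mu> + 1) * y \<xi> + (2 * \<mu> + 2) * (\<xi> * y' \<xi>) + \<xi>\<^sup>2 * y'' \<xi>\<bar> \<le> \<bar>\<mu> * (\<mu> + 1) * y \<xi>\<bar> + \<bar>(2 * \<mu> + 2) * (\<xi> * y' \<xi>)\<bar> + \<bar>\<xi>\<^sup>2 * y'' \<xi>\<bar>"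
        by linarith
      also have "\<dots> = \<mu> * (\<mu> + 1) * \<bar>y \<xi>\<bar> + (2 * \<mu> + 2) * \<bar>\<xi> * y' \<xi>\<bar> + \<bar>\<xi>\<^sup>2 * y'' \<xi>\<bar>"
        using mu by (simp add: abs_mult)
      also have "\<dots> \<le> \<mu> * (\<mu> + 1) * K' + (2 * \<mu> + 2) * K' + K'" using mu by (intro add_mono mult_left_mono z0) auto
      finally show "\<bar>\<mu> * (\<mu> + 1) * y \<xi> + (2 * \<mu> + 2) * (\<xi> * y' \<xi>) + \<xi>\<^sup>2 * y'' \<xi>\<bar> \<le> M" using M(4) by simp
    qed simp
    finally show "\<bar>(cosh v)\<^sup>2 * ker_PP (cosh v) x\<bar> \<le> M * cosh v powr (-\<mu>)" .
  qed
qed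

lemma integrable_cosh_bound:
  fixes f :: "real \<Rightarrow> real"
  assumes "\<And>v. isCont f v" "\<And>v. \<bar>f v\<bar> \<le> K * cosh v powr (-\<mu>)"
  shows "integrable lborel f"
proof (rule Bochner_Integration.integrable_bound)
  show "integrable lborel (\<lambda>v. K * cosh v powr (-\<mu>))"
    using mu_pos by (intro integrable_mult_right integrable_cosh_powr)
  show "f \<in> borel_measurable lborel" using continuous_borel[OF assms(1)] by simp
  show "AE v in lborel. norm (f v) \<le> norm (K * cosh v powr (-\<mu>))"
    using assms(2) by (auto intro!: AE_I2 order.trans[OF _ abs_ge_self])
qed

lemma abs_cos_mult_le: "\<bar>z\<bar> \<le> B \<Longrightarrow> \<bar>cos w * z\<bar> \<le> (B :: real)"
  using abs_cos_le_one[of w] mult_mono[of "\<bar>cos w\<bar>" 1 "\<bar>z\<bar>" B] by (simp add: abs_mult)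

lemma cosT_integrable:
  "integrable lborel (\<lambda>v. cos (t * v) * ker (cosh v) x)"
  "integrable lborel (\<lambda>v. cos (t * v) * ker_x (cosh v) x)"
  "integrable lborel (\<lambda>v. cos (t * v) * ker_xx (cosh v) x)"
proof -
  obtain K where K: "K > 0" "\<And>v x. \<bar>ker (cosh v) x\<bar> \<le> K * cosh v powr (-\<mu>)"
    "\<And>v x. \<bar>ker_x (cosh v) x\<bar> \<le> K * cosh v powr (-\<mu>)" "\<And>v x. \<bar>ker_xx (cosh v) x\<bar> \<le> K * cosh v powr (-\<mu>)"
    by (rule cosh_bounds) blast
  show "integrable lborel (\<lambda>v. cos (t * v) * ker (cosh v) x)"
    by (rule integrable_cosh_bound[OF _ abs_cos_mult_le[OF K(2)]]) (intro continuous_intros ker_continuous, simp_all)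
  show "integrable lborel (\<lambda>v. cos (t * v) * ker_x (cosh v) x)"
    by (rule integrable_cosh_bound[OF _ abs_cos_mult_le[OF K(3)]]) (intro continuous_intros ker_continuous, simp_all)
  show "integrable lborel (\<lambda>v. cos (t * v) * ker_xx (cosh v) x)"
    by (rule integrable_cosh_bound[OF _ abs_cos_mult_le[OF K(4)]]) (intro continuous_intros ker_continuous, simp_all)
qed

lemma cosT_deriv:
  "(cosT t ker has_real_derivative cosT t ker_x x) (at x)"
  "(cosT t ker_x has_real_derivative cosT t ker_xx x) (at x)"
proof -
  obtain K where K: "K > 0" "\<And>v x. \<bar>ker_x (cosh v) x\<bar> \<le> K * cosh v powr (-\<mu>)" "\<And>v x. \<bar>ker_xx (cosh v) x\<bar> \<le> K * cosh v powr (-\<mu>)"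
    by (rule cosh_bounds) blast
  have g: "integrable lborel (\<lambda>v. K * cosh v powr (-\<mu>))"
    using mu_pos by (intro integrable_mult_right integrable_cosh_powr)
  have "((\<lambda>x. \<integral>v. cos (t * v) * ker (cosh v) x \<partial>lborel) has_real_derivative (\<integral>v. cos (t * v) * ker_x (cosh v) x \<partial>lborel)) (at x)"
    by (rule has_real_derivative_integral[where l = "x - 1" and r = "x + 1" and g = "\<lambda>v. K * cosh v powr (-\<mu>)"])
       (use g cosT_integrable abs_cos_mult_le[OF K(2)] in \<open>auto intro!: DERIV_cmult ker_deriv_x dest: borel_measurable_integrable\<close>)
  thus "(cosT t ker has_real_derivative cosT t ker_x x) (at x)" by (simp add: cosT_def [abs_def])
  have "((\<lambda>x. \<integral>v. cos (t * v) * ker_x (cosh v) x \<partial>lborel) has_real_derivative (\<integral>v. cos (t * v) * ker_xx (cosh v) x \<partial>lborel)) (at x)"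
    by (rule has_real_derivative_integral[where l = "x - 1" and r = "x + 1" and g = "\<lambda>v. K * cosh v powr (-\<mu>)"])
       (use g cosT_integrable abs_cos_mult_le[OF K(3)] in \<open>auto intro!: DERIV_cmult ker_deriv_x dest: borel_measurable_integrable\<close>)
  thus "(cosT t ker_x has_real_derivative cosT t ker_xx x) (at x)" by (simp add: cosT_def [abs_def])
qed

lemma cosT_x_0: "cosT t ker_x 0 = 0"
proof -
  obtain K where K: "\<And>v x. \<bar>ker_x (cosh v) x\<bar> \<le> K * \<bar>x\<bar> * cosh v powr (-\<mu>)"
    by (rule cosh_bounds) blast
  have "ker_x (cosh v) 0 = 0" for v using K[of v 0] by simp
  thus ?thesis by (simp add: cosT_def)
qed

text \<open>By \<open>ker_ode\<close> the operator in x acts on the kernel as the second derivative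
  in v, and two integrations by parts against cos(tv) replace the latter by -t^2.\<close>

lemma cosT_ode:
  "x * (1 + x\<^sup>2) * cosT t ker_xx x + ((2*c - 1) + (2*\<mu> + 1) * x\<^sup>2) * cosT t ker_x x + (\<mu>\<^sup>2 + t\<^sup>2) * x * cosT t ker x = 0"
proof -
  obtain K where K: "K > 0" "\<And>v x. \<bar>ker (cosh v) x\<bar> \<le> K * cosh v powr (-\<mu>)"
    "\<And>v x. \<bar>cosh v * ker_P (cosh v) x\<bar> \<le> K * cosh v powr (-\<mu>)"
    "\<And>v x. \<bar>(cosh v)\<^sup>2 * ker_PP (cosh v) x\<bar> \<le> K * cosh v powr (-\<mu>)"
    by (rule cosh_bounds) blast
  define k2 where "k2 = (\<lambda>v. cosh v * ker_P (cosh v) x + ((cosh v)\<^sup>2 - 1) * ker_PP (cosh v) x)"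
  \<comment> \<open>Both integrations by parts are packed into one primitive. With k =
    \<open>ker (cosh v) x\<close> as a function of v, F = cos(tv) k' + t sin(tv) k, the mixed terms
    of its derivative cancel and F' = cos(tv) (k'' + t^2 k).\<close>
  define F where "F = (\<lambda>v. cos (t * v) * (sinh v * ker_P (cosh v) x) + t * (sin (t * v) * ker (cosh v) x))"
  define f where "f = (\<lambda>v. cos (t * v) * k2 v + t\<^sup>2 * (cos (t * v) * ker (cosh v) x))"
  have Dc: "((\<lambda>v. cosh v) has_real_derivative sinh v) (at v)" for v :: real by (auto intro!: derivative_eq_intros)
  have DF: "(F has_real_derivative f v) (at v)" for v
  proof -
    have D1: "((\<lambda>v. ker (cosh v) x) has_real_derivative ker_P (cosh v) x * sinh v) (at v)"
      by (rule DERIV_chain2[OF ker_deriv_P(1) Dc]) simp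
    have D2: "((\<lambda>v. ker_P (cosh v) x) has_real_derivative ker_PP (cosh v) x * sinh v) (at v)"
      by (rule DERIV_chain2[OF ker_deriv_P(2) Dc]) simp
    show ?thesis unfolding F_def f_def k2_def
      by (rule derivative_eq_intros D1 D2 refl)+ (simp add: algebra_simps power2_eq_square cosh_square_eq[unfolded power2_eq_square])
  qed
  have f_cont: "isCont f v" for v
    unfolding f_def k2_def by (intro continuous_intros ker_continuous) simp_all
  have k2_le: "\<bar>k2 v\<bar> \<le> 2 * K * cosh v powr (-\<mu>)" for v
  proof -
    have "\<bar>((cosh v)\<^sup>2 - 1) * ker_PP (cosh v) x\<bar> \<le> \<bar>(cosh v)\<^sup>2 * ker_PP (cosh v) x\<bar>"
      unfolding abs_mult using cosh_real_ge_1[of v] by (intro mult_right_mono) auto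
    thus ?thesis using K(3)[of v x] K(4)[of v x] unfolding k2_def by linarith
  qed
  have k2_int: "integrable lborel (\<lambda>v. cos (t * v) * k2 v)"
    by (rule integrable_cosh_bound[OF _ abs_cos_mult_le[OF k2_le]])
       (unfold k2_def, intro continuous_intros ker_continuous, simp_all)
  have f_int: "integrable lborel f"
    unfolding f_def by (intro Bochner_Integration.integrable_add integrable_mult_right k2_int cosT_integrable)
  have F_le: "\<bar>F v\<bar> \<le> (K + \<bar>t\<bar> * K) * cosh v powr (-\<mu>)" for v
  proof -
    have "\<bar>sinh v\<bar> \<le> \<bar>cosh v\<bar>" unfolding abs_le_square_iff by (simp add: cosh_square_eq)
    hence "\<bar>sinh v * ker_P (cosh v) x\<bar> \<le> \<bar>cosh v * ker_P (cosh v) x\<bar>"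
      unfolding abs_mult by (intro mult_right_mono) auto
    hence 1: "\<bar>cos (t * v) * (sinh v * ker_P (cosh v) x)\<bar> \<le> K * cosh v powr (-\<mu>)"
      using K(3)[of v x] by (intro abs_cos_mult_le) simp
    have "\<bar>sin (t * v)\<bar> * \<bar>ker (cosh v) x\<bar> \<le> 1 * (K * cosh v powr (-\<mu>))"
      by (intro mult_mono K) auto
    hence 2: "\<bar>t * (sin (t * v) * ker (cosh v) x)\<bar> \<le> \<bar>t\<bar> * (K * cosh v powr (-\<mu>))"
      by (simp add: abs_mult mult_left_mono)
    show ?thesis using 1 2 unfolding F_def distrib_right mult.assoc by linarith
  qed
  have cosh_lim: "((\<lambda>v::real. cosh v powr (-\<mu>)) \<longlongrightarrow> 0) at_top" "((\<lambda>v::real. cosh v powr (-\<mu>)) \<longlongrightarrow> 0) at_bot"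
    using mu_pos by (intro tendsto_neg_powr cosh_real_at_top cosh_real_at_bot; simp)+
  have F_lim: "(F \<longlongrightarrow> 0) at_top" "(F \<longlongrightarrow> 0) at_bot"
    by (rule Lim_null_comparison[OF always_eventually tendsto_mult_right_zero[OF cosh_lim(1)]], use F_le in force)
       (rule Lim_null_comparison[OF always_eventually tendsto_mult_right_zero[OF cosh_lim(2)]], use F_le in force)
  have "(\<integral>v. f v \<partial>lborel) = 0 - 0"
    by (rule FTC_real_line[OF DF f_cont f_int F_lim(2,1)])
  moreover have "(\<integral>v. f v \<partial>lborel) = (\<integral>v. cos (t * v) * k2 v \<partial>lborel) + t\<^sup>2 * cosT t ker x"
    unfolding f_def cosT_def
    by (simp add: Bochner_Integration.integral_add[OF k2_int integrable_mult_right[OF cosT_integrable(1)]])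
  ultimately have z: "(\<integral>v. cos (t * v) * k2 v \<partial>lborel) + t\<^sup>2 * cosT t ker x = 0" by simp
  have pw: "x * (cos (t * v) * k2 v) = x * (1 + x\<^sup>2) * (cos (t * v) * ker_xx (cosh v) x) + ((2*c - 1) + (2*\<mu> + 1) * x\<^sup>2) * (cos (t * v) * ker_x (cosh v) x)
      + \<mu>\<^sup>2 * x * (cos (t * v) * ker (cosh v) x)" for v
    using arg_cong[OF ker_ode[of "cosh v" x, OF cosh_real_pos], of "\<lambda>z. cos (t * v) * z"]
    unfolding k2_def by (simp add: algebra_simps)
  have "x * (\<integral>v. cos (t * v) * k2 v \<partial>lborel) = x * (1 + x\<^sup>2) * cosT t ker_xx x + ((2*c - 1) + (2*\<mu> + 1) * x\<^sup>2) * cosT t ker_x x + \<mu>\<^sup>2 * x * cosT t ker x"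
    unfolding cosT_def integral_mult_right_zero[symmetric] pw
    by (subst Bochner_Integration.integral_add | intro Bochner_Integration.integrable_add integrable_mult_right cosT_integrable | rule refl)+
  moreover have "x * (\<integral>v. cos (t * v) * k2 v \<partial>lborel) = - (t\<^sup>2 * x * cosT t ker x)"
    using arg_cong[OF z, of "\<lambda>z. x * z"] by (simp add: algebra_simps)
  ultimately show ?thesis by (simp add: algebra_simps)
qed

end

section \<open>Gamma integrals and Jacobi functions\<close>

text \<open>Euler's integral in a logarithmic variable. On the whole line the changes of variable
  that the double integral for |Gamma|^2 requires are affine.\<close>

lemma Gamma_integral_exp:
  assumes z: "Re z > 0"
  shows "integrable lborel (\<lambda>x::real. exp (z * of_real x - of_real (exp x)))"
    and "(\<integral>x. exp (z * of_real x - of_real (exp x)) \<partial>lborel) = Gamma z"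
proof -
  let ?f = "\<lambda>t::real. of_real t powr (z - 1) / of_real (exp t) :: complex"
  have range: "range (exp :: real \<Rightarrow> real) = {0<..}" by (auto simp: image_iff intro: exp_ln[symmetric])
  have eq: "\<bar>exp x\<bar> *\<^sub>R ?f (exp x) = exp (z * of_real x - of_real (exp x))" for x :: real
  proof -
    have "(of_real (exp x) :: complex) powr (z - 1) = exp ((z - 1) * of_real x)"
      by (simp add: powr_def Ln_of_real del: of_real_exp)
    thus ?thesis by (simp add: scaleR_conv_of_real exp_diff left_diff_distrib exp_of_real[symmetric])
  qed
  have "?f absolutely_integrable_on exp ` UNIV \<and> integral (exp ` UNIV) ?f = Gamma z"
    using absolutely_integrable_Gamma_integral'[OF z] integral_unique[OF Gamma_integral_complex'[OF z]]
    unfolding range by auto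
  hence "(\<lambda>x. \<bar>exp x\<bar> *\<^sub>R ?f (exp x)) absolutely_integrable_on UNIV \<and> integral UNIV (\<lambda>x. \<bar>exp x\<bar> *\<^sub>R ?f (exp x)) = Gamma z"
    by (subst has_absolute_integral_change_of_variables_real[where g = exp and h = exp])
       (auto intro!: derivative_eq_intros simp: inj_on_def)
  hence *: "(\<lambda>x. exp (z * of_real x - of_real (exp x))) absolutely_integrable_on UNIV"
    "integral UNIV (\<lambda>x::real. exp (z * of_real x - of_real (exp x))) = Gamma z"
    unfolding eq by auto
  have m: "(\<lambda>x::real. exp (z * of_real x - of_real (exp x))) \<in> borel_measurable lborel" by measurable
  show i: "integrable lborel (\<lambda>x::real. exp (z * of_real x - of_real (exp x)))"
    using *(1) unfolding set_integrable_def by (simp add: integrable_completion[OF m])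
  show "(\<integral>x. exp (z * of_real x - of_real (exp x)) \<partial>lborel) = Gamma z"
    using has_integral_integral_lborel[OF i] *(2) by (metis integral_unique)
qed

text \<open>Both sides are iterated integrals of \<open>exp(2a(y + v) + itv - e\<^bsup>y+2v\<^esup> - e\<^bsup>y\<^esup>)\<close>: integrating over \<open>v\<close>
  and then over \<open>y\<close> gives \<open>|\<Gamma>(a + it/2)|\<^sup>2/2\<close>, and \<open>e\<^bsup>y+2v\<^esup> + e\<^bsup>y\<^esup> = e\<^bsup>y+v\<^esup> 2 cosh v\<close>.\<close>
lemma cosh_integral_Gamma:
  fixes a t :: real
  assumes a: "a > 0"
  shows "(\<integral>v. cos (t * v) * cosh v powr (- (2 * a)) \<partial>lborel)
     = 4 powr a / 2 * (norm (Gamma (complex_of_real a + \<i> * of_real t / 2)))\<^sup>2 / Gamma (2 * a)"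
proof -
  define \<alpha> where "\<alpha> = complex_of_real a + \<i> * of_real t / 2"
  have \<alpha>: "Re \<alpha> > 0" "Re (cnj \<alpha>) > 0" "\<alpha> + cnj \<alpha> = of_real (2 * a)" using a by (simp_all add: \<alpha>_def complex_eq_iff)
  define h where "h = (\<lambda>v y :: real. exp (of_real (2*a*(y+v)) + \<i> * of_real (t * v) - of_real (exp (y + 2 * v) + exp y)))"
  have h_alt: "h v y = exp (cnj \<alpha> * of_real y - of_real (exp y)) * exp (\<alpha> * of_real (y + 2 * v) - of_real (exp (y + 2 * v)))" for v y
  proof -
    have "of_real (2*a*(y+v)) + \<i> * of_real (t * v) = cnj \<alpha> * of_real y + \<alpha> * of_real (y + 2 * v)"
      by (simp add: \<alpha>_def complex_eq_iff algebra_simps)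
    thus ?thesis by (simp add: h_def algebra_simps flip: exp_add)
  qed
  have norm_h: "norm (h v y) = exp (2*a*(y+v) - (exp (y + 2 * v) + exp y))" for v y
    by (simp add: h_def)
  define g where "g = (\<lambda>y. exp (2 * a * y - exp y))"
  have g: "integrable lborel g" "(\<integral>y. g y \<partial>lborel) = Gamma (2 * a)"
  proof -
    have "Re (complex_of_real (2 * a)) > 0" using a by simp
    note G = Gamma_integral_exp[OF this]
    have e: "exp (complex_of_real (2 * a) * of_real x - of_real (exp x)) = of_real (g x)" for x
      by (simp add: g_def exp_of_real[symmetric])
    show "integrable lborel g" using G(1) unfolding e by (simp add: complex_of_real_integrable_eq)
    have "complex_of_real (\<integral>y. g y \<partial>lborel) = complex_of_real (Gamma (2 * a))"
      using G(2) unfolding e by (simp add: Gamma_complex_of_real[symmetric])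
    thus "(\<integral>y. g y \<partial>lborel) = Gamma (2 * a)" by (simp only: of_real_eq_iff)
  qed
  have expcosh: "exp (y + 2 * v) + exp y = exp (y + v + ln (2 * cosh v))" for v y :: real
  proof -
    have "exp (y + v + ln (2 * cosh v)) = exp (y + v) * (exp v + exp (-v))"
      using cosh_real_pos[of v] by (simp add: exp_add cosh_field_def del: cosh_real_pos)
    also have "\<dots> = exp (y + 2 * v) + exp y" by (simp add: distrib_left flip: exp_add)
    finally show ?thesis ..
  qed
  \<comment> \<open>Translating y by v + ln(2 cosh v) brings the exponent to the form belonging to
    Gamma(2a) and leaves the factor (2 cosh v)^(-2a). The term \<open>1 * y\<close> matches the
    shape of the affine substitution rule.\<close>
  have h_g: "h v y = exp (\<i> * of_real (t * v)) * of_real ((2 * cosh v) powr (- (2*a)) * g ((v + ln (2 * cosh v)) + 1 * y))" for v y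
  proof -
    have "g ((v + ln (2 * cosh v)) + 1 * y) = exp (2*a*(y + v) - (exp (y + 2 * v) + exp y)) * exp (2 * a * ln (2 * cosh v))"
      unfolding g_def expcosh by (simp add: algebra_simps flip: exp_add)
    moreover have "(2 * cosh v) powr (- (2*a)) = exp (- (2 * a * ln (2 * cosh v)))"
      by (simp add: powr_def)
    ultimately have "(2 * cosh v) powr (- (2*a)) * g ((v + ln (2 * cosh v)) + 1 * y) = exp (2*a*(y + v) - (exp (y + 2 * v) + exp y))"
      by (simp add: exp_minus)
    thus ?thesis by (simp add: h_def exp_of_real[symmetric] algebra_simps flip: exp_add)
  qed
  have int_y: "integrable lborel (h v)" for v
    unfolding h_g [abs_def] using lborel_integrable_real_affine[OF g(1), of 1 "v + ln (2 * cosh v)"]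
    by (intro integrable_mult_right integrable_of_real) simp
  have val_g: "(\<integral>y. g ((v + ln (2 * cosh v)) + 1 * y) \<partial>lborel) = Gamma (2 * a)" for v
    using lborel_integral_real_affine[of 1 g "v + ln (2 * cosh v)"] g(2) by simp
  have val_y: "(\<integral>y. h v y \<partial>lborel) = exp (\<i> * of_real (t * v)) * of_real ((2 * cosh v) powr (- (2*a)) * Gamma (2 * a))" for v
    unfolding h_g integral_mult_right_zero integral_complex_of_real integral_mult_right_zero val_g ..
  have val_norm: "(\<integral>y. norm (h v y) \<partial>lborel) = Gamma (2 * a) * 2 powr (-(2*a)) * cosh v powr (- (2*a))" for v
  proof -
    have "norm (h v y) = (2 * cosh v) powr (- (2*a)) * g ((v + ln (2 * cosh v)) + 1 * y)" for y
      unfolding h_g norm_mult norm_of_real abs_mult by (simp add: g_def)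
    hence "(\<integral>y. norm (h v y) \<partial>lborel) = (2 * cosh v) powr (- (2*a)) * Gamma (2 * a)"
      by (simp only: integral_mult_right_zero val_g)
    thus ?thesis by (simp add: powr_mult)
  qed
  have int: "integrable (lborel \<Otimes>\<^sub>M lborel) (case_prod h)"
  proof (rule lborel_pair.Fubini_integrable)
    show "case_prod h \<in> borel_measurable (lborel \<Otimes>\<^sub>M lborel)" unfolding h_def by measurable
    show "integrable lborel (\<lambda>v. \<integral>y. norm (case_prod h (v, y)) \<partial>lborel)"
      unfolding prod.case val_norm using a by (intro integrable_mult_right integrable_cosh_powr) simp
    show "AE v in lborel. integrable lborel (\<lambda>y. case_prod h (v, y))" using int_y by simp
  qed
  have val_v: "(\<integral>v. h v y \<partial>lborel) = Gamma \<alpha> / 2 * exp (cnj \<alpha> * of_real y - of_real (exp y))" for y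
  proof -
    have "Gamma \<alpha> = 2 * (\<integral>v. exp (\<alpha> * of_real (y + 2 * v) - of_real (exp (y + 2 * v))) \<partial>lborel)"
      unfolding Gamma_integral_exp(2)[OF \<alpha>(1), symmetric]
      by (subst lborel_integral_real_affine[of 2 _ y]) (simp_all add: scaleR_conv_of_real)
    thus ?thesis unfolding h_alt integral_mult_right_zero by simp
  qed
  have "Gamma \<alpha> / 2 * Gamma (cnj \<alpha>) = (\<integral>y. \<integral>v. h v y \<partial>lborel \<partial>lborel)"
    unfolding val_v integral_mult_right_zero Gamma_integral_exp(2)[OF \<alpha>(2)] ..
  also have "\<dots> = (\<integral>v. \<integral>y. h v y \<partial>lborel \<partial>lborel)"
    by (rule lborel_pair.Fubini_integral[OF int])
  also have "\<dots> = (\<integral>v. exp (\<i> * of_real (t * v)) * of_real ((2 * cosh v) powr (- (2*a)) * Gamma (2 * a)) \<partial>lborel)"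
    unfolding val_y ..
  finally have eq: "Gamma \<alpha> / 2 * Gamma (cnj \<alpha>) = \<dots>" .
  have i: "integrable lborel (\<lambda>v. exp (\<i> * of_real (t * v)) * of_real ((2 * cosh v) powr (- (2*a)) * Gamma (2 * a)))"
    using lborel_pair.integrable_fst[OF int] unfolding val_y by simp
  have "Re (Gamma \<alpha> / 2 * Gamma (cnj \<alpha>)) = (\<integral>v. Re (exp (\<i> * of_real (t * v)) * of_real ((2 * cosh v) powr (- (2*a)) * Gamma (2 * a))) \<partial>lborel)"
    unfolding eq by (rule integral_Re[OF i, symmetric])
  also have "\<dots> = (\<integral>v. Gamma (2 * a) * 2 powr (-(2*a)) * (cos (t * v) * cosh v powr (- (2 * a))) \<partial>lborel)"
    by (rule Bochner_Integration.integral_cong) (simp_all add: Re_exp powr_mult)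
  also have "\<dots> = Gamma (2 * a) * 2 powr (-(2*a)) * (\<integral>v. cos (t * v) * cosh v powr (- (2 * a)) \<partial>lborel)"
    by (rule integral_mult_right_zero)
  also have "Gamma \<alpha> / 2 * Gamma (cnj \<alpha>) = of_real ((norm (Gamma \<alpha>))\<^sup>2 / 2)"
    by (simp only: of_real_divide complex_norm_square cnj_Gamma[symmetric]) simp
  finally have "(norm (Gamma \<alpha>))\<^sup>2 / 2 = Gamma (2 * a) * 2 powr (-(2*a)) * (\<integral>v. cos (t * v) * cosh v powr (- (2 * a)) \<partial>lborel)" by simp
  moreover have "Gamma (2 * a) > 0" using a by (intro Gamma_real_pos) auto
  moreover have "2 powr (-(2*a)) * 4 powr a = (1::real)"
  proof -
    have "(4::real) powr a = (2 powr 2) powr a" by simp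
    also have "\<dots> = 2 powr (2 * a)" by (simp only: powr_powr)
    finally show ?thesis by (simp flip: powr_add)
  qed
  ultimately show ?thesis unfolding \<alpha>_def[symmetric]
    by (simp add: field_simps)
qed

lemma Y2F1_0: "Y2F1 A B C 0 = 1"
  by (simp add: Y2F1_def S2F1_def eval_fps_at_0 fps_2F1_nth)

lemma ode_divide:
  fixes y y' y'' :: complex
  assumes "x > 0" and "of_real (x * (1 + x\<^sup>2)) * y'' + of_real (b + k * x\<^sup>2) * y' + of_real (d * x) * y = 0"
  shows "of_real (1 + x\<^sup>2) * y'' + of_real (b / x + k * x) * y' + of_real d * y = 0"
proof -
  have "of_real x * (of_real (1 + x\<^sup>2) * y'' + of_real (b / x + k * x) * y' + of_real d * y)
     = of_real (x * (1 + x\<^sup>2)) * y'' + of_real (x * (b / x + k * x)) * y' + of_real (d * x) * y"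
    by (simp add: algebra_simps)
  also have "x * (b / x + k * x) = b + k * x\<^sup>2" using assms(1) by (simp add: field_simps power2_eq_square)
  finally show ?thesis using assms by simp
qed

section \<open>Jacobi functions: equation, bound, and representation as a cosine transform\<close>

context
  fixes a c t :: real and \<phi> \<phi>' \<phi>'' :: "real \<Rightarrow> complex"
  assumes a: "a > 0" and c: "c > 1/2" and t: "t > 0"
  defines "\<phi> \<equiv> (\<lambda>x. Y2F1 (of_real a + \<i> * of_real t / 2) (of_real a - \<i> * of_real t / 2) c (of_real x))"
  defines "\<phi>' \<equiv> (\<lambda>x. Y2F1' (of_real a + \<i> * of_real t / 2) (of_real a - \<i> * of_real t / 2) c (of_real x))"
  defines "\<phi>'' \<equiv> (\<lambda>x. Y2F1'' (of_real a + \<i> * of_real t / 2) (of_real a - \<i> * of_real t / 2) c (of_real x))"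
begin

lemma phi_deriv: "(\<phi> has_vector_derivative \<phi>' x) (at x)" "(\<phi>' has_vector_derivative \<phi>'' x) (at x)"
proof -
  have C: "complex_of_real c \<notin> \<int>\<^sub>\<le>\<^sub>0" using of_real_notin_nonpos_Ints[of c] c by simp
  show "(\<phi> has_vector_derivative \<phi>' x) (at x)" "(\<phi>' has_vector_derivative \<phi>'' x) (at x)"
    unfolding \<phi>_def \<phi>'_def \<phi>''_def
    by (intro has_vector_derivative_real_field Y2F1_deriv[OF refl C] Y2F1'_deriv[OF refl C])+
qed

lemma phi_continuous: "isCont \<phi> x" "isCont \<phi>' x"
  using phi_deriv[THEN has_vector_derivative_continuous] by auto

lemma phi_0: "\<phi> 0 = 1" "\<phi>' 0 = 0"
  by (simp_all add: \<phi>_def \<phi>'_def Y2F1_0 Y2F1'_def)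

lemma phi_ode:
  assumes x: "x > 0"
  shows "of_real (1 + x\<^sup>2) * \<phi>'' x + of_real ((2*c - 1) / x + (4*a+1) * x) * \<phi>' x + of_real (4*a\<^sup>2 + t\<^sup>2) * \<phi> x = 0"
proof (rule ode_divide[OF x])
  have C: "complex_of_real c \<notin> \<int>\<^sub>\<le>\<^sub>0" using of_real_notin_nonpos_Ints[of c] c by simp
  define A B where "A = complex_of_real a + \<i> * of_real t / 2" "B = complex_of_real a - \<i> * of_real t / 2"
  have AB: "A + B = of_real (2 * a)" "4 * A * B = of_real (4*a\<^sup>2 + t\<^sup>2)"
    by (simp_all add: A_B_def complex_eq_iff power2_eq_square field_simps)
  have "of_real x * (1 + (of_real x)\<^sup>2) * Y2F1'' A B c (of_real x) + ((2 * of_real c - 1) + (2 * (A + B) + 1) * (of_real x)\<^sup>2) * Y2F1' A B c (of_real x)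
           + (4 * A * B) * of_real x * Y2F1 A B c (of_real x) = 0"
    by (rule Y2F1_ode[OF refl C])
  thus "of_real (x * (1 + x\<^sup>2)) * \<phi>'' x + of_real ((2*c - 1) + (4*a+1) * x\<^sup>2) * \<phi>' x + of_real ((4*a\<^sup>2 + t\<^sup>2) * x) * \<phi> x = 0"
    unfolding AB \<phi>_def \<phi>'_def \<phi>''_def A_B_def[symmetric] by simp
qed

lemma phi_bound:
  assumes "x > 0"
  shows "norm (\<phi> x) \<le> exp (pi * a * \<bar>c - a\<bar> / t) * (1 + x\<^sup>2) powr (- a)"
proof -
  have "(\<phi> \<longlongrightarrow> 1) (at_right 0)" "(\<phi>' \<longlongrightarrow> 0) (at_right 0)"
    using isCont_at_right[OF phi_continuous(1)[of 0]] isCont_at_right[OF phi_continuous(2)[of 0]] by (simp_all add: phi_0)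
  hence "norm (\<phi> x) \<le> norm (1::complex) * exp (pi * a * \<bar>c - a\<bar> / t) * (1 + x\<^sup>2) powr (- a)"
    by (intro energy_bound[OF phi_deriv phi_ode]) (use a c t assms in auto)
  thus ?thesis by simp
qed

text \<open>For \<mu> = 2a the transform satisfies the equation of \<phi>. Its difference from the
  multiple of \<phi> with the same value at 0 is regular with initial value 0, and the energy
  estimate bounds it by 0.\<close>

lemma cosT_eq_phi:
  fixes y y' y''
  assumes H: "radial_solution c (2 * a) y y' y''" and x: "x > 0"
  defines "k \<equiv> radial_solution.ker (2 * a) y"
  shows "of_real (radial_solution.cosT t k x) = of_real (radial_solution.cosT t k 0) * \<phi> x"
proof -
  interpret H: radial_solution c "2 * a" y y' y'' by (rule H)
  define R where "R = complex_of_real (H.cosT t H.ker 0)"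
  have vd: "((\<lambda>x. complex_of_real (f x) - R * g x) has_vector_derivative of_real f' - R * g') (at x)"
    if "(f has_real_derivative f') (at x)" "(g has_vector_derivative g') (at x)" for f f' x and g :: "real \<Rightarrow> complex" and g'
    using that by (intro derivative_intros) (auto simp: has_real_derivative_iff_has_vector_derivative)
  have "norm (of_real (H.cosT t H.ker x) - R * \<phi> x) \<le> norm (0::complex) * exp (pi * a * \<bar>c - a\<bar> / t) * (1 + x\<^sup>2) powr (- a)"
  proof (rule energy_bound[OF vd[OF H.cosT_deriv(1) phi_deriv(1)] vd[OF H.cosT_deriv(2) phi_deriv(2)]])
    fix x :: real assume x: "x > 0"
    have "of_real (1 + x\<^sup>2) * of_real (H.cosT t H.ker_xx x) + of_real ((2*c - 1) / x + (4*a+1) * x) * of_real (H.cosT t H.ker_x x)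
         + of_real (4*a\<^sup>2 + t\<^sup>2) * of_real (H.cosT t H.ker x) = (0::complex)"
    proof (rule ode_divide[OF x])
      show "of_real (x * (1 + x\<^sup>2)) * of_real (H.cosT t H.ker_xx x) + of_real ((2*c - 1) + (4*a+1) * x\<^sup>2) * of_real (H.cosT t H.ker_x x)
         + of_real ((4*a\<^sup>2 + t\<^sup>2) * x) * of_real (H.cosT t H.ker x) = (0::complex)"
        using arg_cong[OF H.cosT_ode[of x t], of complex_of_real] by (simp add: power_mult_distrib algebra_simps)
    qed
    moreover have "of_real (1 + x\<^sup>2) * (R * \<phi>'' x) + of_real ((2*c - 1) / x + (4*a+1) * x) * (R * \<phi>' x) + of_real (4*a\<^sup>2 + t\<^sup>2) * (R * \<phi> x) = 0"
      using arg_cong[OF phi_ode[OF x], of "\<lambda>z. R * z"] by (simp add: algebra_simps)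
    ultimately show "of_real (1 + x\<^sup>2) * (of_real (H.cosT t H.ker_xx x) - R * \<phi>'' x) + of_real ((2*c - 1) / x + (4*a+1) * x) * (of_real (H.cosT t H.ker_x x) - R * \<phi>' x)
         + of_real (4*a\<^sup>2 + t\<^sup>2) * (of_real (H.cosT t H.ker x) - R * \<phi> x) = 0"
      unfolding right_diff_distrib by (metis (no_types, lifting) add_diff_add diff_zero)
  next
    have c1: "isCont (\<lambda>x. of_real (H.cosT t H.ker x) - R * \<phi> x) 0"
      by (intro continuous_intros isCont_of_real DERIV_isCont[OF H.cosT_deriv(1)] phi_continuous)
    show "((\<lambda>x. of_real (H.cosT t H.ker x) - R * \<phi> x) \<longlongrightarrow> 0) (at_right 0)"
      using isCont_at_right[OF c1] by (simp add: phi_0 R_def)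
    have c2: "isCont (\<lambda>x. of_real (H.cosT t H.ker_x x) - R * \<phi>' x) 0"
      by (intro continuous_intros isCont_of_real DERIV_isCont[OF H.cosT_deriv(2)] phi_continuous)
    show "((\<lambda>x. of_real (H.cosT t H.ker_x x) - R * \<phi>' x) \<longlongrightarrow> 0) (at_right 0)"
      using isCont_at_right[OF c2] by (simp add: phi_0 H.cosT_x_0)
  qed (use a c t x in auto)
  thus ?thesis by (simp add: R_def k_def)
qed

end

section \<open>The pairing of two kernels\<close>

context radial_solution
begin

lemma ker_euler:
  assumes "P > 0"
  shows "x * ker_x P x + P * ker_P P x = - \<mu> * ker P x"
proof -
  define Y where "Y = y' (x / P)"
  have "P powr (-\<mu>) = P * P powr (-\<mu>-1)" using powr_shift(1,2)[OF assms] by (simp add: power2_eq_square)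
  thus ?thesis unfolding ker_def ker_x_def ker_P_def Y_def[symmetric]
    using assms by (simp add: distrib_left right_diff_distrib)
qed

text \<open>Majorants for differentiating in P under the integral. For P < r one has 1 + (x/P)^2 >=
  m (1 + x^2) with m = min(1, 1/r^2), so replacing x/P by x costs only a constant; the negative
  powers of P are largest at the left end l.\<close>

lemma ker_local_bound:
  assumes lr: "0 < l" "l < r"
  obtains M where "M > 0"
    "\<And>P x. l < P \<Longrightarrow> P < r \<Longrightarrow> \<bar>ker P x\<bar> \<le> M * (1 + x\<^sup>2) powr (-\<mu>/2)"
    "\<And>P x. l < P \<Longrightarrow> P < r \<Longrightarrow> \<bar>ker_P P x\<bar> \<le> M * (1 + x\<^sup>2) powr (-\<mu>/2)"
    "\<And>P x. l < P \<Longrightarrow> P < r \<Longrightarrow> \<bar>ker_PP P x\<bar> \<le> M * (1 + x\<^sup>2) powr (-\<mu>/2)"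
proof -
  obtain K where K: "K > 0" "\<And>x. \<bar>y x\<bar> \<le> K * (1 + x\<^sup>2) powr (-\<mu>/2)"
    "\<And>x. \<bar>x * y' x\<bar> \<le> K * (1 + x\<^sup>2) powr (-\<mu>/2)"
    "\<And>x. \<bar>x\<^sup>2 * y'' x\<bar> \<le> K * (1 + x\<^sup>2) powr (-\<mu>/2)" by (rule euler_bounds) blast
  have mu: "\<mu> > 0" by (rule mu_pos)
  define m where "m = min 1 (1 / r\<^sup>2)"
  have m: "m > 0" using lr by (simp add: m_def)
  define L where "L = l powr (-\<mu>) + l powr (-\<mu>-1) + l powr (-\<mu>-2)"
  have L: "P powr (-\<mu>) \<le> L" "P powr (-\<mu>-1) \<le> L" "P powr (-\<mu>-2) \<le> L" "L > 0" if "l < P" for P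
  proof -
    have "P powr (-\<mu>) \<le> l powr (-\<mu>)" "P powr (-\<mu>-1) \<le> l powr (-\<mu>-1)" "P powr (-\<mu>-2) \<le> l powr (-\<mu>-2)"
      using lr that mu by (intro powr_mono2'; simp)+
    thus "P powr (-\<mu>) \<le> L" "P powr (-\<mu>-1) \<le> L" "P powr (-\<mu>-2) \<le> L" unfolding L_def
      using powr_ge_zero[of l "-\<mu>"] powr_ge_zero[of l "-\<mu>-1"] powr_ge_zero[of l "-\<mu>-2"] by linarith+
    show "L > 0" unfolding L_def using lr by (intro add_pos_nonneg) auto
  qed
  have scale: "(1 + (x/P)\<^sup>2) powr (-\<mu>/2) \<le> m powr (-\<mu>/2) * (1 + x\<^sup>2) powr (-\<mu>/2)" if P: "l < P" "P < r" for P x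
  proof -
    have "m * (1 + x\<^sup>2) \<le> 1 + (x/P)\<^sup>2"
    proof -
      have "m * x\<^sup>2 \<le> 1 / P\<^sup>2 * x\<^sup>2"
      proof (intro mult_right_mono)
        have "1 / r\<^sup>2 \<le> 1 / P\<^sup>2" using P lr by (intro frac_le power_mono) auto
        thus "m \<le> 1 / P\<^sup>2" by (simp add: m_def min_def)
      qed simp
      moreover have "m \<le> 1" by (simp add: m_def)
      ultimately show ?thesis by (simp add: algebra_simps power_divide)
    qed
    hence "(1 + (x/P)\<^sup>2) powr (-\<mu>/2) \<le> (m * (1 + x\<^sup>2)) powr (-\<mu>/2)"
      using mu m one_plus_square_pos[of x] by (intro powr_mono2') auto
    thus ?thesis using m one_plus_square_pos[of x] by (simp add: powr_mult)
  qed
  define N where "N = (\<mu> * (\<mu> + 1) + (2 * \<mu> + 2) + 1) * K * m powr (-\<mu>/2)"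
  have N0: "N > 0" using mu K(1) m by (simp add: N_def add_pos_pos)
  have q0: "(1 + x\<^sup>2) powr (-\<mu>/2) \<ge> 0" for x :: real by simp
  \<comment> \<open>Up to a power of P all three kernels are combinations of y and its two Euler
    derivatives at x/P; one estimate with free coefficients u, v, w covers them.\<close>
  have b: "\<bar>u * y (x/P) + v * (x/P * y' (x/P)) + w * ((x/P)\<^sup>2 * y'' (x/P))\<bar> \<le> N * (1 + x\<^sup>2) powr (-\<mu>/2)"
    if P: "l < P" "P < r" and uvw: "\<bar>u\<bar> + \<bar>v\<bar> + \<bar>w\<bar> \<le> \<mu> * (\<mu> + 1) + (2 * \<mu> + 2) + 1" for u v w P x
  proof -
    have "\<bar>u * y (x/P) + v * (x/P * y' (x/P)) + w * ((x/P)\<^sup>2 * y'' (x/P))\<bar>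
      \<le> \<bar>u\<bar> * \<bar>y (x/P)\<bar> + \<bar>v\<bar> * \<bar>x/P * y' (x/P)\<bar> + \<bar>w\<bar> * \<bar>(x/P)\<^sup>2 * y'' (x/P)\<bar>"
      unfolding abs_mult[symmetric] by (rule order.trans[OF abs_triangle_ineq add_mono[OF abs_triangle_ineq order_refl]])
    also have "\<dots> \<le> \<bar>u\<bar> * (K * (1 + (x/P)\<^sup>2) powr (-\<mu>/2)) + \<bar>v\<bar> * (K * (1 + (x/P)\<^sup>2) powr (-\<mu>/2)) + \<bar>w\<bar> * (K * (1 + (x/P)\<^sup>2) powr (-\<mu>/2))"
      by (intro add_mono mult_left_mono K) auto
    also have "\<dots> = (\<bar>u\<bar> + \<bar>v\<bar> + \<bar>w\<bar>) * K * (1 + (x/P)\<^sup>2) powr (-\<mu>/2)" by (simp add: algebra_simps)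
    also have "\<dots> \<le> (\<mu> * (\<mu> + 1) + (2 * \<mu> + 2) + 1) * K * (m powr (-\<mu>/2) * (1 + x\<^sup>2) powr (-\<mu>/2))"
      using uvw K(1) mu by (intro mult_mono scale P) auto
    finally show ?thesis by (simp add: N_def mult_ac)
  qed
  have fin: "\<bar>P powr e * z\<bar> \<le> L * N * (1 + x\<^sup>2) powr (-\<mu>/2)"
    if "l < P" "P powr e \<le> L" "\<bar>z\<bar> \<le> N * (1 + x\<^sup>2) powr (-\<mu>/2)" for P e z x
  proof -
    have "\<bar>P powr e * z\<bar> = P powr e * \<bar>z\<bar>" by (simp add: abs_mult)
    also have "\<dots> \<le> L * (N * (1 + x\<^sup>2) powr (-\<mu>/2))" using that L(4)[of P] by (intro mult_mono) auto
    finally show ?thesis by (simp add: mult_ac)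
  qed
  show ?thesis
  proof (rule that[of "L * N"])
    show "L * N > 0" using L(4)[of "l + 1"] N0 by simp
    fix P x :: real assume P: "l < P" "P < r"
    have mm: "\<mu> * \<mu> \<ge> 0" by simp
    have u: "\<bar>1::real\<bar> + \<bar>0::real\<bar> + \<bar>0::real\<bar> \<le> \<mu> * (\<mu> + 1) + (2 * \<mu> + 2) + 1"
      "\<bar>\<mu>\<bar> + \<bar>1::real\<bar> + \<bar>0::real\<bar> \<le> \<mu> * (\<mu> + 1) + (2 * \<mu> + 2) + 1"
      "\<bar>\<mu> * (\<mu> + 1)\<bar> + \<bar>2 * \<mu> + 2\<bar> + \<bar>1::real\<bar> \<le> \<mu> * (\<mu> + 1) + (2 * \<mu> + 2) + 1"
      using mu mm by (simp_all add: distrib_left)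
    note b = b[OF P u(1)] b[OF P u(2)] b[OF P u(3)]
    show "\<bar>ker P x\<bar> \<le> L * N * (1 + x\<^sup>2) powr (-\<mu>/2)"
      unfolding ker_def by (rule fin[OF P(1) L(1)[OF P(1)]]) (use b(1)[of x] in simp)
    have "\<bar>ker_P P x\<bar> = \<bar>P powr (-\<mu>-1) * (\<mu> * y (x / P) + x / P * y' (x / P))\<bar>"
      unfolding ker_P_def by (rule abs_minus_cancel)
    also have "\<dots> \<le> L * N * (1 + x\<^sup>2) powr (-\<mu>/2)"
      by (rule fin[OF P(1) L(2)[OF P(1)]]) (use b(2)[of x] in simp)
    finally show "\<bar>ker_P P x\<bar> \<le> L * N * (1 + x\<^sup>2) powr (-\<mu>/2)" .
    show "\<bar>ker_PP P x\<bar> \<le> L * N * (1 + x\<^sup>2) powr (-\<mu>/2)"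
      unfolding ker_PP_def by (rule fin[OF P(1) L(3)[OF P(1)]]) (use b(3)[of x] in simp)
  qed
qed

end

text \<open>The decay exponents 2p + 1 and 2a add up to 2c + 1, so the product weighted with
  x^(2c-1) is O(x^(-2)) at infinity, which makes the pairing integrals converge.\<close>

locale radial_pair =
  G: radial_solution c "2 * p + 1" g g' g'' + H: radial_solution c "2 * a" h h' h''
  for a p c g g' g'' h h' h'' +
  assumes c: "c = a + p" "c > 1/2" and p_pos: "p > 0"
begin

lemma a_pos: "a > 0" using H.mu_pos by simp

definition J :: "(real \<Rightarrow> real \<Rightarrow> real) \<Rightarrow> real \<Rightarrow> real" where
  "J k P = (LINT x:{0<..}|lborel. x powr (2*c - 1) * (k P x * h x))"

lemma weight_integrable: "set_integrable lborel {0<..} (\<lambda>x. M * (x powr (2*c - 1) * (1 + x\<^sup>2) powr (- (c + 1/2))))"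
  using c by (intro set_integrable_mult_right set_integrable_weight) auto

lemma J_bound:
  assumes "\<bar>k\<bar> \<le> M * (1 + x\<^sup>2) powr (- (2 * p + 1)/2)" "\<bar>hx\<bar> \<le> K * (1 + x\<^sup>2) powr (- (2 * a)/2)" "M > 0"
  shows "\<bar>x powr (2*c - 1) * (k * hx)\<bar> \<le> M * K * (x powr (2*c - 1) * (1 + x\<^sup>2) powr (- (c + 1/2)))"
proof -
  have "\<bar>x powr (2*c - 1) * (k * hx)\<bar> = x powr (2*c - 1) * (\<bar>k\<bar> * \<bar>hx\<bar>)" by (simp add: abs_mult)
  also have "\<dots> \<le> x powr (2*c - 1) * ((M * (1 + x\<^sup>2) powr (- (2 * p + 1)/2)) * (K * (1 + x\<^sup>2) powr (- (2 * a)/2)))"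
    using assms by (intro mult_left_mono mult_mono) auto
  also have "\<dots> = M * K * (x powr (2*c - 1) * ((1 + x\<^sup>2) powr (- (2 * p + 1)/2) * (1 + x\<^sup>2) powr (- (2 * a)/2)))"
    by simp
  also have "(1 + x\<^sup>2) powr (- (2 * p + 1)/2) * (1 + x\<^sup>2) powr (- (2 * a)/2) = (1 + x\<^sup>2) powr (- (c + 1/2))"
    unfolding powr_add[symmetric] by (rule arg_cong[where f = "(powr) (1 + x\<^sup>2)"]) (simp add: c field_simps)
  finally show ?thesis .
qed

lemma set_integrable_J:
  assumes "\<And>x. isCont k x" "\<And>x. \<bar>k x\<bar> \<le> M * (1 + x\<^sup>2) powr (- (2 * p + 1)/2)" "M > 0"
  shows "set_integrable lborel {0<..} (\<lambda>x. x powr (2*c - 1) * (k x * h x))"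
proof -
  obtain K where K: "K > 0" "\<And>x. \<bar>h x\<bar> \<le> K * (1 + x\<^sup>2) powr (- (2 * a)/2)" by (rule H.bounds) blast
  show ?thesis
  proof (rule set_integrable_bound[OF weight_integrable[of "M * K"]])
    have [measurable]: "k \<in> borel_measurable borel" "h \<in> borel_measurable borel"
      using assms(1) H.continuous by (auto intro: continuous_borel)
    show "set_borel_measurable lborel {0<..} (\<lambda>x. x powr (2*c - 1) * (k x * h x))"
      unfolding set_borel_measurable_def by measurable
    show "AE x in lborel. x \<in> {0<..} \<longrightarrow> norm (x powr (2*c - 1) * (k x * h x))
         \<le> norm (M * K * (x powr (2*c - 1) * (1 + x\<^sup>2) powr (- (c + 1/2))))"
      using J_bound[OF assms(2) K(2) assms(3)] by (auto intro!: AE_I2 order.trans[OF _ abs_ge_self])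
  qed
qed

lemma J_integrable:
  assumes P: "P > 0"
  shows "set_integrable lborel {0<..} (\<lambda>x. x powr (2*c - 1) * (G.ker P x * h x))"
    "set_integrable lborel {0<..} (\<lambda>x. x powr (2*c - 1) * (G.ker_P P x * h x))"
    "set_integrable lborel {0<..} (\<lambda>x. x powr (2*c - 1) * (G.ker_PP P x * h x))"
proof -
  obtain M where M: "M > 0"
    "\<And>x. \<bar>G.ker P x\<bar> \<le> M * (1 + x\<^sup>2) powr (- (2 * p + 1)/2)"
    "\<And>x. \<bar>G.ker_P P x\<bar> \<le> M * (1 + x\<^sup>2) powr (- (2 * p + 1)/2)"
    "\<And>x. \<bar>G.ker_PP P x\<bar> \<le> M * (1 + x\<^sup>2) powr (- (2 * p + 1)/2)"
    by (rule G.ker_local_bound[of "P/2" "2*P"]) (use P in auto)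
  show "set_integrable lborel {0<..} (\<lambda>x. x powr (2*c - 1) * (G.ker P x * h x))"
    "set_integrable lborel {0<..} (\<lambda>x. x powr (2*c - 1) * (G.ker_P P x * h x))"
    "set_integrable lborel {0<..} (\<lambda>x. x powr (2*c - 1) * (G.ker_PP P x * h x))"
    using M P by (intro set_integrable_J[where M = M] G.ker_continuous; simp)+
qed

lemma J_deriv:
  assumes P: "P > 0"
  shows "(J G.ker has_real_derivative J G.ker_P P) (at P)" "(J G.ker_P has_real_derivative J G.ker_PP P) (at P)"
proof -
  obtain M where M: "M > 0"
    "\<And>Q x. P/2 < Q \<Longrightarrow> Q < 2*P \<Longrightarrow> \<bar>G.ker_P Q x\<bar> \<le> M * (1 + x\<^sup>2) powr (- (2 * p + 1)/2)"
    "\<And>Q x. P/2 < Q \<Longrightarrow> Q < 2*P \<Longrightarrow> \<bar>G.ker_PP Q x\<bar> \<le> M * (1 + x\<^sup>2) powr (- (2 * p + 1)/2)"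
    by (rule G.ker_local_bound[of "P/2" "2*P"]) (use P in auto)
  obtain K where K: "K > 0" "\<And>x. \<bar>h x\<bar> \<le> K * (1 + x\<^sup>2) powr (- (2 * a)/2)" by (rule H.bounds) blast
  let ?w = "\<lambda>x. indicator {0<..} x *\<^sub>R (M * K * (x powr (2*c - 1) * (1 + x\<^sup>2) powr (- (c + 1/2))))"
  have w: "integrable lborel ?w" using weight_integrable[of "M * K"] by (simp add: set_integrable_def)
  have le: "\<bar>indicator {0<..} x *\<^sub>R (x powr (2*c - 1) * (k * h x))\<bar> \<le> ?w x" if "\<bar>k\<bar> \<le> M * (1 + x\<^sup>2) powr (- (2 * p + 1)/2)" for k x
    using J_bound[OF that K(2) M(1)] by (simp add: indicator_def)
  have diff: "(J k has_real_derivative J k' P) (at P)"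
    if D: "\<And>Q x. Q > 0 \<Longrightarrow> ((\<lambda>P. k P x) has_real_derivative k' Q x) (at Q)"
      and int: "\<And>Q. Q > 0 \<Longrightarrow> set_integrable lborel {0<..} (\<lambda>x. x powr (2*c - 1) * (k Q x * h x))"
        "set_integrable lborel {0<..} (\<lambda>x. x powr (2*c - 1) * (k' P x * h x))"
      and bound: "\<And>Q x. P/2 < Q \<Longrightarrow> Q < 2*P \<Longrightarrow> \<bar>k' Q x\<bar> \<le> M * (1 + x\<^sup>2) powr (- (2 * p + 1)/2)"
    for k k'
  proof -
    have "((\<lambda>P. \<integral>x. indicator {0<..} x *\<^sub>R (x powr (2*c - 1) * (k P x * h x)) \<partial>lborel) has_real_derivative
        (\<integral>x. indicator {0<..} x *\<^sub>R (x powr (2*c - 1) * (k' P x * h x)) \<partial>lborel)) (at P)"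
    proof (rule has_real_derivative_integral[where l = "P/2" and r = "2*P", OF _ _ _ _ _ le[OF bound] w])
      fix Q x assume Q: "P/2 < Q" "Q < 2*P"
      show "((\<lambda>P. indicator {0<..} x *\<^sub>R (x powr (2*c - 1) * (k P x * h x))) has_real_derivative
          indicator {0<..} x *\<^sub>R (x powr (2*c - 1) * (k' Q x * h x))) (at Q)"
        unfolding real_scaleR_def using P Q by (intro DERIV_cmult DERIV_cmult_right D) auto
      show "integrable lborel (\<lambda>x. indicator {0<..} x *\<^sub>R (x powr (2*c - 1) * (k Q x * h x)))"
        using int(1)[of Q] P Q by (simp add: set_integrable_def)
    next
      show "(\<lambda>x. indicator {0<..} x *\<^sub>R (x powr (2*c - 1) * (k' P x * h x))) \<in> borel_measurable lborel"
        using int(2) unfolding set_integrable_def by (rule borel_measurable_integrable)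
    qed (use P in auto)
    thus ?thesis unfolding J_def [abs_def] set_lebesgue_integral_def .
  qed
  show "(J G.ker has_real_derivative J G.ker_P P) (at P)"
    by (rule diff[OF G.ker_deriv_P(1) J_integrable(1) J_integrable(2)[OF P] M(2)])
  show "(J G.ker_P has_real_derivative J G.ker_PP P) (at P)"
    by (rule diff[OF G.ker_deriv_P(2) J_integrable(2) J_integrable(3)[OF P] M(3)])
qed

text \<open>The integrand is an exact derivative by Lagrange's identity: \<open>h\<close> solves a second order
  equation, and \<open>\<partial>\<^sub>P\<^sup>2((1 - P\<^sup>2) ker)\<close> is minus the adjoint operator applied to \<open>ker\<close>.\<close>
lemma J_ode:
  assumes P: "P > 0"
  shows "(P\<^sup>2 - 1) * J G.ker_PP P + 4 * P * J G.ker_P P + 2 * J G.ker P = 0"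
proof -
  define k kx kxx where "k = G.ker P" "kx = G.ker_x P" "kxx = G.ker_xx P"
  define L where "L = (\<lambda>x. (P\<^sup>2 - 1) * G.ker_PP P x + 4 * P * G.ker_P P x + 2 * G.ker P x)"
  \<comment> \<open>In divergence form with respect to the weight x^(2c-1), the equation of h
    consists of (x^(2c-1) (1+x^2) h')', a drift \<kappa> x^(2c) h' and a term without derivatives.
    This \<kappa> supplies the last summand of the boundary term B.\<close>
  define \<kappa> where "\<kappa> = 4 * a + 1 - 2 * c"
  define B where "B = (\<lambda>x. x powr (2*c - 1) * ((1 + x\<^sup>2) * (k x * h' x - kx x * h x) + \<kappa> * x * (k x * h x)))"
  note Dk = G.ker_deriv_x[OF P, folded k_kx_kxx_def]
  \<comment> \<open>\<open>ker_ode\<close> and Euler's identity eliminate the derivatives in P. What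
    remains is an ordinary differential operator in x, the adjoint of that of h for the weight
    x^(2c-1).\<close>
  have L_eq: "L x = (1 + x\<^sup>2) * kxx x + ((2*c - 1) / x + 4 * p * x) * kx x + 2 * p * (2 * p - 1) * k x" if x: "x > 0" for x
  proof -
    have e: "x * kx x + P * G.ker_P P x = - (2 * p + 1) * k x"
      using G.ker_euler[OF P] by (simp add: k_kx_kxx_def)
    have o: "x * (1 + x\<^sup>2) * kxx x + ((2*c - 1) + (2*(2*p+1) + 1) * x\<^sup>2) * kx x + (2*p+1)\<^sup>2 * x * k x
       = x * (P * G.ker_P P x + (P\<^sup>2 - 1) * G.ker_PP P x)"
      using G.ker_ode[OF P] by (simp add: k_kx_kxx_def)
    have e': "P * G.ker_P P x = - (2 * p + 1) * k x - x * kx x" using e by simp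
    have "x * L x = x * (1 + x\<^sup>2) * kxx x + ((2*c - 1) + (2*(2*p+1) + 1) * x\<^sup>2) * kx x + (2*p+1)\<^sup>2 * x * k x
         + 3 * x * (P * G.ker_P P x) + 2 * x * k x"
      unfolding o by (simp add: L_def k_kx_kxx_def algebra_simps)
    also have "\<dots> = x * (1 + x\<^sup>2) * kxx x + ((2*c - 1) + (2*(2*p+1) + 1) * x\<^sup>2) * kx x + (2*p+1)\<^sup>2 * x * k x
         + 3 * x * (- (2 * p + 1) * k x - x * kx x) + 2 * x * k x"
      unfolding e' ..
    also have "\<dots>
       = x * (1 + x\<^sup>2) * kxx x + (2*c - 1 + 4 * p * x\<^sup>2) * kx x + 2 * p * (2 * p - 1) * x * k x"
      by (simp add: algebra_simps power2_eq_square)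
    also have "\<dots> = x * ((1 + x\<^sup>2) * kxx x + ((2*c - 1) / x + 4 * p * x) * kx x + 2 * p * (2 * p - 1) * k x)"
      using x by (simp add: field_simps power2_eq_square)
    finally show ?thesis using x by simp
  qed
  have DB: "(B has_real_derivative - (x powr (2*c - 1) * (L x * h x))) (at x)" if x: "x > 0" for x
  proof -
    define r where "r = (2*c - 1) / x"
    have r: "r * x = 2 * c - 1" using x by (simp add: r_def)
    have ho: "x * ((1 + x\<^sup>2) * h'' x + (r + (4*a + 2) * x) * h' x + 2 * a * (2 * a + 1) * h x) = 0"
    proof -
      have xr: "x * (r + (4*a + 2) * x) = (2*c - 1) + (2*(2*a) + 2) * x\<^sup>2"
        using r by (simp add: algebra_simps power2_eq_square)
      have "x * ((1 + x\<^sup>2) * h'' x + (r + (4*a + 2) * x) * h' x + 2 * a * (2 * a + 1) * h x)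
         = x * (1 + x\<^sup>2) * h'' x + (x * (r + (4*a + 2) * x)) * h' x + 2 * a * (2 * a + 1) * x * h x"
        by (simp add: algebra_simps)
      thus ?thesis unfolding xr using H.ode[of x] by simp
    qed
    hence "(1 + x\<^sup>2) * h'' x + (r + (4*a + 2) * x) * h' x + 2 * a * (2 * a + 1) * h x = 0"
      using x by simp
    hence ho: "(1 + x\<^sup>2) * h'' x = - ((r + (4*a + 2) * x) * h' x) - 2 * a * (2 * a + 1) * h x"
      by linarith
    have Dp: "((\<lambda>x. x powr (2*c - 1)) has_real_derivative x powr (2*c - 1) * r) (at x)"
      by (rule DERIV_cong[OF has_real_derivative_powr[OF x]]) (unfold powr_diff r_def, use x in simp)
    have Dq: "((\<lambda>x. (1 + x\<^sup>2) * (k x * h' x - kx x * h x) + \<kappa> * x * (k x * h x)) has_real_derivative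
      2 * x * (k x * h' x - kx x * h x) + (k x * ((1 + x\<^sup>2) * h'' x) - (1 + x\<^sup>2) * kxx x * h x)
       + \<kappa> * (k x * h x) + \<kappa> * x * (kx x * h x + k x * h' x)) (at x)"
      by (rule derivative_eq_intros Dk H.deriv H.deriv' refl)+ (simp add: algebra_simps)
    have "r * ((1 + x\<^sup>2) * (k x * h' x - kx x * h x) + \<kappa> * x * (k x * h x))
       = (r + (r * x) * x) * (k x * h' x - kx x * h x) + \<kappa> * (r * x) * (k x * h x)"
      by (simp add: algebra_simps power2_eq_square)
    hence rT: "r * ((1 + x\<^sup>2) * (k x * h' x - kx x * h x) + \<kappa> * x * (k x * h x))
       = (r + (2 * c - 1) * x) * (k x * h' x - kx x * h x) + \<kappa> * (2 * c - 1) * (k x * h x)"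
      unfolding r .
    have pc: "p = c - a" using c(1) by simp
    have Lr: "L x = (1 + x\<^sup>2) * kxx x + (r + 4 * p * x) * kx x + 2 * p * (2 * p - 1) * k x"
      unfolding r_def by (rule L_eq[OF x])
    have inner: "r * ((1 + x\<^sup>2) * (k x * h' x - kx x * h x) + \<kappa> * x * (k x * h x))
         + (2 * x * (k x * h' x - kx x * h x) + (k x * ((1 + x\<^sup>2) * h'' x) - (1 + x\<^sup>2) * kxx x * h x)
       + \<kappa> * (k x * h x) + \<kappa> * x * (kx x * h x + k x * h' x)) = - (L x * h x)"
      unfolding rT unfolding ho Lr \<kappa>_def pc by (simp add: algebra_simps power2_eq_square)
    show ?thesis unfolding B_def
    proof (rule DERIV_cong[OF DERIV_mult[OF Dp Dq]])
      have "x powr (2*c - 1) * r * ((1 + x\<^sup>2) * (k x * h' x - kx x * h x) + \<kappa> * x * (k x * h x))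
         + (2 * x * (k x * h' x - kx x * h x) + (k x * ((1 + x\<^sup>2) * h'' x) - (1 + x\<^sup>2) * kxx x * h x)
       + \<kappa> * (k x * h x) + \<kappa> * x * (kx x * h x + k x * h' x)) * x powr (2*c - 1)
        = x powr (2*c - 1) * (r * ((1 + x\<^sup>2) * (k x * h' x - kx x * h x) + \<kappa> * x * (k x * h x))
         + (2 * x * (k x * h' x - kx x * h x) + (k x * ((1 + x\<^sup>2) * h'' x) - (1 + x\<^sup>2) * kxx x * h x)
       + \<kappa> * (k x * h x) + \<kappa> * x * (kx x * h x + k x * h' x)))" by (simp only: distrib_left mult_ac)
      also have "\<dots> = x powr (2*c - 1) * (- (L x * h x))"
        unfolding inner ..
      finally show "x powr (2*c - 1) * r * ((1 + x\<^sup>2) * (k x * h' x - kx x * h x) + \<kappa> * x * (k x * h x))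
         + (2 * x * (k x * h' x - kx x * h x) + (k x * ((1 + x\<^sup>2) * h'' x) - (1 + x\<^sup>2) * kxx x * h x)
       + \<kappa> * (k x * h x) + \<kappa> * x * (kx x * h x + k x * h' x)) * x powr (2*c - 1) = - (x powr (2*c - 1) * (L x * h x))"
        by simp
    qed
  qed
  have cont_k: "isCont k x" "isCont kx x" "isCont (G.ker_P P) x" "isCont (G.ker_PP P) x" for x
    unfolding k_kx_kxx_def using G.ker_continuous[where v = x and h = "\<lambda>x. x" and g = "\<lambda>_. P"] P by simp_all
  have cont: "isCont (\<lambda>x. - (x powr (2*c - 1) * (L x * h x))) x" if "x > 0" for x
    unfolding L_def using that by (intro continuous_intros cont_k[unfolded k_kx_kxx_def] H.continuous) auto
  have split: "x powr (2*c - 1) * (L x * h x) = (P\<^sup>2 - 1) * (x powr (2*c - 1) * (G.ker_PP P x * h x))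
      + 4 * P * (x powr (2*c - 1) * (G.ker_P P x * h x)) + 2 * (x powr (2*c - 1) * (G.ker P x * h x))" for x
    by (simp add: L_def algebra_simps)
  have int: "set_integrable lborel {0<..} (\<lambda>x. x powr (2*c - 1) * (L x * h x))"
    unfolding split by (intro set_integral_add set_integrable_mult_right J_integrable P)
  have lim0: "(B \<longlongrightarrow> 0) (at_right 0)"
  proof -
    have c0: "isCont (\<lambda>x. (1 + x\<^sup>2) * (k x * h' x - kx x * h x) + \<kappa> * x * (k x * h x)) 0"
      by (intro continuous_intros cont_k H.continuous)
    \<comment> \<open>The boundary term at 0 vanishes because c > 1/2.\<close>
    have p0: "((\<lambda>x::real. x powr (2*c - 1)) \<longlongrightarrow> 0) (at_right 0)"
      using c by (intro powr_tendsto_at_right_0) simp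
    show ?thesis
      using tendsto_mult[OF p0 isCont_at_right[OF c0]] unfolding B_def by simp
  qed
  have lim_inf: "(B \<longlongrightarrow> 0) at_top"
  proof -
    obtain M where M: "M > 0"
      "\<And>x. \<bar>k x\<bar> \<le> M * (1 + x\<^sup>2) powr (- (2 * p + 1)/2)"
      "\<And>x. \<bar>G.ker_P P x\<bar> \<le> M * (1 + x\<^sup>2) powr (- (2 * p + 1)/2)"
      unfolding k_kx_kxx_def by (rule G.ker_local_bound[of "P/2" "2*P"]) (use P in auto)
    obtain K where K: "K > 0" "\<And>x. \<bar>h x\<bar> \<le> K * (1 + x\<^sup>2) powr (- (2 * a)/2)"
       "\<And>x. \<bar>x * h' x\<bar> \<le> K * (1 + x\<^sup>2) powr (- (2 * a)/2)" by (rule H.euler_bounds) blast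
    define M' where "M' = (2 * p + 1) * M + P * M"
    have M': "M' > 0" using M P p_pos by (simp add: M'_def add_pos_pos)
    have kx: "\<bar>x * kx x\<bar> \<le> M' * (1 + x\<^sup>2) powr (- (2 * p + 1)/2)" for x
    proof -
      have "x * kx x = - ((2 * p + 1) * k x) - P * G.ker_P P x"
        using G.ker_euler[OF P, of x] by (simp add: k_kx_kxx_def algebra_simps)
      hence "\<bar>x * kx x\<bar> \<le> (2 * p + 1) * \<bar>k x\<bar> + P * \<bar>G.ker_P P x\<bar>"
        using P p_pos abs_triangle_ineq4[of "- ((2 * p + 1) * k x)" "P * G.ker_P P x"] by (simp add: abs_mult)
      also have "\<dots> \<le> (2 * p + 1) * (M * (1 + x\<^sup>2) powr (- (2 * p + 1)/2)) + P * (M * (1 + x\<^sup>2) powr (- (2 * p + 1)/2))"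
        using P p_pos by (intro add_mono mult_left_mono M) auto
      finally show ?thesis by (simp add: M'_def algebra_simps)
    qed
    define D where "D = 2 * (M * K) + 2 * (M' * K) + \<bar>\<kappa>\<bar> * (M * K)"
    have bound: "\<bar>B x\<bar> \<le> D * (1 + x\<^sup>2) powr (- (1/2))" if x: "x \<ge> 1" for x
    proof -
      have le2: "1 + x\<^sup>2 \<le> 2 * (x * x)" using x mult_mono[of 1 x 1 x] by (simp add: power2_eq_square)
      define W where "W = x powr (2*c - 1) * (1 + x\<^sup>2) powr (- (c + 1/2))"
      have W: "x * W \<le> (1 + x\<^sup>2) powr (- (1/2))" "W \<ge> 0"
      proof -
        have "x * W = (x powr 1 * x powr (2*c - 1)) * (1 + x\<^sup>2) powr (- (c + 1/2))" using x by (simp add: W_def)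
        also have "x powr 1 * x powr (2*c - 1) = (x powr 2) powr c" unfolding powr_add[symmetric] powr_powr by simp
        also have "(x powr 2) powr c \<le> (1 + x\<^sup>2) powr c" using c x by (intro powr_mono2) auto
        also have "(1 + x\<^sup>2) powr c * (1 + x\<^sup>2) powr (- (c + 1/2)) = (1 + x\<^sup>2) powr (- (1/2))"
          unfolding powr_add[symmetric] by simp
        finally show "x * W \<le> (1 + x\<^sup>2) powr (- (1/2))" by (simp add: mult_right_mono)
        show "W \<ge> 0" by (simp add: W_def)
      qed
      have t1: "\<bar>x powr (2*c - 1) * (k x * (x * h' x))\<bar> \<le> M * K * W"
        unfolding W_def by (rule J_bound[OF M(2) K(3) M(1)])
      have t2: "\<bar>x powr (2*c - 1) * ((x * kx x) * h x)\<bar> \<le> M' * K * W"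
        unfolding W_def by (rule J_bound[OF kx K(2) M'])
      have t3: "\<bar>x powr (2*c - 1) * (k x * h x)\<bar> \<le> M * K * W"
        unfolding W_def by (rule J_bound[OF M(2) K(2) M(1)])
      \<comment> \<open>Writing 1 + x^2 as s x supplies the factor x that the bounds for x h' and x
        \<open>kx\<close> require. Since s <= 2x and W is of order x^(-2), B is of order
        1/x.\<close>
      define s where "s = (1 + x\<^sup>2) / x"
      have s: "1 + x\<^sup>2 = s * x" "0 \<le> s" "s \<le> 2 * x" using x le2 by (simp_all add: s_def field_simps)
      define T1 T2 T3 where T_def: "T1 = x powr (2*c - 1) * (k x * (x * h' x))" "T2 = x powr (2*c - 1) * ((x * kx x) * h x)"
        "T3 = x powr (2*c - 1) * (k x * h x)"
      have "B x = s * T1 - s * T2 + \<kappa> * x * T3"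
        unfolding B_def s(1) T_def by (simp add: algebra_simps)
      also have "\<bar>\<dots>\<bar> \<le> \<bar>s * T1\<bar> + \<bar>s * T2\<bar> + \<bar>\<kappa> * x * T3\<bar>" by linarith
      also have "\<dots> = s * \<bar>T1\<bar> + s * \<bar>T2\<bar> + \<bar>\<kappa>\<bar> * x * \<bar>T3\<bar>"
        using s(2) x by (simp only: abs_mult abs_of_nonneg)
      also have "\<dots> \<le> (2 * x) * (M * K * W) + (2 * x) * (M' * K * W) + \<bar>\<kappa>\<bar> * x * (M * K * W)"
        using s x t1 t2 t3 unfolding T_def[symmetric] by (intro add_mono mult_mono) simp_all
      also have "\<dots> = D * (x * W)" by (simp add: D_def algebra_simps)
      also have "\<dots> \<le> D * (1 + x\<^sup>2) powr (- (1/2))"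
        using W M(1) M' K(1) by (intro mult_left_mono) (auto simp: D_def)
      finally show ?thesis .
    qed
    have limD: "((\<lambda>x::real. D * (1 + x\<^sup>2) powr (- (1/2))) \<longlongrightarrow> 0) at_top"
      by (intro tendsto_mult_right_zero tendsto_neg_powr filterlim_one_plus_square) auto
    show ?thesis
      by (rule Lim_null_comparison[OF eventually_mono[OF eventually_ge_at_top[of 1]] limD]) (use bound in simp)
  qed
  have "(LINT x:{0<..}|lborel. - (x powr (2*c - 1) * (L x * h x))) = 0 - 0"
    by (rule FTC_Ioi[OF DB cont _ lim0 lim_inf]) (use int in \<open>simp_all add: set_integrable_def\<close>)
  hence zero: "(LINT x:{0<..}|lborel. x powr (2*c - 1) * (L x * h x)) = 0"
    by (simp add: set_lebesgue_integral_def)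
  note I = set_integrable_mult_right[OF J_integrable(3)[OF P], of "P\<^sup>2 - 1"]
      set_integrable_mult_right[OF J_integrable(2)[OF P], of "4 * P"] set_integrable_mult_right[OF J_integrable(1)[OF P], of 2]
  have "(LINT x:{0<..}|lborel. x powr (2*c - 1) * (L x * h x)) = (P\<^sup>2 - 1) * J G.ker_PP P + 4 * P * J G.ker_P P + 2 * J G.ker P"
    unfolding split J_def set_integral_add(2)[OF set_integral_add(1)[OF I(1,2)] I(3)] set_integral_add(2)[OF I(1,2)]
      set_integral_mult_right ..
  with zero show ?thesis by simp
qed

text \<open>By \<open>J_ode\<close> the function N(P) = (1 - P^2) J(P) is affine. It vanishes at P =
  1 because J is finite there, so it is a multiple of 1 - P, and the slope N'(1) = -2 J(1)
  determines the multiple.\<close>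

lemma J_eq:
  assumes P: "P > 0"
  shows "J G.ker P = 2 * J G.ker 1 / (1 + P)"
proof -
  define N where "N = (\<lambda>P. (1 - P\<^sup>2) * J G.ker P)"
  define N' where "N' = (\<lambda>P. (1 - P\<^sup>2) * J G.ker_P P - 2 * P * J G.ker P)"
  have DN: "(N has_real_derivative N' P) (at P)" if "P > 0" for P
    unfolding N_def N'_def by (rule derivative_eq_intros J_deriv that refl)+ (simp add: algebra_simps)
  have DN': "(N' has_real_derivative 0) (at P)" if "P > 0" for P
    unfolding N'_def
    by (rule derivative_eq_intros J_deriv that refl)+ (use J_ode[OF that] in \<open>simp add: algebra_simps power2_eq_square\<close>)
  have "\<exists>k. \<forall>Q\<in>{0<..}. N' Q = k"
    by (rule has_field_derivative_zero_constant) (use DN' in \<open>auto intro: has_field_derivative_at_within\<close>)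
  then obtain k where k: "\<And>Q. Q > 0 \<Longrightarrow> N' Q = k" by auto
  have "\<exists>d. \<forall>Q\<in>{0<..}. N Q - k * Q = d"
  proof (rule has_field_derivative_zero_constant)
    fix Q :: real assume Q: "Q \<in> {0<..}"
    show "((\<lambda>P. N P - k * P) has_real_derivative 0) (at Q within {0<..})"
      by (rule derivative_eq_intros has_field_derivative_at_within[OF DN] refl)+ (use Q k[of Q] in auto)
  qed simp
  then obtain d where d: "\<forall>Q\<in>{0<..}. N Q - k * Q = d" by blast
  have eq0: "N P - k * P = N 1 - k * 1" using bspec[OF d, of P] bspec[OF d, of 1] P by simp
  have k1: "k = - 2 * J G.ker 1" using k[of 1] by (simp add: N'_def)
  have eq: "(1 - P\<^sup>2) * J G.ker P = 2 * J G.ker 1 * (1 - P)"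
    using eq0 unfolding k1 by (simp add: N_def algebra_simps)
  show ?thesis
  proof (cases "P = 1")
    case False
    have "(1 - P) * ((1 + P) * J G.ker P) = (1 - P) * (2 * J G.ker 1)"
      using eq by (simp add: algebra_simps power2_eq_square)
    hence "(1 + P) * J G.ker P = 2 * J G.ker 1"
      by (rule mult_left_cancel[THEN iffD1, rotated]) (use False in simp)
    thus ?thesis using P by (simp add: nonzero_eq_divide_eq mult.commute)
  qed simp
qed

text \<open>The substitution x -> Q x brings the second kernel to Q = 1. Weight and measure
  contribute Q^(2c), the kernels Q^(-2p-1-2a), together 1/Q, and J(P/Q)/Q takes the form symmetric
  in P and Q.\<close>

lemma J_scaled:
  assumes "P > 0" "Q > 0"
  shows "(LINT x:{0<..}|lborel. x powr (2*c - 1) * (G.ker P x * H.ker Q x)) = 2 * J G.ker 1 / (P + Q)"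
proof -
  have pw: "(Q * x) powr (2*c - 1) * (G.ker P (Q * x) * H.ker Q (Q * x)) = Q powr (-2) * (x powr (2*c - 1) * (G.ker (P / Q) x * h x))" if x: "x > 0" for x
  proof -
    have "G.ker P (Q * x) = P powr (- (2*p+1)) * g (Q * x / P)" by (simp add: G.ker_def)
    also have "\<dots> = Q powr (- (2*p+1)) * G.ker (P / Q) x"
      using assms by (simp add: G.ker_def powr_divide mult.commute[of Q x])
    finally have 1: "G.ker P (Q * x) = Q powr (- (2*p+1)) * G.ker (P / Q) x" .
    have 2: "H.ker Q (Q * x) = Q powr (- (2*a)) * h x" using assms by (simp add: H.ker_def)
    have 3: "(Q * x) powr (2*c - 1) = Q powr (2*c - 1) * x powr (2*c - 1)" using assms x by (simp add: powr_mult)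
    have e: "Q powr (2*c - 1) * Q powr (- (2*p+1)) * Q powr (- (2*a)) = Q powr (-2)"
      unfolding powr_add[symmetric] by (rule arg_cong[where f = "(powr) Q"]) (simp add: c)
    have "(Q * x) powr (2*c - 1) * (G.ker P (Q * x) * H.ker Q (Q * x))
       = (Q powr (2*c - 1) * Q powr (- (2*p+1)) * Q powr (- (2*a))) * (x powr (2*c - 1) * (G.ker (P / Q) x * h x))"
      unfolding 1 2 3 by (simp only: mult_ac)
    thus ?thesis unfolding e .
  qed
  have "(LINT x:{0<..}|lborel. x powr (2*c - 1) * (G.ker P x * H.ker Q x))
     = Q * (\<integral>x. indicator {0<..} (Q * x) * ((Q * x) powr (2*c - 1) * (G.ker P (Q * x) * H.ker Q (Q * x))) \<partial>lborel)"
    unfolding set_lebesgue_integral_def using assms by (subst lborel_integral_real_affine[of Q _ 0]) auto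
  also have "(\<integral>x. indicator {0<..} (Q * x) * ((Q * x) powr (2*c - 1) * (G.ker P (Q * x) * H.ker Q (Q * x))) \<partial>lborel)
     = (\<integral>x. Q powr (-2) * (indicator {0<..} x *\<^sub>R (x powr (2*c - 1) * (G.ker (P / Q) x * h x))) \<partial>lborel)"
    using assms by (intro Bochner_Integration.integral_cong refl) (auto simp: indicator_def pw zero_less_mult_iff)
  also have "\<dots> = Q powr (-2) * J G.ker (P / Q)"
    unfolding J_def set_lebesgue_integral_def by (rule integral_mult_right_zero)
  also have "Q * (Q powr (-2) * J G.ker (P / Q)) = Q * Q powr (-2) * (2 * J G.ker 1 / (1 + P / Q))"
    using J_eq[of "P / Q"] assms by simp
  also have "Q * Q powr (-2) = 1 / Q"
    using assms by (simp add: powr_minus_divide power2_eq_square)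
  finally show ?thesis using assms by (simp add: field_simps)
qed

text \<open>The limit of P J(P) at infinity is computed twice. By \<open>J_eq\<close> it is 2 J(1).
  After x -> P x it is the limit of the integral of x^(2c-1) g(x) P^(2a) h(Px), where P^(2a) h(Px)
  tends to \<open>hinf\<close> x^(-2a) and is dominated by K x^(-2a); the Mellin integral of g
  remains.\<close>

lemma J_1_limit:
  assumes lim: "((\<lambda>x. x powr (2*a) * h x) \<longlongrightarrow> hinf) at_top"
  shows "2 * J G.ker 1 = hinf * (LINT x:{0<..}|lborel. x powr (2*p - 1) * g x)"
proof -
  obtain K where K: "K > 0" "\<And>x. \<bar>h x\<bar> \<le> K * (1 + x\<^sup>2) powr (- (2 * a)/2)" by (rule H.bounds) blast
  obtain L where L: "L > 0" "\<And>x. \<bar>g x\<bar> \<le> L * (1 + x\<^sup>2) powr (- (2 * p + 1)/2)" by (rule G.bounds) blast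
  have [measurable]: "g \<in> borel_measurable borel" "h \<in> borel_measurable borel"
    using G.continuous H.continuous by (auto intro: continuous_borel)
  define P where "P = (\<lambda>n. real (Suc n))"
  have P: "P n > 0" for n by (simp add: P_def)
  have Plim: "filterlim P at_top sequentially" unfolding P_def
    by (rule filterlim_compose[OF filterlim_real_sequentially filterlim_Suc])
  define F where "F = (\<lambda>n x. indicator {0<..} x * (x powr (2*c - 1) * (g x * (P n powr (2*a) * h (P n * x)))))"
  have "(\<lambda>n. \<integral>x. F n x \<partial>lborel) \<longlonglongrightarrow> (\<integral>x. indicator {0<..} x * (x powr (2*p - 1) * g x * hinf) \<partial>lborel)"
  proof (rule integral_dominated_convergence)
    show "(\<lambda>x. indicator {0<..} x * (x powr (2*p - 1) * g x * hinf)) \<in> borel_measurable lborel" by measurable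
    show "F n \<in> borel_measurable lborel" for n unfolding F_def by measurable
    have "set_integrable lborel {0<..} (\<lambda>x. L * K * (x powr (2*p - 1) * (1 + x\<^sup>2) powr (- (p + 1/2))))"
      using p_pos by (intro set_integrable_mult_right set_integrable_weight) auto
    thus "integrable lborel (\<lambda>x. indicator {0<..} x * (L * K * (x powr (2*p - 1) * (1 + x\<^sup>2) powr (- (p + 1/2)))))"
      by (simp add: set_integrable_def)
    have split: "x powr (2*c - 1) * x powr (- (2*a)) = x powr (2*p - 1)" for x
      unfolding powr_add[symmetric] by (rule arg_cong[where f = "(powr) x"]) (simp add: c)
    show "AE x in lborel. (\<lambda>n. F n x) \<longlonglongrightarrow> indicator {0<..} x * (x powr (2*p - 1) * g x * hinf)"
    proof (rule AE_I2)
      fix x :: real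
      show "(\<lambda>n. F n x) \<longlonglongrightarrow> indicator {0<..} x * (x powr (2*p - 1) * g x * hinf)"
      proof (cases "x > 0")
        case True
        have "filterlim (\<lambda>n. P n * x) at_top sequentially"
          by (rule filterlim_at_top_mult_tendsto_pos[OF tendsto_const True Plim])
        hence "(\<lambda>n. x powr (2*p - 1) * g x * ((P n * x) powr (2*a) * h (P n * x))) \<longlonglongrightarrow> x powr (2*p - 1) * g x * hinf"
          by (intro tendsto_mult_left filterlim_compose[OF lim])
        moreover have "F n x = x powr (2*p - 1) * g x * ((P n * x) powr (2*a) * h (P n * x))" for n
        proof -
          have "(P n * x) powr (2*a) = P n powr (2*a) * x powr (2*a)" using P True by (simp add: powr_mult less_imp_le)
          hence "x powr (2*p - 1) * g x * ((P n * x) powr (2*a) * h (P n * x)) = (x powr (2*p - 1) * x powr (2*a)) * (g x * (P n powr (2*a) * h (P n * x)))"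
            by (simp only: mult_ac)
          also have "x powr (2*p - 1) * x powr (2*a) = x powr (2*c - 1)"
            unfolding powr_add[symmetric] by (rule arg_cong[where f = "(powr) x"]) (simp add: c)
          finally have "x powr (2*p - 1) * g x * ((P n * x) powr (2*a) * h (P n * x)) = x powr (2*c - 1) * (g x * (P n powr (2*a) * h (P n * x)))" .
          moreover have "F n x = x powr (2*c - 1) * (g x * (P n powr (2*a) * h (P n * x)))" using True by (simp add: F_def)
          ultimately show ?thesis by (simp only:)
        qed
        ultimately show ?thesis using True by simp
      qed (simp add: F_def)
    qed
    show "AE x in lborel. norm (F n x) \<le> indicator {0<..} x * (L * K * (x powr (2*p - 1) * (1 + x\<^sup>2) powr (- (p + 1/2))))" for n
    proof (rule AE_I2)
      fix x :: real
      show "norm (F n x) \<le> indicator {0<..} x * (L * K * (x powr (2*p - 1) * (1 + x\<^sup>2) powr (- (p + 1/2))))"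
      proof (cases "x > 0")
        case True
        have hb: "P n powr (2*a) * \<bar>h (P n * x)\<bar> \<le> K * x powr (- (2*a))"
        proof -
          have "(1 + (P n * x)\<^sup>2) powr (- (2*a)/2) \<le> ((P n * x)\<^sup>2) powr (- (2*a)/2)"
            using a_pos P[of n] True by (intro powr_mono2') auto
          also have "\<dots> = ((P n * x) powr 2) powr (- (2*a)/2)" using P[of n] True by simp
          also have "\<dots> = P n powr (- (2*a)) * x powr (- (2*a))"
            unfolding powr_powr using P[of n] True by (simp add: powr_mult less_imp_le)
          finally have "\<bar>h (P n * x)\<bar> \<le> K * (P n powr (- (2*a)) * x powr (- (2*a)))"
            using K(1) by (intro order.trans[OF K(2)] mult_left_mono) auto
          hence "P n powr (2*a) * \<bar>h (P n * x)\<bar> \<le> P n powr (2*a) * (K * (P n powr (- (2*a)) * x powr (- (2*a))))"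
            by (intro mult_left_mono) auto
          also have "\<dots> = (P n powr (2*a) * P n powr (- (2*a))) * (K * x powr (- (2*a)))" by (simp only: mult_ac)
          also have "P n powr (2*a) * P n powr (- (2*a)) = 1" using P[of n] by (simp flip: powr_add)
          finally show ?thesis by simp
        qed
        have "x powr (2*c - 1) * (\<bar>g x\<bar> * (P n powr (2*a) * \<bar>h (P n * x)\<bar>)) \<le> x powr (2*c - 1) * ((L * (1 + x\<^sup>2) powr (- (2 * p + 1)/2)) * (K * x powr (- (2*a))))"
          by (intro mult_left_mono mult_mono[OF L(2) hb]) (use L(1) in auto)
        also have "\<dots> = L * K * ((x powr (2*c - 1) * x powr (- (2*a))) * (1 + x\<^sup>2) powr (- (2 * p + 1)/2))" by (simp only: mult_ac)
        also have "(1 + x\<^sup>2) powr (- (2 * p + 1)/2) = (1 + x\<^sup>2) powr (- (p + 1/2))"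
          by (rule arg_cong[where f = "(powr) (1 + x\<^sup>2)"]) (simp add: field_simps)
        finally show ?thesis using True unfolding split by (simp add: F_def abs_mult)
      qed (simp add: F_def)
    qed
  qed
  also have "(\<integral>x. indicator {0<..} x * (x powr (2*p - 1) * g x * hinf) \<partial>lborel) = hinf * (LINT x:{0<..}|lborel. x powr (2*p - 1) * g x)"
    unfolding set_lebesgue_integral_def integral_mult_right_zero[symmetric]
    by (rule Bochner_Integration.integral_cong) (simp_all add: mult_ac)
  finally have lim1: "(\<lambda>n. \<integral>x. F n x \<partial>lborel) \<longlonglongrightarrow> hinf * (LINT x:{0<..}|lborel. x powr (2*p - 1) * g x)" .
  have "(\<integral>x. F n x \<partial>lborel) = P n * J G.ker (P n)" for n
  proof -
    have pw: "(P n * x) powr (2*c - 1) * (G.ker (P n) (P n * x) * h (P n * x)) = P n powr (-2) * (x powr (2*c - 1) * (g x * (P n powr (2*a) * h (P n * x))))" if x: "x > 0" for x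
    proof -
      have 1: "G.ker (P n) (P n * x) = P n powr (- (2*p+1)) * g x" using P[of n] by (simp add: G.ker_def)
      have 3: "(P n * x) powr (2*c - 1) = P n powr (2*c - 1) * x powr (2*c - 1)" using P[of n] x by (simp add: powr_mult less_imp_le)
      have e: "P n powr (2*c - 1) * P n powr (- (2*p+1)) = P n powr (-2) * P n powr (2*a)"
        unfolding powr_add[symmetric] by (rule arg_cong[where f = "(powr) (P n)"]) (simp add: c)
      have "(P n * x) powr (2*c - 1) * (G.ker (P n) (P n * x) * h (P n * x))
         = (P n powr (2*c - 1) * P n powr (- (2*p+1))) * (x powr (2*c - 1) * (g x * h (P n * x)))"
        unfolding 1 3 by (simp only: mult_ac)
      thus ?thesis unfolding e by (simp only: mult_ac)
    qed
    have "J G.ker (P n) = P n * (\<integral>x. indicator {0<..} (P n * x) * ((P n * x) powr (2*c - 1) * (G.ker (P n) (P n * x) * h (P n * x))) \<partial>lborel)"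
      unfolding J_def set_lebesgue_integral_def using P[of n] by (subst lborel_integral_real_affine[of "P n" _ 0]) auto
    also have "(\<integral>x. indicator {0<..} (P n * x) * ((P n * x) powr (2*c - 1) * (G.ker (P n) (P n * x) * h (P n * x))) \<partial>lborel)
       = (\<integral>x. P n powr (-2) * F n x \<partial>lborel)"
    proof (intro Bochner_Integration.integral_cong refl)
      fix x :: real
      show "indicator {0<..} (P n * x) * ((P n * x) powr (2*c - 1) * (G.ker (P n) (P n * x) * h (P n * x))) = P n powr (-2) * F n x"
      proof (cases "x > 0")
        case True
        hence "indicator {0<..} (P n * x) = (1::real)" "indicator {0<..} x = (1::real)" using P[of n] by simp_all
        thus ?thesis by (simp only: F_def pw[OF True] mult_1_left)
      qed (use P[of n] in \<open>simp add: F_def indicator_def zero_less_mult_iff\<close>)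
    qed
    also have "\<dots> = P n powr (-2) * (\<integral>x. F n x \<partial>lborel)" by (rule integral_mult_right_zero)
    finally have "P n * J G.ker (P n) = (P n * P n * P n powr (-2)) * (\<integral>x. F n x \<partial>lborel)" by simp
    also have "P n * P n * P n powr (-2) = 1" using P[of n] by (simp add: powr_minus_divide power2_eq_square)
    finally show ?thesis by simp
  qed
  hence "(\<integral>x. F n x \<partial>lborel) = 2 * J G.ker 1 * (P n / (1 + P n))" for n
    using J_eq[OF P[of n]] by (simp add: mult_ac)
  moreover have "(\<lambda>n. 2 * J G.ker 1 * (P n / (1 + P n))) \<longlonglongrightarrow> 2 * J G.ker 1 * 1"
  proof (intro tendsto_intros)
    have "(\<lambda>n. 1 - inverse (1 + P n)) \<longlonglongrightarrow> 1 - 0"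
      by (intro tendsto_intros tendsto_inverse_0_at_top filterlim_tendsto_add_at_top[OF tendsto_const Plim])
    moreover have "1 - inverse (1 + P n) = P n / (1 + P n)" for n using P[of n] by (simp add: field_simps)
    ultimately show "(\<lambda>n. P n / (1 + P n)) \<longlonglongrightarrow> 1" by simp
  qed
  ultimately have "(\<lambda>n. \<integral>x. F n x \<partial>lborel) \<longlonglongrightarrow> 2 * J G.ker 1" by simp
  from LIMSEQ_unique[OF this lim1] show ?thesis .
qed

end

section \<open>A Fourier integral and asymptotics\<close>

lemma Gamma_1_plus_imag:
  assumes "t \<noteq> 0"
  shows "(norm (Gamma (1 + \<i> * complex_of_real t)))\<^sup>2 = pi * t / sinh (pi * t)"
proof -
  define z where "z = \<i> * complex_of_real t"
  have z: "z \<noteq> 0" using assms by (simp add: z_def)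
  have "z \<notin> \<int>\<^sub>\<le>\<^sub>0" using assms by (auto elim!: nonpos_Ints_cases simp: z_def complex_eq_iff)
  hence G1: "Gamma (1 + z) = z * Gamma z" using Gamma_plus1[of z] by (simp add: add.commute)
  have "cnj (1 + z) = 1 - z" by (simp add: z_def)
  hence "complex_of_real ((norm (Gamma (1 + z)))\<^sup>2) = Gamma (1 + z) * Gamma (1 - z)"
    by (simp only: complex_norm_square cnj_Gamma)
  also have "\<dots> = z * (Gamma z * Gamma (1 - z))" by (simp only: G1 mult.assoc)
  also have "\<dots> = z * (of_real pi / sin (of_real pi * z))" by (simp only: Gamma_reflection_complex)
  finally have 1: "complex_of_real ((norm (Gamma (1 + z)))\<^sup>2) = z * (of_real pi / sin (of_real pi * z))" .
  have "sin (of_real pi * z) = \<i> * of_real (sinh (pi * t))"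
  proof -
    have "sin (of_real pi * z) = \<i> * sinh (complex_of_real (pi * t))"
      by (simp add: z_def sinh_conv_sin mult_ac)
    also have "sinh (complex_of_real (pi * t)) = of_real (sinh (pi * t))"
      by (simp only: sinh_field_def exp_of_real of_real_minus[symmetric] of_real_diff of_real_divide of_real_numeral)
    finally show ?thesis .
  qed
  hence "complex_of_real ((norm (Gamma (1 + z)))\<^sup>2) = of_real (pi * t / sinh (pi * t))"
    unfolding 1 by (simp add: z_def)
  thus ?thesis unfolding z_def by (simp only: of_real_eq_iff)
qed

text \<open>The addition theorems give cosh u + cosh v = 2 cosh A cosh B with A = (v+u)/2 and B =
  (v-u)/2. As a difference of translates of tanh, the kernel has a derivative built from translates
  of 1/cosh^2, whose transform is known.\<close>

lemma inverse_cosh_sum: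
  fixes u v :: real
  assumes "u \<noteq> 0"
  shows "1 / (cosh u + cosh v) = (tanh ((v + u) / 2) - tanh ((v - u) / 2)) / (2 * sinh u)"
proof -
  define A B where "A = (v + u) / 2" "B = (v - u) / 2"
  have uv: "u = A - B" "v = A + B" by (simp_all add: A_B_def field_simps)
  have nz: "cosh A > 0" "cosh B > 0" "sinh u \<noteq> 0" using assms by simp_all
  have "cosh u + cosh v = 2 * (cosh A * cosh B)" unfolding uv by (simp add: cosh_add cosh_diff)
  moreover have "tanh A - tanh B = sinh u / (cosh A * cosh B)"
    using nz unfolding uv(1) sinh_diff by (simp add: tanh_def field_simps)
  ultimately show ?thesis unfolding A_B_def[symmetric] using nz by (simp add: field_simps)
qed

text \<open>Integration by parts passes to D', a difference of translates of 1/cosh^2(x/2). The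
  translations by u and -u produce the factor sin(tu), and the remaining cosine transform is the
  case a = 1 of \<open>cosh_integral_Gamma\<close>, where |Gamma(1 + it)|^2 is elementary.\<close>

lemma fourier_inverse_cosh_sum:
  fixes t u :: real
  assumes t: "t > 0" and u: "u \<noteq> 0"
  shows "(\<integral>v. cos (t * v) / (cosh u + cosh v) \<partial>lborel) = 2 * pi * sin (t * u) / (sinh u * sinh (pi * t))"
proof -
  define D where "D = (\<lambda>v. tanh ((v + u) / 2) - tanh ((v - u) / 2))"
  define S where "S = (\<lambda>x::real. 1 - tanh (1 / 2 * x) ^ 2)"
  have D_eq: "D v = 2 * sinh u * (1 / (cosh u + cosh v))" for v
    using inverse_cosh_sum[OF u, of v] u by (simp add: D_def)
  have S_int: "integrable lborel S" unfolding S_def by (rule integrable_sech_squared) simp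
  have S_pos: "S x \<ge> 0" for x
    using tanh_real_bounds[of "1 / 2 * x"] by (simp add: S_def abs_square_le_1 abs_le_iff)
  have S_meas [measurable]: "S \<in> borel_measurable borel" using borel_measurable_integrable[OF S_int] by simp
  have S_cont: "isCont S x" for x unfolding S_def by (intro continuous_intros) auto
  have trig: "integrable lborel (\<lambda>x. sin (t * x + b) * S x)" for b
    by (rule Bochner_Integration.integrable_bound[OF S_int])
       (use S_pos abs_sin_le_one in \<open>auto intro!: AE_I2 mult_right_le_one_le simp: abs_mult mult_left_le_one_le\<close>)
  have trigc: "integrable lborel (\<lambda>x. cos (t * x) * S x)"
    using trig[of "pi/2"] by (simp add: sin_add)
  have shift_i: "integrable lborel (\<lambda>v. sin (t * v) * S (v + b))" for b
    using lborel_integrable_real_affine[OF trig[of "- (t * b)"], of 1 b] by (simp add: algebra_simps)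
  have shift: "(\<integral>v. sin (t * v) * S (v + b) \<partial>lborel) = (\<integral>x. sin (t * x + - (t * b)) * S x \<partial>lborel)" for b
    by (subst (2) lborel_integral_real_affine[of 1 _ b]) (simp_all add: algebra_simps)
  define Sh where "Sh = (\<integral>x. cos (t * x) * S x \<partial>lborel)"
  have Sh: "Sh = 4 * (pi * t / sinh (pi * t))"
  proof -
    have "Sh = 2 * (\<integral>y. cos (2 * t * y) * cosh y powr (- (2 * 1)) \<partial>lborel)"
      unfolding Sh_def
    proof (subst lborel_integral_real_affine[of 2 _ 0])
      have "cos (t * (0 + 2 * y)) * S (0 + 2 * y) = cos (2 * t * y) * cosh y powr (- (2 * 1))" for y
      proof -
        have "S (0 + 2 * y) = cosh y powr (- (2 * 1))"
          using cosh_real_pos[of y] one_minus_tanh_square[of y] by (simp add: S_def powr_minus_divide)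
        thus ?thesis by (simp add: mult_ac)
      qed
      thus "\<bar>2::real\<bar> *\<^sub>R (\<integral>y. cos (t * (0 + 2 * y)) * S (0 + 2 * y) \<partial>lborel) = 2 * (\<integral>y. cos (2 * t * y) * cosh y powr (- (2 * 1)) \<partial>lborel)"
        by simp
    qed simp
    also have "\<dots> = 4 * (norm (Gamma (1 + \<i> * complex_of_real t)))\<^sup>2"
      using cosh_integral_Gamma[of 1 "2 * t"] by (simp add: Gamma_numeral)
    finally show ?thesis using Gamma_1_plus_imag[of t] t by simp
  qed
  define F where "F = (\<lambda>v. sin (t * v) * D v)"
  define f where "f = (\<lambda>v. t * (cos (t * v) * D v) + (sin (t * v) * S (v + u) - sin (t * v) * S (v + - u)) / 2)"
  have DD: "(D has_real_derivative (S (v + u) - S (v + - u)) / 2) (at v)" for v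
    unfolding D_def S_def by (auto intro!: derivative_eq_intros simp: field_simps)
  have DF: "(F has_real_derivative f v) (at v)" for v
    unfolding F_def f_def by (rule derivative_eq_intros DD refl)+ (simp add: algebra_simps diff_divide_distrib)
  have D_cont: "isCont D v" for v by (rule DERIV_isCont[OF DD])
  have D_le: "\<bar>D v\<bar> \<le> 2 * \<bar>sinh u\<bar> * cosh v powr (- 1)" for v
  proof -
    have "1 / (cosh u + cosh v) \<le> 1 / cosh v" by (intro frac_le) auto
    hence "2 * \<bar>sinh u\<bar> * (1 / (cosh u + cosh v)) \<le> 2 * \<bar>sinh u\<bar> * (1 / cosh v)"
      by (intro mult_left_mono) auto
    moreover have "\<bar>D v\<bar> = 2 * \<bar>sinh u\<bar> * (1 / (cosh u + cosh v))"
      unfolding D_eq abs_mult using cosh_real_pos[of u] cosh_real_pos[of v] by (simp add: add_pos_pos abs_of_pos)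
    ultimately have "\<bar>D v\<bar> \<le> 2 * \<bar>sinh u\<bar> * (1 / cosh v)" by simp
    thus ?thesis using cosh_real_pos[of v] by (simp add: powr_minus_divide)
  qed
  have cD_int: "integrable lborel (\<lambda>v. cos (t * v) * D v)"
  proof (rule Bochner_Integration.integrable_bound)
    show "integrable lborel (\<lambda>v. 2 * \<bar>sinh u\<bar> * cosh v powr (- 1))"
      by (intro integrable_mult_right integrable_cosh_powr) simp
    have "(\<lambda>v. cos (t * v) * D v) \<in> borel_measurable borel"
      by (intro continuous_borel continuous_intros D_cont)
    thus "(\<lambda>v. cos (t * v) * D v) \<in> borel_measurable lborel" by simp
    have "\<bar>cos (t * v) * D v\<bar> \<le> 2 * \<bar>sinh u\<bar> * cosh v powr (- 1)" for v
      using mult_mono[OF abs_cos_le_one D_le[of v], of "t * v"] by (simp add: abs_mult)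
    thus "AE v in lborel. norm (cos (t * v) * D v) \<le> norm (2 * \<bar>sinh u\<bar> * cosh v powr (- 1))"
      by (auto intro!: AE_I2 order.trans[OF _ abs_ge_self])
  qed
  have f_int: "integrable lborel f"
    unfolding f_def by (intro Bochner_Integration.integrable_add integrable_mult_right integrable_divide
       Bochner_Integration.integrable_diff cD_int shift_i)
  have f_cont: "isCont f v" for v
    unfolding f_def by (intro continuous_intros D_cont isCont_o2[OF _ S_cont]) auto
  have cosh_lim: "((\<lambda>v::real. cosh v powr (- 1)) \<longlongrightarrow> 0) at_top" "((\<lambda>v::real. cosh v powr (- 1)) \<longlongrightarrow> 0) at_bot"
    by (intro tendsto_neg_powr cosh_real_at_top cosh_real_at_bot; simp)+
  have F_le: "norm (F v) \<le> 2 * \<bar>sinh u\<bar> * cosh v powr (- 1)" for v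
    unfolding F_def using mult_mono[OF abs_sin_le_one D_le[of v], of "t * v"] by (simp add: abs_mult)
  have F_lim: "(F \<longlongrightarrow> 0) at_top" "(F \<longlongrightarrow> 0) at_bot"
    by (rule Lim_null_comparison[OF always_eventually tendsto_mult_right_zero[OF cosh_lim(1)]], use F_le in force)
       (rule Lim_null_comparison[OF always_eventually tendsto_mult_right_zero[OF cosh_lim(2)]], use F_le in force)
  have "0 = (\<integral>v. f v \<partial>lborel)"
    using FTC_real_line[OF DF f_cont f_int F_lim(2,1)] by simp
  also have "\<dots> = t * (\<integral>v. cos (t * v) * D v \<partial>lborel) + ((\<integral>v. sin (t * v) * S (v + u) \<partial>lborel) - (\<integral>v. sin (t * v) * S (v + - u) \<partial>lborel)) / 2"
    unfolding f_def Bochner_Integration.integral_add[OF integrable_mult_right[OF cD_int]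
        integrable_divide[OF Bochner_Integration.integrable_diff[OF shift_i shift_i]]]
      integral_mult_right_zero integral_divide_zero Bochner_Integration.integral_diff[OF shift_i shift_i] ..
  also have "(\<integral>v. sin (t * v) * S (v + u) \<partial>lborel) - (\<integral>v. sin (t * v) * S (v + - u) \<partial>lborel)
      = (\<integral>x. sin (t * x + - (t * u)) * S x - sin (t * x + - (t * - u)) * S x \<partial>lborel)"
    unfolding shift by (rule Bochner_Integration.integral_diff[OF trig trig, symmetric])
  also have "\<dots> = (\<integral>x. (- 2 * sin (t * u)) * (cos (t * x) * S x) \<partial>lborel)"
    by (rule Bochner_Integration.integral_cong[OF refl]) (unfold sin_add, simp add: algebra_simps)
  also have "\<dots> = - 2 * sin (t * u) * Sh" unfolding Sh_def by (rule integral_mult_right_zero)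
  finally have "t * (\<integral>v. cos (t * v) * D v \<partial>lborel) = sin (t * u) * Sh" by simp
  hence "(\<integral>v. cos (t * v) * D v \<partial>lborel) = 4 * pi * sin (t * u) / sinh (pi * t)"
    using t unfolding Sh by (simp add: field_simps)
  moreover have "(\<integral>v. cos (t * v) * D v \<partial>lborel) = 2 * sinh u * (\<integral>v. cos (t * v) / (cosh u + cosh v) \<partial>lborel)"
    unfolding D_eq integral_mult_right_zero[symmetric] by (rule Bochner_Integration.integral_cong) simp_all
  ultimately have "(\<integral>v. cos (t * v) / (cosh u + cosh v) \<partial>lborel) * (2 * sinh u) = 4 * pi * sin (t * u) / sinh (pi * t)" by (simp add: mult_ac)
  hence "(\<integral>v. cos (t * v) / (cosh u + cosh v) \<partial>lborel) = 4 * pi * sin (t * u) / sinh (pi * t) / (2 * sinh u)"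
    by (intro eq_divide_imp) (use u t in simp_all)
  thus ?thesis by simp
qed

section \<open>Exponential decay of the Gamma function\<close>

text \<open>In the quotient of Gauss's products the powers of n cancel, and what remains are factors
  (a+k)/|a+k+iy|, each increasing in a. This replaces a by a larger integer, for which the modulus
  is explicit.\<close>

lemma norm_Gamma_quotient_mono:
  fixes a b y :: real
  assumes ab: "0 < a" "a \<le> b"
  shows "norm (Gamma (complex_of_real a + \<i> * y)) / Gamma a \<le> norm (Gamma (complex_of_real b + \<i> * y)) / Gamma b"
proof -
  have lim: "(\<lambda>n. norm (Gamma_series (complex_of_real a + \<i> * y) n) / Gamma_series a n) \<longlonglongrightarrow> norm (Gamma (complex_of_real a + \<i> * y)) / Gamma a"
    if "a > 0" for a
    using Gamma_real_pos[OF that] by (intro tendsto_intros Gamma_series_LIMSEQ) auto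
  have eq: "norm (Gamma_series (complex_of_real a + \<i> * y) n) / Gamma_series a n = (\<Prod>k\<le>n. (a + real k) / norm (complex_of_real a + \<i> * y + of_nat k))"
    if "a > 0" for a n
  proof -
    have p: "pochhammer a (Suc n) > 0" using that by (rule pochhammer_pos)
    have "norm (Gamma_series (complex_of_real a + \<i> * y) n) / Gamma_series a n = pochhammer a (Suc n) / norm (pochhammer (complex_of_real a + \<i> * y) (Suc n))"
      using p by (simp add: Gamma_series_def norm_mult norm_divide)
    also have "\<dots> = (\<Prod>k\<le>n. (a + real k) / norm (complex_of_real a + \<i> * y + of_nat k))"
      by (simp add: pochhammer_prod prod_norm[symmetric] prod_dividef atLeast0LessThan lessThan_Suc_atMost)
    finally show ?thesis .
  qed
  have "(\<Prod>k\<le>n. (a + real k) / norm (complex_of_real a + \<i> * y + of_nat k)) \<le> (\<Prod>k\<le>n. (b + real k) / norm (complex_of_real b + \<i> * y + of_nat k))" for n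
  proof (rule prod_mono, intro conjI)
    fix k :: nat
    have pos: "a + k > 0" "b + k > 0" using ab by simp_all
    have nrm: "norm (complex_of_real r + \<i> * y + of_nat k) = sqrt ((r + k)\<^sup>2 + y\<^sup>2)" for r
      by (simp add: cmod_def)
    show "0 \<le> (a + real k) / norm (complex_of_real a + \<i> * y + of_nat k)" using pos by simp
    have eq: "(r + k) / sqrt ((r + k)\<^sup>2 + y\<^sup>2) = 1 / sqrt (1 + (y / (r + k))\<^sup>2)" if "r + k > 0" for r :: real
    proof -
      have "(r + k)\<^sup>2 + y\<^sup>2 = (r + k)\<^sup>2 * (1 + (y / (r + k))\<^sup>2)" using that by (simp add: field_simps)
      thus ?thesis using that by (simp add: real_sqrt_mult)
    qed
    have "(y / (b + k))\<^sup>2 \<le> (y / (a + k))\<^sup>2"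
      unfolding power_divide using pos ab by (intro divide_left_mono power_mono mult_pos_pos) auto
    thus "(a + real k) / norm (complex_of_real a + \<i> * y + of_nat k) \<le> (b + real k) / norm (complex_of_real b + \<i> * y + of_nat k)"
      unfolding nrm eq[OF pos(1)] eq[OF pos(2)] by (intro divide_left_mono) (auto intro!: mult_pos_pos add_pos_nonneg)
  qed
  thus ?thesis
    by (intro LIMSEQ_le[OF lim lim]) (use ab in \<open>auto simp: eq\<close>)
qed

lemma power_exp_bounded:
  fixes e b :: real
  assumes "e > 0" "b \<ge> 0"
  shows "\<exists>K. \<forall>y\<ge>0. (b + y) ^ k * exp (- e * y) \<le> K"
\<comment> \<open>The witness comes from x^k/k! <= exp x at x = e (b + y), a single term of the
  exponential series.\<close>
proof (intro exI[of _ "fact k / e ^ k * exp (e * b)"] allI impI)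
  fix y :: real assume y: "y \<ge> 0"
  define x where "x = e * (b + y)"
  have x: "x \<ge> 0" using assms y by (simp add: x_def)
  have "(\<Sum>n\<in>{k}. x ^ n /\<^sub>R fact n) \<le> exp x"
    unfolding exp_def using x by (intro sum_le_suminf summable_exp_generic) auto
  hence "x ^ k \<le> fact k * exp x" by (simp add: field_simps)
  moreover have "x ^ k = e ^ k * (b + y) ^ k" unfolding x_def by (rule power_mult_distrib)
  moreover have "exp x = exp (e * b) * exp (e * y)" by (simp add: x_def distrib_left exp_add)
  ultimately have "(b + y) ^ k * e ^ k \<le> fact k * (exp (e * b) * exp (e * y))" by (simp add: mult_ac)
  hence "(b + y) ^ k \<le> fact k * (exp (e * b) * exp (e * y)) / e ^ k"
    using assms by (simp only: pos_le_divide_eq zero_less_power)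
  hence "(b + y) ^ k \<le> fact k / e ^ k * (exp (e * b) * exp (e * y))" by simp
  hence "(b + y) ^ k * exp (- e * y) \<le> (fact k / e ^ k * (exp (e * b) * exp (e * y))) * exp (- e * y)"
    by (intro mult_right_mono) auto
  also have "\<dots> = fact k / e ^ k * exp (e * b) * (exp (e * y) * exp (- e * y))" by (simp only: mult_ac)
  also have "exp (e * y) * exp (- e * y) = 1" by (simp flip: exp_add)
  finally show "(b + y) ^ k * exp (- e * y) \<le> fact k / e ^ k * exp (e * b)" by simp
qed

text \<open>For b = N + 1, Gamma(b + iy) is (1+iy)...(N+iy) Gamma(1+iy), so its squared modulus is
  at most a power of b + y times pi y/sinh(pi y). At y = m/2 this decays like exp(-pi m/2) up to a
  polynomial, and \<delta> < pi/2 leaves room for exp(\<delta> m).\<close>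

lemma Gamma_exp_bounded:
  fixes a \<delta> :: real
  assumes a: "a > 0" and \<delta>: "\<delta> < pi / 2"
  obtains K where "K > 0" "\<And>m::nat. m \<ge> 1 \<Longrightarrow> (norm (Gamma (complex_of_real a + \<i> * of_nat m / 2)))\<^sup>2 * exp (\<delta> * real m) \<le> K"
proof -
  obtain N :: nat where N: "a \<le> real N" using real_arch_simple by blast
  define b where "b = real (Suc N)"
  have b: "a \<le> b" "b > 0" using N a by (simp_all add: b_def)
  define Q where "Q = Gamma a / Gamma b"
  have Q: "Q > 0" using a b by (simp add: Q_def Gamma_real_pos)
  \<comment> \<open>Since m = 2y, exp(-pi y) exp(\<delta> m) = exp(-e y). In the power 2N + 1 below,
    2N comes from the squared Pochhammer symbol and 1 from the factor y in pi y/sinh(pi y).\<close>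
  define e where "e = pi - 2 * \<delta>"
  have e: "e > 0" using \<delta> by (simp add: e_def)
  obtain K where K: "\<And>y. y \<ge> 0 \<Longrightarrow> (b + y) ^ (2 * N + 1) * exp (- e * y) \<le> K"
    using power_exp_bounded[OF e, of b "2 * N + 1"] b by auto
  show ?thesis
  proof (rule that[of "Q\<^sup>2 * (4 * pi) * \<bar>K\<bar> + 1"])
    show "Q\<^sup>2 * (4 * pi) * \<bar>K\<bar> + 1 > 0" by (simp add: add_nonneg_pos)
    fix m :: nat assume m: "m \<ge> 1"
    define y where "y = real m / 2"
    have y: "y \<ge> 1/2" "y > 0" using m by (simp_all add: y_def)
    have nz: "1 + \<i> * complex_of_real y \<notin> \<int>\<^sub>\<le>\<^sub>0"
      using y by (auto elim!: nonpos_Ints_cases simp: complex_eq_iff)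
    have "norm (Gamma (complex_of_real a + \<i> * y)) / Gamma a \<le> norm (Gamma (complex_of_real b + \<i> * y)) / Gamma b"
      by (rule norm_Gamma_quotient_mono[OF a b(1)])
    hence 1: "norm (Gamma (complex_of_real a + \<i> * y)) \<le> Q * norm (Gamma (complex_of_real b + \<i> * y))"
      using Gamma_real_pos[OF a] by (simp add: Q_def field_simps)
    have "Gamma (complex_of_real b + \<i> * y) = pochhammer (1 + \<i> * y) N * Gamma (1 + \<i> * y)"
      using pochhammer_Gamma[OF nz, of N] nz by (simp add: b_def Gamma_eq_zero_iff add_ac)
    moreover have "norm (pochhammer (1 + \<i> * complex_of_real y) N) \<le> (b + y) ^ N"
    proof -
      have "norm (pochhammer (1 + \<i> * complex_of_real y) N) = (\<Prod>k<N. norm (1 + \<i> * complex_of_real y + of_nat k))"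
        by (simp add: pochhammer_prod prod_norm atLeast0LessThan)
      also have "\<dots> \<le> (\<Prod>k<N. b + y)"
      proof (rule prod_mono, intro conjI)
        fix k assume k: "k \<in> {..<N}"
        have "norm (1 + \<i> * complex_of_real y + of_nat k) \<le> norm (of_nat (Suc k) :: complex) + norm (\<i> * complex_of_real y)"
          using norm_triangle_ineq[of "of_nat (Suc k) :: complex" "\<i> * complex_of_real y"] by (simp add: add_ac)
        also have "\<dots> \<le> b + y" using k y unfolding norm_of_nat by (simp add: b_def norm_mult)
        finally show "norm (1 + \<i> * complex_of_real y + of_nat k) \<le> b + y" .
      qed simp
      finally show ?thesis by simp
    qed
    ultimately have "norm (Gamma (complex_of_real b + \<i> * y)) \<le> (b + y) ^ N * norm (Gamma (1 + \<i> * complex_of_real y))"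
      by (simp add: norm_mult mult_right_mono)
    hence "norm (Gamma (complex_of_real a + \<i> * y)) \<le> Q * ((b + y) ^ N * norm (Gamma (1 + \<i> * complex_of_real y)))"
      using 1 Q by (meson mult_left_mono order_trans less_imp_le)
    hence "(norm (Gamma (complex_of_real a + \<i> * y)))\<^sup>2 \<le> (Q * ((b + y) ^ N * norm (Gamma (1 + \<i> * complex_of_real y))))\<^sup>2"
      by (intro power_mono) auto
    also have "\<dots> = Q\<^sup>2 * ((b + y) ^ (2 * N) * (pi * y / sinh (pi * y)))"
      using Gamma_1_plus_imag[of y] y by (simp add: power_mult_distrib power_mult[symmetric] mult.commute[of _ 2])
    also have "\<dots> \<le> Q\<^sup>2 * ((b + y) ^ (2 * N) * (4 * pi * ((b + y) * exp (- pi * y))))"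
    proof (intro mult_left_mono)
      \<comment> \<open>This uses y >= 1/2 and gives sinh(pi y) >= exp(pi y)/4.\<close>
      have "exp (- pi * y) \<le> 1 / 2 * exp (pi * y)"
      proof -
        have "2 \<le> exp (1::real)" using exp_ge_add_one_self[of 1] by simp
        also have "\<dots> \<le> exp (2 * pi * y)"
          using y pi_gt3 mult_mono[of 6 "2 * pi" "1/2" y] by simp
        finally have "2 * exp (- pi * y) \<le> exp (2 * pi * y) * exp (- pi * y)" by (intro mult_right_mono) auto
        also have "\<dots> = exp (pi * y)" by (simp flip: exp_add)
        finally show ?thesis by simp
      qed
      hence "sinh (pi * y) \<ge> exp (pi * y) / 4" unfolding sinh_field_def by simp
      hence "pi * y / sinh (pi * y) \<le> pi * y / (exp (pi * y) / 4)"
        using y by (intro divide_left_mono mult_pos_pos) auto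
      also have "\<dots> = 4 * pi * (y * exp (- pi * y))" by (simp add: exp_minus field_simps)
      also have "\<dots> \<le> 4 * pi * ((b + y) * exp (- pi * y))" using b y by (intro mult_left_mono mult_right_mono) auto
      finally show "pi * y / sinh (pi * y) \<le> 4 * pi * ((b + y) * exp (- pi * y))" .
    qed (use b y in auto)
    finally have "(norm (Gamma (complex_of_real a + \<i> * y)))\<^sup>2 * exp (\<delta> * real m)
       \<le> Q\<^sup>2 * ((b + y) ^ (2 * N) * (4 * pi * ((b + y) * exp (- pi * y)))) * exp (\<delta> * real m)"
      by (intro mult_right_mono) auto
    also have "\<dots> = Q\<^sup>2 * (4 * pi) * ((b + y) ^ (2 * N + 1) * (exp (- pi * y) * exp (\<delta> * real m)))"
      by (simp add: mult_ac)
    also have "exp (- pi * y) * exp (\<delta> * real m) = exp (- e * y)"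
      unfolding exp_add[symmetric] by (rule arg_cong[where f = exp]) (simp add: e_def y_def field_simps)
    also have "Q\<^sup>2 * (4 * pi) * ((b + y) ^ (2 * N + 1) * exp (- e * y)) \<le> Q\<^sup>2 * (4 * pi) * \<bar>K\<bar>"
      using K[of y] y by (intro mult_left_mono) auto
    also have "complex_of_real a + \<i> * y = complex_of_real a + \<i> * of_nat m / 2" by (simp add: y_def)
    finally show "(norm (Gamma (complex_of_real a + \<i> * of_nat m / 2)))\<^sup>2 * exp (\<delta> * real m) \<le> Q\<^sup>2 * (4 * pi) * \<bar>K\<bar> + 1"
      by simp
  qed
qed

text \<open>The point is that z d/dz + 2B integrates explicitly: for real B and x > 0, x^(2B-1)
  times the left side is the derivative of x^(2B) Y.\<close>

lemma Y2F1_contiguous: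
  assumes C: "C \<notin> \<int>\<^sub>\<le>\<^sub>0" and z: "z = complex_of_real x"
  shows "z * Y2F1' A B C z + 2 * B * Y2F1 A B C z = 2 * B * Y2F1 A (B + 1) C z"
proof -
  define q w where "q = 1 + z\<^sup>2" "w = z\<^sup>2 / q"
  have q: "q \<noteq> 0" using q_nz[OF z] by (simp add: q_w_def)
  have w: "norm w < 1" using w_norm[OF z] by (simp add: q_w_def)
  have w1: "z\<^sup>2 / q\<^sup>2 = w * (1 - w)" using q by (simp add: q_w_def field_simps power2_eq_square)
  define S0 S1 where "S0 = S2F1 A (C - B) C 0 w" "S1 = S2F1 A (C - B) C 1 w"
  define E where "E = exp (- A * Ln q)"
  have "z * Y2F1' A B C z = E * 2 * (- A * S0 * (z\<^sup>2 / q) + S1 * (z\<^sup>2 / q\<^sup>2))"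
    unfolding Y2F1'_def Let_def q_w_def(1)[symmetric] S0_S1_def q_w_def(2) E_def
    by (simp add: algebra_simps power2_eq_square)
  also have "\<dots> = E * 2 * (- A * S0 * w + S1 * (w * (1 - w)))" unfolding w1 by (simp add: q_w_def)
  finally have y1: "z * Y2F1' A B C z = E * 2 * (- A * S0 * w + S1 * (w * (1 - w)))" .
  have y0: "Y2F1 A B C z = E * S0" by (simp add: Y2F1_def q_w_def S0_S1_def E_def)
  have cB: "B * S2F1 A (C - B - 1) C 0 w = (B - A * w) * S0 + w * (1 - w) * S1"
    using S2F1_contiguous[OF C w, of "C - B" A] by (simp add: S0_S1_def)
  have "2 * B * Y2F1 A (B + 1) C z = E * 2 * (B * S2F1 A (C - B - 1) C 0 w)"
    by (simp add: Y2F1_def q_w_def E_def diff_diff_eq)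
  thus ?thesis unfolding y1 y0 cB by (simp add: algebra_simps)
qed

text \<open>With w = x^2/(1+x^2) the function is w^a (1-w)^(1/2) times a series whose excess A + B -
  C is 1/2. The limit w -> 1 is supplied by \<open>eval_2F1_at_1\<close>, and sqrt pi is
  Gamma(1/2).\<close>

lemma Y2F1_at_top:
  fixes a c :: real
  assumes a: "a > 0" and ca: "c > a"
  shows "((\<lambda>x::real. x powr (2*a) * Re (Y2F1 (of_real (a + 1/2)) a c (of_real x))) \<longlongrightarrow>
      Gamma c * sqrt pi / (Gamma (a + 1/2) * Gamma (c - a))) at_top"
proof -
  have c: "c > 0" using a ca by simp
  define L where "L = Gamma c * sqrt pi / (Gamma (a + 1/2) * Gamma (c - a))"
  have L: "rGamma (complex_of_real (a + 1/2)) * rGamma (complex_of_real c - of_real a) * Gamma (complex_of_real c) * Gamma (complex_of_real (1/2)) = of_real L"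
    unfolding of_real_diff[symmetric] Gamma_complex_of_real rGamma_complex_of_real of_real_mult[symmetric] L_def
    by (simp add: Gamma_one_half_real rGamma_inverse_Gamma field_simps)
  have C: "complex_of_real c \<notin> \<int>\<^sub>\<le>\<^sub>0" using of_real_notin_nonpos_Ints[OF c] .
  define S where "S = (\<lambda>w::real. eval_fps (fps_2F1 (of_real (a + 1/2)) (of_real c - of_real a) c) (of_real w))"
  define w where "w = (\<lambda>x::real. x\<^sup>2 / (1 + x\<^sup>2))"
  have w1: "1 - w x = 1 / (1 + x\<^sup>2)" "w x < 1" "w x \<ge> 0" for x
    using one_plus_square_pos[of x] by (simp_all add: w_def field_simps)
  note top = filterlim_one_plus_square
  have "((\<lambda>x. 1 - inverse (1 + x\<^sup>2)) \<longlongrightarrow> 1 - (0::real)) at_top"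
    by (intro tendsto_intros tendsto_inverse_0_at_top top)
  moreover have "1 - inverse (1 + x\<^sup>2) = w x" for x using w1(1)[of x] by (simp add: inverse_eq_divide)
  ultimately have wlim: "(w \<longlongrightarrow> 1) at_top" by simp
  hence wleft: "filterlim w (at_left 1) at_top"
    by (rule tendsto_imp_filterlim_at_left) (use w1 in auto)
  have "((\<lambda>w::real. of_real ((1 - w) powr (1/2)) * S w) \<longlongrightarrow> of_real L) (at_left 1)"
    unfolding S_def L[symmetric] by (rule eval_2F1_at_1[OF C]) simp_all
  from filterlim_compose[OF this wleft]
  have l: "((\<lambda>x. of_real ((1 - w x) powr (1/2)) * S (w x)) \<longlongrightarrow> of_real L) at_top" .
  have "((\<lambda>x. w x powr a * Re (of_real ((1 - w x) powr (1/2)) * S (w x))) \<longlongrightarrow>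
      1 powr a * Re (complex_of_real L)) at_top"
    by (intro tendsto_mult tendsto_powr wlim tendsto_const tendsto_Re l) auto
  moreover have "eventually (\<lambda>x. w x powr a * Re (of_real ((1 - w x) powr (1/2)) * S (w x)) = x powr (2*a) * Re (Y2F1 (of_real (a + 1/2)) a c (of_real x))) at_top"
    using eventually_gt_at_top[of 0]
  proof eventually_elim
    case (elim x)
    define q where "q = 1 + x\<^sup>2"
    have q: "q > 0" using one_plus_square_pos[of x] by (simp add: q_def)
    have "Y2F1 (of_real (a + 1/2)) a c (of_real x) = of_real q powr (- of_real (a + 1/2)) * S (w x)"
      unfolding Y2F1_of_real[OF refl] hyp2F1_series_eq_eval S_def w_def q_def ..
    also have "(of_real q :: complex) powr (- of_real (a + 1/2)) = of_real (q powr (- (a + 1/2)))"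
      using powr_of_real[of q "- (a + 1/2)"] q by simp
    finally have Y: "Re (Y2F1 (of_real (a + 1/2)) a c (of_real x)) = q powr (- (a + 1/2)) * Re (S (w x))" by simp
    have "w x powr a = x powr (2*a) * q powr (- a)"
    proof -
      have "w x = x powr 2 / q" using elim by (simp add: w_def q_def)
      hence "w x powr a = (x powr 2) powr a / q powr a" using elim q by (simp only: powr_divide)
      thus ?thesis by (simp only: powr_powr powr_minus_divide) simp
    qed
    moreover have "(1 - w x) powr (1/2) = q powr (- (1/2))"
      unfolding w1(1) q_def[symmetric] using q by (simp add: powr_divide powr_minus_divide)
    moreover have "q powr (- a) * q powr (- (1/2)) = q powr (- (a + 1/2))" by (simp flip: powr_add)
    ultimately show ?case unfolding Y by (simp add: mult.assoc)
  qed
  ultimately show ?thesis by (simp add: filterlim_cong L_def)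
qed

section \<open>Evaluation of the pairing\<close>

lemma Gamma_duplication_real:
  fixes a :: real
  assumes "a > 0"
  shows "Gamma a * Gamma (a + 1/2) = 2 powr (1 - 2 * a) * sqrt pi * Gamma (2 * a)"
proof -
  have nz: "complex_of_real a \<notin> \<int>\<^sub>\<le>\<^sub>0" "complex_of_real a + 1/2 \<notin> \<int>\<^sub>\<le>\<^sub>0"
    using of_real_notin_nonpos_Ints[OF assms] of_real_notin_nonpos_Ints[of "a + 1/2"] assms by simp_all
  have e: "exp ((1 - 2 * complex_of_real a) * of_real (ln 2)) = of_real (2 powr (1 - 2 * a))"
    by (simp add: powr_def exp_of_real[symmetric])
  have h: "complex_of_real a + 1/2 = of_real (a + 1/2)" "2 * complex_of_real a = of_real (2 * a)" by simp_all
  have "complex_of_real (Gamma a * Gamma (a + 1/2)) = of_real (2 powr (1 - 2 * a) * sqrt pi * Gamma (2 * a))"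
    using Gamma_legendre_duplication[OF nz] unfolding e h(1) unfolding h(2) Gamma_complex_of_real
    by (simp only: of_real_mult)
  thus ?thesis by (simp only: of_real_eq_iff)
qed

lemma Y2F1_real:
  fixes A B C x :: real
  assumes C: "C > 0"
  shows "Y2F1 A B C (of_real x) = of_real (Re (Y2F1 A B C (of_real x)))"
proof -
  define q w where "q = 1 + x\<^sup>2" "w = x\<^sup>2 / q"
  have q: "q > 0" using one_plus_square_pos[of x] by (simp add: q_w_def)
  have w: "0 \<le> w" "w < 1" using q by (simp_all add: q_w_def)
  define r where "r = (\<lambda>k. pochhammer A k * pochhammer (C - B) k / (pochhammer C k * fact k) * w ^ k)"
  have r: "fps_nth (fps_2F1 A (of_real C - of_real B) C) k * of_real w ^ k = of_real (r k)" for k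
    unfolding of_real_diff[symmetric] fps_2F1_nth pochhammer_of_real r_def by simp
  have "ereal (norm (complex_of_real w)) < fps_conv_radius (fps_2F1 A (of_real C - of_real B) C)"
    using w by (intro less_le_trans[OF _ fps_conv_radius_2F1[OF of_real_notin_nonpos_Ints[OF C]]]) simp
  hence "summable (\<lambda>k. fps_nth (fps_2F1 A (of_real C - of_real B) C) k * of_real w ^ k)" by (rule summable_fps)
  hence "summable r" unfolding r summable_complex_of_real .
  hence "eval_fps (fps_2F1 A (of_real C - of_real B) C) (of_real w) = of_real (suminf r)"
    unfolding eval_fps_def r by (rule suminf_of_real[symmetric])
  moreover have "(of_real q :: complex) powr (- of_real A) = of_real (q powr (- A))"
    using powr_of_real[of q "- A"] q by simp
  ultimately have "Y2F1 A B C (of_real x) = of_real (q powr (- A) * suminf r)"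
    unfolding Y2F1_of_real[OF refl] hyp2F1_series_eq_eval q_w_def by simp
  thus ?thesis by simp
qed

text \<open>With a product majorant the inner integrals of the norm are at most g x times the
  integral of h, so Tonelli's criterion applies. Both exchanges of integrals below rest on
  this.\<close>

lemma set_integrable_product:
  fixes f :: "real \<Rightarrow> real \<Rightarrow> 'b::{banach, second_countable_topology}"
  assumes meas: "case_prod f \<in> borel_measurable (lborel \<Otimes>\<^sub>M lborel)"
    and le: "\<And>x v. norm (f x v) \<le> g x * h v"
    and g: "integrable lborel (g :: real \<Rightarrow> real)" and h: "integrable lborel (h :: real \<Rightarrow> real)"
  shows "integrable (lborel \<Otimes>\<^sub>M lborel) (case_prod f)"
proof (rule lborel_pair.Fubini_integrable[OF meas])
  have hx: "integrable lborel (\<lambda>v. norm (f x v))" for x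
  proof (rule Bochner_Integration.integrable_bound)
    show "integrable lborel (\<lambda>v. g x * h v)" by (intro integrable_mult_right h)
    have "(\<lambda>v. case_prod f (x, v)) \<in> borel_measurable lborel"
      by (rule measurable_compose[OF _ meas]) simp
    thus "(\<lambda>v. norm (f x v)) \<in> borel_measurable lborel" by simp
    show "AE v in lborel. norm (norm (f x v)) \<le> norm (g x * h v)"
      using le by (auto intro!: AE_I2 order.trans[OF _ abs_ge_self])
  qed
  show "AE x in lborel. integrable lborel (\<lambda>v. case_prod f (x, v))"
  proof (rule AE_I2)
    fix x
    have "(\<lambda>v. case_prod f (x, v)) \<in> borel_measurable lborel"
      by (rule measurable_compose[OF _ meas]) simp
    thus "integrable lborel (\<lambda>v. case_prod f (x, v))"
      using hx[of x] integrable_norm_iff[of "\<lambda>v. case_prod f (x, v)" lborel] by simp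
  qed
  show "integrable lborel (\<lambda>x. \<integral>v. norm (case_prod f (x, v)) \<partial>lborel)"
  proof (rule Bochner_Integration.integrable_bound)
    show "integrable lborel (\<lambda>x. g x * (\<integral>v. h v \<partial>lborel))" by (intro integrable_mult_left g)
    show "(\<lambda>x. \<integral>v. norm (case_prod f (x, v)) \<partial>lborel) \<in> borel_measurable lborel"
      using meas by (intro lborel.borel_measurable_lebesgue_integral) simp
    show "AE x in lborel. norm (\<integral>v. norm (case_prod f (x, v)) \<partial>lborel) \<le> norm (g x * (\<integral>v. h v \<partial>lborel))"
    proof (rule AE_I2)
      fix x
      have "(\<integral>v. norm (f x v) \<partial>lborel) \<le> (\<integral>v. g x * h v \<partial>lborel)"
        by (intro integral_mono hx integrable_mult_right h le)
      also have "\<dots> = g x * (\<integral>v. h v \<partial>lborel)" by (rule integral_mult_right_zero)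
      finally show "norm (\<integral>v. norm (case_prod f (x, v)) \<partial>lborel) \<le> norm (g x * (\<integral>v. h v \<partial>lborel))"
        by (simp add: integral_nonneg_AE)
    qed
  qed
qed

locale jacobi_kernels =
  fixes a c :: real
  assumes a: "a > 0" and c_half: "c > 1/2" and ac: "a < c"
begin

definition p :: real where "p = c - a"
definition g :: "real \<Rightarrow> real" where "g x = Re (Y2F1 (of_real (p + 1/2)) (of_real (p + 1)) c (of_real x))"
definition g' :: "real \<Rightarrow> real" where "g' x = Re (Y2F1' (of_real (p + 1/2)) (of_real (p + 1)) c (of_real x))"
definition g'' :: "real \<Rightarrow> real" where "g'' x = Re (Y2F1'' (of_real (p + 1/2)) (of_real (p + 1)) c (of_real x))"
text \<open>The larger parameter of \<open>h\<close> comes first: in this Pfaff form the series behaves like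
  \<open>(1 - w)\<^bsup>-1/2\<^esup>\<close> at \<open>w = 1\<close>, so that the limit of \<open>x\<^bsup>2a\<^esup> h(x)\<close> is accessible without Gauss's summation theorem.\<close>
definition h :: "real \<Rightarrow> real" where "h x = Re (Y2F1 (of_real (a + 1/2)) (of_real a) c (of_real x))"
definition h' :: "real \<Rightarrow> real" where "h' x = Re (Y2F1' (of_real (a + 1/2)) (of_real a) c (of_real x))"
definition h'' :: "real \<Rightarrow> real" where "h'' x = Re (Y2F1'' (of_real (a + 1/2)) (of_real a) c (of_real x))"

lemma p: "p > 0" using ac by (simp add: p_def)

sublocale radial_pair a p c g g' g'' h h' h''
proof -
  interpret G: radial_solution c "2 * p + 1" g g' g''
    unfolding g_def [abs_def] g'_def [abs_def] g''_def [abs_def]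
    by (rule radial_solution_2F1) (use c_half p in \<open>auto simp: add_divide_distrib\<close>)
  interpret H: radial_solution c "2 * a" h h' h''
    unfolding h_def [abs_def] h'_def [abs_def] h''_def [abs_def]
    by (rule radial_solution_2F1) (use c_half a in \<open>auto simp: add_divide_distrib\<close>)
  show "radial_pair a p c g g' g'' h h' h''"
    by unfold_locales (use c_half p in \<open>auto simp: p_def\<close>)
qed

text \<open>The contiguous relation makes 2p x^(2p-1) g(x) the derivative of x^(2p) Y(x), where Y
  has p in place of p + 1. The primitive vanishes at 0, and its limit at infinity is the
  value.\<close>

lemma mellin_g: "(LINT x:{0<..}|lborel. x powr (2*p - 1) * g x) = Gamma c * sqrt pi / (Gamma (p + 1/2) * Gamma a) / (2 * p)"
proof -
  define Y Y' where "Y = (\<lambda>x. Re (Y2F1 (of_real (p + 1/2)) (of_real p) c (of_real x)))"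
     "Y' = (\<lambda>x. Re (Y2F1' (of_real (p + 1/2)) (of_real p) c (of_real x)))"
  interpret Y: radial_solution c "2 * p" Y Y' "\<lambda>x. Re (Y2F1'' (of_real (p + 1/2)) (of_real p) c (of_real x))"
    unfolding Y_Y'_def by (rule radial_solution_2F1) (use c_half p in \<open>auto simp: add_divide_distrib\<close>)
  have C: "complex_of_real c \<notin> \<int>\<^sub>\<le>\<^sub>0" using of_real_notin_nonpos_Ints[of c] c_half by simp
  have cont: "x * Y' x + 2 * p * Y x = 2 * p * g x" for x
    using arg_cong[OF Y2F1_contiguous[OF C refl, of x "of_real (p + 1/2)" "of_real p"], of Re]
    by (simp add: Y_Y'_def g_def)
  have D: "((\<lambda>x. x powr (2*p) * Y x) has_real_derivative 2 * p * (x powr (2*p - 1) * g x)) (at x)" if x: "x > 0" for x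
  proof (rule DERIV_cong[OF DERIV_mult[OF has_real_derivative_powr[OF x] Y.deriv]])
    have "x powr (2*p) = x powr (2*p - 1) * x" using x by (simp add: powr_diff)
    hence "2 * p * x powr (2 * p - 1) * Y x + Y' x * x powr (2 * p) = x powr (2*p - 1) * (x * Y' x + 2 * p * Y x)"
      by (simp add: algebra_simps)
    thus "2 * p * x powr (2 * p - 1) * Y x + Y' x * x powr (2 * p) = 2 * p * (x powr (2*p - 1) * g x)"
      unfolding cont by simp
  qed
  obtain K where K: "K > 0" "\<And>x. \<bar>g x\<bar> \<le> K * (1 + x\<^sup>2) powr (- (2 * p + 1)/2)" by (rule G.bounds) blast
  have [measurable]: "g \<in> borel_measurable borel" using G.continuous by (auto intro: continuous_borel)
  have int: "set_integrable lborel {0<..} (\<lambda>x. x powr (2*p - 1) * g x)"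
  proof (rule set_integrable_bound)
    show "set_integrable lborel {0<..} (\<lambda>x. K * (x powr (2*p - 1) * (1 + x\<^sup>2) powr (- (p + 1/2))))"
      using p by (intro set_integrable_mult_right set_integrable_weight) auto
    show "set_borel_measurable lborel {0<..} (\<lambda>x. x powr (2*p - 1) * g x)"
      unfolding set_borel_measurable_def by measurable
    have e: "- (2 * p + 1)/2 = - (p + 1/2)" by (simp add: field_simps)
    have "\<bar>x powr (2*p - 1) * g x\<bar> \<le> K * (x powr (2*p - 1) * (1 + x\<^sup>2) powr (- (p + 1/2)))" for x
      using mult_left_mono[OF K(2)[of x, unfolded e], of "x powr (2*p - 1)"] by (simp add: abs_mult mult_ac)
    thus "AE x in lborel. x \<in> {0<..} \<longrightarrow> norm (x powr (2*p - 1) * g x) \<le> norm (K * (x powr (2*p - 1) * (1 + x\<^sup>2) powr (- (p + 1/2))))"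
      by (auto intro!: AE_I2 order.trans[OF _ abs_ge_self])
  qed
  have lim: "((\<lambda>x. x powr (2*p) * Y x) \<longlongrightarrow> Gamma c * sqrt pi / (Gamma (p + 1/2) * Gamma (c - p))) at_top"
    unfolding Y_Y'_def by (rule Y2F1_at_top) (use p a in \<open>auto simp: p_def\<close>)
  have lim0: "((\<lambda>x. x powr (2*p) * Y x) \<longlongrightarrow> 0) (at_right 0)"
    using tendsto_mult[OF powr_tendsto_at_right_0 isCont_at_right[OF Y.continuous(1)], of "2*p"] p by simp
  have "(LINT x:{0<..}|lborel. 2 * p * (x powr (2*p - 1) * g x)) = Gamma c * sqrt pi / (Gamma (p + 1/2) * Gamma (c - p)) - 0"
  proof (rule FTC_Ioi[OF D _ _ lim0 lim])
    show "isCont (\<lambda>x. 2 * p * (x powr (2*p - 1) * g x)) x" if "x > 0" for x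
      using that by (intro continuous_intros G.continuous) auto
    show "set_integrable lborel {0<..} (\<lambda>x. 2 * p * (x powr (2*p - 1) * g x))"
      by (intro set_integrable_mult_right int)
  qed
  hence "2 * p * (LINT x:{0<..}|lborel. x powr (2*p - 1) * g x) = Gamma c * sqrt pi / (Gamma (p + 1/2) * Gamma a)"
    by (simp add: p_def)
  thus ?thesis by (intro eq_divide_imp[where c = "2 * p"]) (use p in \<open>simp_all add: mult_ac\<close>)
qed

text \<open>The duplication formula at a and at p merges four Gamma factors into Gamma(2a)
  Gamma(2p). The factor 2p from \<open>mellin_g\<close> raises Gamma(2p) to Gamma(2p + 1), and the
  powers of 2 combine because a + p = c.\<close>

lemma J_1: "2 * J G.ker 1 = (Gamma c)\<^sup>2 * 4 powr (c - 1) / (Gamma (2 * a) * Gamma (2 * p + 1))"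
proof -
  have "((\<lambda>x. x powr (2*a) * h x) \<longlongrightarrow> Gamma c * sqrt pi / (Gamma (a + 1/2) * Gamma (c - a))) at_top"
    unfolding h_def by (rule Y2F1_at_top[OF a ac])
  hence "2 * J G.ker 1 = Gamma c * sqrt pi / (Gamma (a + 1/2) * Gamma p) * (Gamma c * sqrt pi / (Gamma (p + 1/2) * Gamma a) / (2 * p))"
    unfolding mellin_g[symmetric] by (intro J_1_limit) (simp add: p_def)
  also have "\<dots> = (Gamma c)\<^sup>2 * pi / ((Gamma a * Gamma (a + 1/2)) * (Gamma p * Gamma (p + 1/2)) * (2 * p))"
    by (simp add: power2_eq_square mult_ac)
  also have "\<dots> = (Gamma c)\<^sup>2 / (2 powr (1 - 2 * a) * 2 powr (1 - 2 * p) * Gamma (2 * a) * (2 * p * Gamma (2 * p)))"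
  proof -
    have sp: "sqrt pi * (sqrt pi * z) = pi * z" for z by (simp flip: mult.assoc)
    show ?thesis
      unfolding Gamma_duplication_real[OF a] Gamma_duplication_real[OF p] by (simp add: mult_ac sp)
  qed
  also have "2 * p * Gamma (2 * p) = Gamma (2 * p + 1)"
  proof -
    have "2 * p \<notin> \<int>\<^sub>\<le>\<^sub>0"
    proof
      assume "2 * p \<in> \<int>\<^sub>\<le>\<^sub>0"
      then obtain k where "2 * p = of_int k" "k \<le> 0" by (rule nonpos_Ints_cases)
      thus False using p by linarith
    qed
    thus ?thesis by (simp add: Gamma_plus1)
  qed
  also have "2 powr (1 - 2 * a) * 2 powr (1 - 2 * p) = 4 powr (- (c - 1))"
  proof -
    have "4 powr (- (c - 1)) = (2 powr 2) powr (- (c - 1))" by simp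
    also have "\<dots> = 2 powr (1 - 2 * a + (1 - 2 * p))"
      unfolding powr_powr by (rule arg_cong[where f = "(powr) 2"]) (simp add: p_def)
    finally show ?thesis by (simp only: powr_add)
  qed
  finally show ?thesis by (simp only: powr_minus) (simp add: field_simps)
qed

lemma h_0: "h 0 = 1"
  by (simp add: h_def Y2F1_0)

lemma cosT_0: "H.cosT t H.ker 0 = 4 powr a / 2 * (norm (Gamma (complex_of_real a + \<i> * of_real t / 2)))\<^sup>2 / Gamma (2 * a)"
proof -
  have "H.ker (cosh v) 0 = cosh v powr (- (2 * a))" for v by (simp add: H.ker_def h_0)
  thus ?thesis using cosh_integral_Gamma[OF a, of t] by (simp add: H.cosT_def)
qed

text \<open>For fixed v the integral over x is \<open>J_scaled\<close>, and the remaining integral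
  over v is \<open>fourier_inverse_cosh_sum\<close>. The exchange requires a majorant that is a
  product in x and v.\<close>

lemma pairing_cosT:
  assumes t: "t > 0" and u: "u \<noteq> 0"
  shows "(LINT x:{0<..}|lborel. x powr (2*c - 1) * (G.ker (cosh u) x * H.cosT t H.ker x))
     = 2 * J G.ker 1 * (2 * pi * sin (t * u) / (sinh u * sinh (pi * t)))"
proof -
  \<comment> \<open>Some decay in x is traded for decay in v: cosh^2 v + x^2 is at least cosh^2 v
    and at least 1 + x^2, and its power -a is split into -\<epsilon> and -(a-\<epsilon>). \<epsilon>
    < a keeps both negative, and \<epsilon> < 1/2 keeps c + 1/2 - \<epsilon> above c.\<close>
  define \<epsilon> where "\<epsilon> = min (a / 2) (1 / 8)"
  have \<epsilon>: "\<epsilon> > 0" "\<epsilon> < a" "\<epsilon> < 1/2" using a by (auto simp: \<epsilon>_def)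
  obtain M where M: "M > 0" "\<And>x. \<bar>G.ker (cosh u) x\<bar> \<le> M * (1 + x\<^sup>2) powr (- (2 * p + 1)/2)"
    by (rule G.ker_local_bound[of "cosh u / 2" "2 * cosh u"]) auto
  obtain K where K: "K > 0" "\<And>x. \<bar>h x\<bar> \<le> K * (1 + x\<^sup>2) powr (- (2 * a)/2)" by (rule H.bounds) blast
  have kH: "\<bar>H.ker (cosh v) x\<bar> \<le> K * (cosh v powr (- (2 * \<epsilon>)) * (1 + x\<^sup>2) powr (- (a - \<epsilon>)))" for v x
  proof -
    have cv: "cosh v > 0" "cosh v \<ge> 1" using cosh_real_ge_1[of v] by simp_all
    define Z where "Z = (cosh v)\<^sup>2 + x\<^sup>2"
    have Z: "(cosh v)\<^sup>2 \<le> Z" "1 + x\<^sup>2 \<le> Z" "Z > 0" using cv by (simp_all add: Z_def add_pos_nonneg)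
    have "1 + (x / cosh v)\<^sup>2 = Z / (cosh v)\<^sup>2" using cv by (simp add: Z_def field_simps)
    hence "(1 + (x / cosh v)\<^sup>2) powr (- a) = Z powr (- a) / ((cosh v)\<^sup>2) powr (- a)"
      using Z cv by (simp add: powr_divide)
    also have "((cosh v)\<^sup>2) powr (- a) = cosh v powr (- (2 * a))"
      using powr_powr[of "cosh v" 2 "- a"] cv by simp
    finally have e: "cosh v powr (- (2 * a)) * (1 + (x / cosh v)\<^sup>2) powr (- a) = Z powr (- a)" using cv by simp
    have "\<bar>H.ker (cosh v) x\<bar> = cosh v powr (- (2 * a)) * \<bar>h (x / cosh v)\<bar>" by (simp add: H.ker_def abs_mult)
    also have "\<dots> \<le> cosh v powr (- (2 * a)) * (K * (1 + (x / cosh v)\<^sup>2) powr (- (2 * a)/2))"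
      by (intro mult_left_mono K) auto
    also have "\<dots> = K * (cosh v powr (- (2 * a)) * (1 + (x / cosh v)\<^sup>2) powr (- a))" by simp
    also have "\<dots> = K * (Z powr (- \<epsilon>) * Z powr (- (a - \<epsilon>)))" unfolding e by (simp flip: powr_add)
    also have "\<dots> \<le> K * (((cosh v)\<^sup>2) powr (- \<epsilon>) * (1 + x\<^sup>2) powr (- (a - \<epsilon>)))"
      using K(1) Z \<epsilon> cv one_plus_square_pos[of x] by (intro mult_left_mono mult_mono powr_mono2') auto
    also have "((cosh v)\<^sup>2) powr (- \<epsilon>) = cosh v powr (- (2 * \<epsilon>))"
      using powr_powr[of "cosh v" 2 "- \<epsilon>"] cv by simp
    finally show ?thesis .
  qed
  define f where "f = (\<lambda>x v. indicator {0<..} x * (x powr (2*c - 1) * (G.ker (cosh u) x * (cos (t * v) * H.ker (cosh v) x))))"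
  have [measurable]: "g \<in> borel_measurable borel" "h \<in> borel_measurable borel" "(cosh :: real \<Rightarrow> real) \<in> borel_measurable borel"
    using G.continuous H.continuous by (auto intro!: continuous_borel continuous_intros)
  have int: "integrable (lborel \<Otimes>\<^sub>M lborel) (case_prod f)"
  proof (rule set_integrable_product)
    show "case_prod f \<in> borel_measurable (lborel \<Otimes>\<^sub>M lborel)"
      unfolding f_def G.ker_def H.ker_def by measurable
    have "set_integrable lborel {0<..} (\<lambda>x. M * K * (x powr (2*c - 1) * (1 + x\<^sup>2) powr (- (c + 1/2 - \<epsilon>))))"
      using \<epsilon> c_half by (intro set_integrable_mult_right set_integrable_weight) auto
    thus "integrable lborel (\<lambda>x. indicator {0<..} x * (M * K * (x powr (2*c - 1) * (1 + x\<^sup>2) powr (- (c + 1/2 - \<epsilon>)))))"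
      by (simp add: set_integrable_def)
    show "integrable lborel (\<lambda>v. cosh v powr (- (2 * \<epsilon>)))" using \<epsilon> by (intro integrable_cosh_powr) simp
    fix x v :: real
    have "\<bar>x powr (2*c - 1) * (G.ker (cosh u) x * (cos (t * v) * H.ker (cosh v) x))\<bar>
       \<le> x powr (2*c - 1) * ((M * (1 + x\<^sup>2) powr (- (2 * p + 1)/2)) * (1 * (K * (cosh v powr (- (2 * \<epsilon>)) * (1 + x\<^sup>2) powr (- (a - \<epsilon>))))))"
      unfolding abs_mult using M(1) by (intro mult_mono M kH abs_cos_le_one) auto
    also have "\<dots> = M * K * (x powr (2*c - 1) * ((1 + x\<^sup>2) powr (- (2 * p + 1)/2) * (1 + x\<^sup>2) powr (- (a - \<epsilon>)))) * cosh v powr (- (2 * \<epsilon>))"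
      by simp
    also have "(1 + x\<^sup>2) powr (- (2 * p + 1)/2) * (1 + x\<^sup>2) powr (- (a - \<epsilon>)) = (1 + x\<^sup>2) powr (- (c + 1/2 - \<epsilon>))"
      unfolding powr_add[symmetric] by (rule arg_cong[where f = "(powr) (1 + x\<^sup>2)"]) (simp add: p_def field_simps)
    finally show "norm (f x v) \<le> indicator {0<..} x * (M * K * (x powr (2*c - 1) * (1 + x\<^sup>2) powr (- (c + 1/2 - \<epsilon>)))) * cosh v powr (- (2 * \<epsilon>))"
      by (simp add: f_def indicator_def)
  qed
  have inner: "(\<integral>x. f x v \<partial>lborel) = 2 * J G.ker 1 * (cos (t * v) / (cosh u + cosh v))" for v
  proof -
    have "(\<integral>x. f x v \<partial>lborel) = (\<integral>x. cos (t * v) * (indicator {0<..} x *\<^sub>R (x powr (2*c - 1) * (G.ker (cosh u) x * H.ker (cosh v) x))) \<partial>lborel)"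
      by (rule Bochner_Integration.integral_cong) (simp_all add: f_def mult_ac)
    also have "\<dots> = cos (t * v) * (LINT x:{0<..}|lborel. x powr (2*c - 1) * (G.ker (cosh u) x * H.ker (cosh v) x))"
      unfolding set_lebesgue_integral_def by (rule integral_mult_right_zero)
    also have "\<dots> = cos (t * v) * (2 * J G.ker 1 / (cosh u + cosh v))"
      by (subst J_scaled) simp_all
    finally show ?thesis by simp
  qed
  have "(LINT x:{0<..}|lborel. x powr (2*c - 1) * (G.ker (cosh u) x * H.cosT t H.ker x)) = (\<integral>x. \<integral>v. f x v \<partial>lborel \<partial>lborel)"
    unfolding set_lebesgue_integral_def H.cosT_def f_def integral_mult_right_zero by simp
  also have "\<dots> = (\<integral>v. \<integral>x. f x v \<partial>lborel \<partial>lborel)"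
    by (rule lborel_pair.Fubini_integral[OF int, symmetric])
  also have "\<dots> = 2 * J G.ker 1 * (\<integral>v. cos (t * v) / (cosh u + cosh v) \<partial>lborel)"
    unfolding inner by (rule integral_mult_right_zero)
  finally show ?thesis unfolding fourier_inverse_cosh_sum[OF t u] .
qed

definition \<phi> :: "real \<Rightarrow> real \<Rightarrow> complex" where
  "\<phi> t x = Y2F1 (of_real a + \<i> * of_real t / 2) (of_real a - \<i> * of_real t / 2) c (of_real x)"

lemma phi_eq_cosT: "t > 0 \<Longrightarrow> x > 0 \<Longrightarrow> of_real (H.cosT t H.ker x) = of_real (H.cosT t H.ker 0) * \<phi> t x"
  unfolding \<phi>_def using cosT_eq_phi[OF a c_half _ H.radial_solution_axioms] by blast

lemma cosT_0_pos: "H.cosT t H.ker 0 > 0"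
proof -
  have "complex_of_real a + \<i> * of_real t / 2 \<notin> \<int>\<^sub>\<le>\<^sub>0"
    using a by (auto elim!: nonpos_Ints_cases simp: complex_eq_iff)
  hence "Gamma (complex_of_real a + \<i> * of_real t / 2) \<noteq> 0" by (simp add: Gamma_eq_zero_iff)
  thus ?thesis unfolding cosT_0 using a Gamma_real_pos[of "2 * a"] by simp
qed

text \<open>The constant of \<open>pairing_cosT\<close> divided by the constant relating the
  transform to \<phi>. The prefactor of the coefficient formula is 1/(pi K(n)).\<close>

definition K :: "real \<Rightarrow> real" where
  "K t = 4 * pi * J G.ker 1 / (H.cosT t H.ker 0 * sinh (pi * t))"

text \<open>The factor sinh u cancels the denominator of the Fourier integral, so the formula
  extends to u = 0, where both sides vanish.\<close>

lemma pairing_phi: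
  assumes t: "t > 0"
  shows "(LINT x:{0<..}|lborel. of_real (x powr (2*c - 1) * (G.ker (cosh u) x * sinh u)) * \<phi> t x) = of_real (K t * sin (t * u))"
proof (cases "u = 0")
  case False
  define R where "R = H.cosT t H.ker 0"
  have R: "R > 0" unfolding R_def by (rule cosT_0_pos)
  have "(LINT x:{0<..}|lborel. of_real (x powr (2*c - 1) * (G.ker (cosh u) x * sinh u)) * \<phi> t x)
     = (LINT x:{0<..}|lborel. complex_of_real (sinh u / R * (x powr (2*c - 1) * (G.ker (cosh u) x * H.cosT t H.ker x))))"
  proof (rule set_lebesgue_integral_cong)
    show "\<forall>x. x \<in> {0<..} \<longrightarrow> of_real (x powr (2*c - 1) * (G.ker (cosh u) x * sinh u)) * \<phi> t x
      = complex_of_real (sinh u / R * (x powr (2*c - 1) * (G.ker (cosh u) x * H.cosT t H.ker x)))"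
    proof (intro allI impI)
      fix x :: real assume "x \<in> {0<..}"
      hence "\<phi> t x = of_real (H.cosT t H.ker x / R)" using phi_eq_cosT[OF t, of x] R by (simp add: R_def)
      thus "of_real (x powr (2*c - 1) * (G.ker (cosh u) x * sinh u)) * \<phi> t x
        = complex_of_real (sinh u / R * (x powr (2*c - 1) * (G.ker (cosh u) x * H.cosT t H.ker x)))" by simp
    qed
  qed simp
  also have "\<dots> = of_real (sinh u / R * (2 * J G.ker 1 * (2 * pi * sin (t * u) / (sinh u * sinh (pi * t)))))"
    unfolding pairing_cosT[OF t False, symmetric] set_integral_complex_of_real set_integral_mult_right ..
  also have "sinh u / R * (2 * J G.ker 1 * (2 * pi * sin (t * u) / (sinh u * sinh (pi * t)))) = K t * sin (t * u)"
    using False R by (simp add: K_def R_def field_simps)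
  finally show ?thesis .
qed (simp add: set_lebesgue_integral_def)

end

section \<open>The expansion\<close>

lemma integral_cos_period:
  fixes k :: int
  assumes "k \<noteq> 0"
  shows "integral {-pi..pi} (\<lambda>u. cos (of_int k * u)) = 0"
proof -
  have "((\<lambda>u. cos (of_int k * u)) has_integral (sin (of_int k * pi) / of_int k - sin (of_int k * - pi) / of_int k)) {-pi..pi}"
    by (rule fundamental_theorem_of_calculus)
       (use assms in \<open>auto intro!: derivative_eq_intros simp flip: has_real_derivative_iff_has_vector_derivative\<close>)
  moreover have "sin (of_int k * pi) = 0" by (rule sin_zero_iff_int2[THEN iffD2]) auto
  ultimately show ?thesis by (simp add: integral_unique)
qed

lemma integral_sin_sin:
  fixes m n :: nat
  assumes "m \<ge> 1" "n \<ge> 1"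
  shows "(LINT u:{-pi..pi}|lborel. sin (real n * u) * sin (real m * u)) = (if n = m then pi else 0)"
proof -
  have ci: "set_integrable lborel {-pi..pi} (\<lambda>u. sin (real n * u) * sin (real m * u))"
    unfolding set_integrable_def by (rule borel_integrable_compact) (auto intro!: continuous_intros)
  have "sin (real n * u) * sin (real m * u) = cos (of_int (int n - int m) * u) / 2 - cos (of_int (int n + int m) * u) / 2" for u
    by (simp add: cos_add cos_diff left_diff_distrib distrib_right add_divide_distrib diff_divide_distrib)
  hence "(LINT u:{-pi..pi}|lborel. sin (real n * u) * sin (real m * u))
    = integral {-pi..pi} (\<lambda>u. cos (of_int (int n - int m) * u) / 2 - cos (of_int (int n + int m) * u) / 2)"
    using set_borel_integral_eq_integral(2)[OF ci] by simp
  also have "\<dots> = integral {-pi..pi} (\<lambda>u. cos (of_int (int n - int m) * u)) / 2 - integral {-pi..pi} (\<lambda>u. cos (of_int (int n + int m) * u)) / 2"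
    by (subst Henstock_Kurzweil_Integration.integral_diff) (auto intro!: integrable_continuous_interval continuous_intros)
  also have "integral {-pi..pi} (\<lambda>u. cos (of_int (int n + int m) * u)) = 0"
    by (rule integral_cos_period) (use assms in auto)
  also have "integral {-pi..pi} (\<lambda>u. cos (of_int (int n - int m) * u)) = (if n = m then 2 * pi else 0)"
    using integral_cos_period[of "int n - int m"] by auto
  finally show ?thesis by (cases "n = m") simp_all
qed

context jacobi_kernels
begin

lemma phi_measurable [measurable]: "t > 0 \<Longrightarrow> \<phi> t \<in> borel_measurable borel"
  unfolding \<phi>_def [abs_def] using phi_continuous(1)[OF a c_half] by (intro continuous_borel) auto

text \<open>The exponent in \<open>phi_bound\<close> decreases with t. Its value at t = 1 serves all
  frequencies m >= 1 at once, as termwise integration requires.\<close>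

lemma phi_le:
  assumes "t \<ge> 1" "x > 0"
  shows "norm (\<phi> t x) \<le> exp (pi * a * p) * (1 + x\<^sup>2) powr (- a)"
proof -
  have "norm (\<phi> t x) \<le> exp (pi * a * \<bar>c - a\<bar> / t) * (1 + x\<^sup>2) powr (- a)"
    unfolding \<phi>_def using phi_bound[OF a c_half] assms by auto
  also have "\<dots> \<le> exp (pi * a * p) * (1 + x\<^sup>2) powr (- a)"
  proof -
    have "pi * a * \<bar>c - a\<bar> / t \<le> pi * a * p / 1" using assms a ac by (intro frac_le) (auto simp: p_def)
    thus ?thesis by (intro mult_right_mono) auto
  qed
  finally show ?thesis .
qed

text \<open>The real form of Phi_n: tanh u / cosh(u)^(2p) is sinh u cosh(u)^(-2p-1), and the power
  of cosh belongs to the homogeneous kernel.\<close>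

definition Phi :: "nat \<Rightarrow> real \<Rightarrow> real" where
  "Phi n x = (LINT u:{-pi..pi}|lborel. G.ker (cosh u) x * sinh u * sin (real n * u))"

lemma kernel_measurable [measurable]:
  "g \<in> borel_measurable borel" "(cosh :: real \<Rightarrow> real) \<in> borel_measurable borel" "(sinh :: real \<Rightarrow> real) \<in> borel_measurable borel"
  using G.continuous by (auto intro!: continuous_borel continuous_intros)

lemma kernel_bound:
  obtains M where "M > 0" "\<And>u x. u \<in> {-pi..pi} \<Longrightarrow> \<bar>G.ker (cosh u) x * sinh u * sin (real n * u)\<bar> \<le> M * (1 + x\<^sup>2) powr (- (p + 1/2))"
proof -
  \<comment> \<open>An open interval around [1, cosh pi], the range of cosh on [-pi, pi].\<close>
  obtain M where M: "M > 0" "\<And>P x. 1/2 < P \<Longrightarrow> P < cosh pi + 1 \<Longrightarrow> \<bar>G.ker P x\<bar> \<le> M * (1 + x\<^sup>2) powr (- (2 * p + 1)/2)"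
    by (rule G.ker_local_bound[of "1/2" "cosh pi + 1"]) (use cosh_real_ge_1[of pi] in auto)
  have e: "- (2 * p + 1)/2 = - (p + 1/2)" by (simp add: field_simps)
  show ?thesis
  proof (rule that[of "M * cosh pi"])
    show "M * cosh pi > 0" using M by simp
    fix u x :: real assume u: "u \<in> {-pi..pi}"
    have c: "1 \<le> cosh u" "cosh u \<le> cosh pi"
    proof -
      have "cosh \<bar>u\<bar> \<le> cosh pi" using u by (subst cosh_real_nonneg_le_iff) auto
      thus "cosh u \<le> cosh pi" by (simp add: abs_if split: if_splits)
    qed (rule cosh_real_ge_1)
    have "\<bar>sinh u\<bar> \<le> \<bar>cosh u\<bar>" unfolding abs_le_square_iff by (simp add: cosh_square_eq)
    hence s: "\<bar>sinh u\<bar> \<le> cosh pi" using c by simp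
    have "\<bar>G.ker (cosh u) x\<bar> \<le> M * (1 + x\<^sup>2) powr (- (p + 1/2))"
      using M(2)[of "cosh u" x] c unfolding e by auto
    hence "\<bar>G.ker (cosh u) x\<bar> * \<bar>sinh u\<bar> * \<bar>sin (real n * u)\<bar> \<le> (M * (1 + x\<^sup>2) powr (- (p + 1/2))) * cosh pi * 1"
      using s M(1) by (intro mult_mono) auto
    thus "\<bar>G.ker (cosh u) x * sinh u * sin (real n * u)\<bar> \<le> M * cosh pi * (1 + x\<^sup>2) powr (- (p + 1/2))"
      by (simp add: abs_mult mult_ac)
  qed
qed

lemma kernel_continuous: "continuous_on S (\<lambda>u. G.ker (cosh u) x * sinh u * sin (real n * u))"
  by (intro continuous_at_imp_continuous_on ballI continuous_intros G.ker_continuous) simp_all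

lemma kernel_integrable: "set_integrable lborel {-pi..pi} (\<lambda>u. G.ker (cosh u) x * sinh u * sin (real n * u))"
  unfolding set_integrable_def by (rule borel_integrable_compact) (auto intro: kernel_continuous)

lemma Phi_measurable [measurable]: "Phi n \<in> borel_measurable borel"
proof -
  have "(\<lambda>x. \<integral>u. indicator {-pi..pi} u * (G.ker (cosh u) x * sinh u * sin (real n * u)) \<partial>lborel) \<in> borel_measurable lborel"
    unfolding G.ker_def by (rule lborel.borel_measurable_lebesgue_integral) measurable
  thus ?thesis unfolding Phi_def [abs_def] set_lebesgue_integral_def by simp
qed

lemma Phi_bound:
  obtains M where "M > 0" "\<And>x. \<bar>Phi n x\<bar> \<le> M * (1 + x\<^sup>2) powr (- (p + 1/2))"
proof -
  obtain M where M: "M > 0" "\<And>u x. u \<in> {-pi..pi} \<Longrightarrow> \<bar>G.ker (cosh u) x * sinh u * sin (real n * u)\<bar> \<le> M * (1 + x\<^sup>2) powr (- (p + 1/2))"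
    by (rule kernel_bound[of n]) blast
  show ?thesis
  proof (rule that[of "2 * pi * M"])
    fix x :: real
    define B where "B = M * (1 + x\<^sup>2) powr (- (p + 1/2))"
    have "Phi n x = integral {-pi..pi} (\<lambda>u. G.ker (cosh u) x * sinh u * sin (real n * u))"
      unfolding Phi_def by (rule set_borel_integral_eq_integral(2)[OF kernel_integrable])
    moreover have "norm (integral {-pi..pi} (\<lambda>u. G.ker (cosh u) x * sinh u * sin (real n * u))) \<le> B * (pi - - pi)"
      by (rule integral_bound) (use M(2) in \<open>auto simp: B_def intro: kernel_continuous\<close>)
    ultimately show "\<bar>Phi n x\<bar> \<le> 2 * pi * M * (1 + x\<^sup>2) powr (- (p + 1/2))" by (simp add: B_def mult_ac)
  qed (use M in simp)
qed

text \<open>The exponents add up to p + 1/2 + a = c + 1/2, which exceeds c. The majorant is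
  independent of t and serves integrability, the exchange with the integral over u, and the
  summation over m.\<close>

lemma phi_weight_le:
  assumes "\<bar>k\<bar> \<le> M * (1 + x\<^sup>2) powr (- (p + 1/2))" "M > 0" "t \<ge> 1" "x > 0"
  shows "norm (of_real (x powr (2*c - 1) * k) * \<phi> t x) \<le> M * exp (pi * a * p) * (x powr (2*c - 1) * (1 + x\<^sup>2) powr (- (c + 1/2)))"
proof -
  have "norm (of_real (x powr (2*c - 1) * k) * \<phi> t x) = x powr (2*c - 1) * (\<bar>k\<bar> * norm (\<phi> t x))"
    by (simp add: norm_mult abs_mult)
  also have "\<dots> \<le> x powr (2*c - 1) * ((M * (1 + x\<^sup>2) powr (- (p + 1/2))) * (exp (pi * a * p) * (1 + x\<^sup>2) powr (- a)))"
    using assms phi_le by (intro mult_left_mono mult_mono) auto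
  also have "\<dots> = M * exp (pi * a * p) * (x powr (2*c - 1) * ((1 + x\<^sup>2) powr (- (p + 1/2)) * (1 + x\<^sup>2) powr (- a)))" by simp
  also have "(1 + x\<^sup>2) powr (- (p + 1/2)) * (1 + x\<^sup>2) powr (- a) = (1 + x\<^sup>2) powr (- (c + 1/2))"
    unfolding powr_add[symmetric] by (rule arg_cong[where f = "(powr) (1 + x\<^sup>2)"]) (simp add: p_def)
  finally show ?thesis .
qed

lemma Phi_phi_integrable:
  assumes t: "t \<ge> 1"
  shows "set_integrable lborel {0<..} (\<lambda>x. of_real (x powr (2*c - 1) * Phi n x) * \<phi> t x)"
proof -
  obtain M where M: "M > 0" "\<And>x. \<bar>Phi n x\<bar> \<le> M * (1 + x\<^sup>2) powr (- (p + 1/2))"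
    by (rule Phi_bound[of n]) blast
  have [measurable]: "\<phi> t \<in> borel_measurable borel" using t by (intro phi_measurable) simp
  show ?thesis
  proof (rule set_integrable_bound[OF weight_integrable])
    show "set_borel_measurable lborel {0<..} (\<lambda>x. of_real (x powr (2*c - 1) * Phi n x) * \<phi> t x)"
      unfolding set_borel_measurable_def by measurable
    show "AE x in lborel. x \<in> {0<..} \<longrightarrow> norm (of_real (x powr (2*c - 1) * Phi n x) * \<phi> t x)
       \<le> norm (M * exp (pi * a * p) * (x powr (2*c - 1) * (1 + x\<^sup>2) powr (- (c + 1/2))))"
      using phi_weight_le[OF M(2) M(1) t] by (auto intro!: AE_I2 order.trans[OF _ abs_ge_self])
  qed
qed

text \<open>Integrating over x before u leaves K(m) sin(mu) by \<open>pairing_phi\<close>;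
  orthogonality of the sines on [-pi, pi] selects m = n, and the squared norm of a sine is
  pi.\<close>

lemma pairing_Phi:
  fixes m n :: nat
  assumes m: "m \<ge> 1" and n: "n \<ge> 1"
  shows "(LINT x:{0<..}|lborel. of_real (x powr (2*c - 1) * Phi n x) * \<phi> (real m) x) = (if m = n then of_real (pi * K n) else 0)"
proof -
  obtain M where M: "M > 0" "\<And>u x. u \<in> {-pi..pi} \<Longrightarrow> \<bar>G.ker (cosh u) x * sinh u * sin (real n * u)\<bar> \<le> M * (1 + x\<^sup>2) powr (- (p + 1/2))"
    by (rule kernel_bound[of n]) blast
  have m0: "real m > 0" "real m \<ge> 1" using m by simp_all
  have [measurable]: "\<phi> (real m) \<in> borel_measurable borel" by (rule phi_measurable[OF m0(1)])
  define f where "f = (\<lambda>x u. indicator {0<..} x *\<^sub>R (indicator {-pi..pi} u *\<^sub>R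
      (of_real (x powr (2*c - 1) * (G.ker (cosh u) x * sinh u * sin (real n * u))) * \<phi> (real m) x)))"
  have int: "integrable (lborel \<Otimes>\<^sub>M lborel) (case_prod f)"
  proof (rule set_integrable_product)
    show "case_prod f \<in> borel_measurable (lborel \<Otimes>\<^sub>M lborel)"
      unfolding f_def G.ker_def by measurable
    show "integrable lborel (\<lambda>x. indicator {0<..} x *\<^sub>R (M * exp (pi * a * p) * (x powr (2*c - 1) * (1 + x\<^sup>2) powr (- (c + 1/2)))))"
      using weight_integrable[of "M * exp (pi * a * p)"] by (simp add: set_integrable_def)
    show "integrable lborel (indicator {-pi..pi} :: real \<Rightarrow> real)" by simp
    show "norm (f x u) \<le> indicator {0<..} x *\<^sub>R (M * exp (pi * a * p) * (x powr (2*c - 1) * (1 + x\<^sup>2) powr (- (c + 1/2)))) * indicator {-pi..pi} u" for x u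
      using phi_weight_le[OF M(2)[of u x] M(1) m0(2)] by (simp add: f_def indicator_def)
  qed
  have in_u: "(\<integral>u. f x u \<partial>lborel) = indicator {0<..} x *\<^sub>R (of_real (x powr (2*c - 1) * Phi n x) * \<phi> (real m) x)" for x
  proof -
    have "(\<integral>u. f x u \<partial>lborel) = (\<integral>u. (indicator {0<..} x *\<^sub>R (of_real (x powr (2*c - 1)) * \<phi> (real m) x))
         * of_real (indicator {-pi..pi} u *\<^sub>R (G.ker (cosh u) x * sinh u * sin (real n * u))) \<partial>lborel)"
      by (rule Bochner_Integration.integral_cong) (simp_all add: f_def indicator_def)
    also have "\<dots> = (indicator {0<..} x *\<^sub>R (of_real (x powr (2*c - 1)) * \<phi> (real m) x)) * of_real (Phi n x)"
      unfolding Phi_def set_lebesgue_integral_def integral_complex_of_real[symmetric] by (rule integral_mult_right_zero)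
    finally show ?thesis by simp
  qed
  have in_x: "(\<integral>x. f x u \<partial>lborel) = of_real (K m * (indicator {-pi..pi} u *\<^sub>R (sin (real n * u) * sin (real m * u))))" for u
  proof -
    have "(\<integral>x. f x u \<partial>lborel) = (\<integral>x. of_real (indicator {-pi..pi} u * sin (real n * u)) *
         (indicator {0<..} x *\<^sub>R (of_real (x powr (2*c - 1) * (G.ker (cosh u) x * sinh u)) * \<phi> (real m) x)) \<partial>lborel)"
      by (rule Bochner_Integration.integral_cong) (simp_all add: f_def indicator_def)
    also have "\<dots> = of_real (indicator {-pi..pi} u * sin (real n * u)) * of_real (K m * sin (real m * u))"
      unfolding pairing_phi[OF m0(1), of u, symmetric] set_lebesgue_integral_def by (rule integral_mult_right_zero)
    finally show ?thesis by (simp add: indicator_def)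
  qed
  have "(LINT x:{0<..}|lborel. of_real (x powr (2*c - 1) * Phi n x) * \<phi> (real m) x) = (\<integral>x. \<integral>u. f x u \<partial>lborel \<partial>lborel)"
    unfolding set_lebesgue_integral_def in_u ..
  also have "\<dots> = (\<integral>u. \<integral>x. f x u \<partial>lborel \<partial>lborel)"
    by (rule lborel_pair.Fubini_integral[OF int, symmetric])
  also have "\<dots> = of_real (K m * (LINT u:{-pi..pi}|lborel. sin (real n * u) * sin (real m * u)))"
    unfolding in_x set_lebesgue_integral_def integral_mult_right_zero[symmetric] by (rule integral_complex_of_real)
  also have "\<dots> = (if m = n then of_real (pi * K n) else 0)"
    unfolding integral_sin_sin[OF m n] by auto
  finally show ?thesis .
qed

text \<open>Gamma(2a) cancels between \<open>J_1\<close> and \<open>cosT_0\<close>, which leaves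
  Gamma(2p + 1), the Gamma quotient and sinh. The powers of 4 combine as (a-c) + 1 + (c-1) =
  a.\<close>

lemma K_eq:
  assumes n: "n \<ge> (1::nat)"
  shows "4 powr (a - c) / pi ^ 2 * Gamma (2*(c - a) + 1) * (norm (Gamma (complex_of_real a + \<i> * of_nat n / 2) / Gamma (complex_of_real c)))\<^sup>2
            * sinh (pi * real n) * (pi * K n) = 1"
proof -
  define N where "N = (norm (Gamma (complex_of_real a + \<i> * of_nat n / 2)))\<^sup>2"
  have "complex_of_real a + \<i> * of_nat n / 2 \<notin> \<int>\<^sub>\<le>\<^sub>0"
    using a by (auto elim!: nonpos_Ints_cases simp: complex_eq_iff)
  hence N: "N > 0" by (simp add: N_def Gamma_eq_zero_iff)
  have Gc: "Gamma c > 0" "Gamma (2 * a) > 0" "Gamma (2 * p + 1) > 0" using a c_half p by (auto intro: Gamma_real_pos)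
  have sh: "sinh (pi * real n) \<noteq> 0" using n by simp
  have R: "H.cosT (real n) H.ker 0 = 4 powr a / 2 * N / Gamma (2 * a)" unfolding cosT_0 N_def by simp
  have Kn: "K n = 4 * pi * ((Gamma c)\<^sup>2 * 4 powr (c - 1) / (Gamma (2 * a) * Gamma (2 * p + 1))) / (4 powr a * N / Gamma (2 * a) * sinh (pi * real n))"
    unfolding K_def R J_1[symmetric] using N Gc sh by (simp add: field_simps)
  have nc: "(norm (Gamma (complex_of_real a + \<i> * of_nat n / 2) / Gamma (complex_of_real c)))\<^sup>2 = N / (Gamma c)\<^sup>2"
    using Gc by (simp add: norm_divide power_divide N_def Gamma_complex_of_real)
  have pw: "4 powr (a - c) * (4 * 4 powr (c - 1)) = 4 powr a"
  proof -
    have "4 powr (a - c) * (4 powr 1 * 4 powr (c - 1)) = (4::real) powr a" unfolding powr_add[symmetric] by simp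
    thus ?thesis by simp
  qed
  have "4 powr (a - c) / pi ^ 2 * Gamma (2 * p + 1) * (N / (Gamma c)\<^sup>2) * sinh (pi * real n) * (pi * K n)
     = (4 powr (a - c) * (4 * 4 powr (c - 1))) / 4 powr a"
    unfolding Kn using N Gc sh by (simp add: field_simps power2_eq_square)
  also have "\<dots> = 1" unfolding pw by simp
  finally show ?thesis unfolding nc p_def[symmetric] .
qed

lemma integrand_eq:
  "hyp2F1 (complex_of_real (c - a + 1/2)) (complex_of_real (c - a + 1)) (complex_of_real c) (- (x ^ 2) / (cosh u) ^ 2)
              * complex_of_real (tanh u * sin (real n * u) / (cosh u) powr (2*(c - a)))
    = complex_of_real (G.ker (cosh u) x * sinh u * sin (real n * u))"
proof -
  have e: "- (x ^ 2) / (cosh u) ^ 2 = - ((x / cosh u)\<^sup>2)" by (simp add: power_divide)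
  have "hyp2F1 (complex_of_real (c - a + 1/2)) (complex_of_real (c - a + 1)) (complex_of_real c) (- (x ^ 2) / (cosh u) ^ 2) = of_real (g (x / cosh u))"
    unfolding e hyp2F1_eq_Y2F1 g_def p_def by (rule Y2F1_real) (use c_half in simp)
  moreover have "G.ker (cosh u) x * sinh u * sin (real n * u) = g (x / cosh u) * (tanh u * sin (real n * u) / (cosh u) powr (2*(c - a)))"
  proof -
    have "cosh u powr (- (2 * p + 1)) = 1 / (cosh u powr (2 * (c - a)) * cosh u)"
      using cosh_real_pos[of u] by (simp only: powr_minus_divide powr_add powr_one p_def)
    thus ?thesis by (simp add: G.ker_def tanh_def mult_ac)
  qed
  ultimately show ?thesis by simp
qed

text \<open>All terms are dominated by |s(m)| W(x) with one integrable W, so absolute summability of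
  s permits termwise integration, and \<open>pairing_Phi\<close> keeps only the term with index
  n.\<close>

lemma coefficient_formula:
  fixes s :: "nat \<Rightarrow> complex" and n :: nat
  assumes summ: "summable (\<lambda>m. norm (s (Suc m)))" and n: "n \<ge> 1"
  defines "f \<equiv> (\<lambda>x. \<Sum>m. s (Suc m) * \<phi> (real (Suc m)) x)"
  shows "set_integrable lborel {0<..} (\<lambda>x. of_real (x powr (2*c - 1) * Phi n x) * f x)"
    and "(LINT x:{0<..}|lborel. of_real (x powr (2*c - 1) * Phi n x) * f x) = s n * of_real (pi * K n)"
proof -
  obtain M where M: "M > 0" "\<And>x. \<bar>Phi n x\<bar> \<le> M * (1 + x\<^sup>2) powr (- (p + 1/2))"
    by (rule Phi_bound[of n]) blast
  define W where "W = (\<lambda>x. indicator {0<..} x *\<^sub>R (M * exp (pi * a * p) * (x powr (2*c - 1) * (1 + x\<^sup>2) powr (- (c + 1/2)))))"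
  have W: "integrable lborel W" unfolding W_def using weight_integrable[of "M * exp (pi * a * p)"] by (simp add: set_integrable_def)
  define F where "F = (\<lambda>m x. s (Suc m) * (indicator {0<..} x *\<^sub>R (of_real (x powr (2*c - 1) * Phi n x) * \<phi> (real (Suc m)) x)))"
  have F_int: "integrable lborel (F m)" for m
    unfolding F_def using Phi_phi_integrable[of "real (Suc m)" n] by (intro integrable_mult_right) (simp add: set_integrable_def)
  have F_le: "norm (F m x) \<le> norm (s (Suc m)) * W x" for m x
    unfolding F_def norm_mult using phi_weight_le[OF M(2) M(1), of "real (Suc m)" x]
    by (intro mult_left_mono) (auto simp: W_def indicator_def)
  have sm: "summable (\<lambda>m. norm (F m x))" for x
    by (rule summable_comparison_test'[OF summable_mult2[OF summ, of "W x"]]) (use F_le in auto)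
  have sm_int: "summable (\<lambda>m. \<integral>x. norm (F m x) \<partial>lborel)"
  proof (rule summable_comparison_test'[OF summable_mult2[OF summ, of "\<integral>x. W x \<partial>lborel"]])
    fix m :: nat
    have "(\<integral>x. norm (F m x) \<partial>lborel) \<le> (\<integral>x. norm (s (Suc m)) * W x \<partial>lborel)"
      by (intro integral_mono integrable_norm F_int integrable_mult_right W F_le)
    thus "norm (\<integral>x. norm (F m x) \<partial>lborel) \<le> norm (s (Suc m)) * (\<integral>x. W x \<partial>lborel)"
      by (simp add: integral_nonneg_AE)
  qed
  have sumF: "(\<Sum>m. F m x) = indicator {0<..} x *\<^sub>R (of_real (x powr (2*c - 1) * Phi n x) * f x)" for x
  proof (cases "x > 0")
    case True
    have "summable (\<lambda>m. norm (s (Suc m) * \<phi> (real (Suc m)) x))"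
    proof (rule summable_comparison_test'[OF summable_mult2[OF summ, of "exp (pi * a * p) * (1 + x\<^sup>2) powr (- a)"]])
      fix m :: nat
      show "norm (norm (s (Suc m) * \<phi> (real (Suc m)) x)) \<le> norm (s (Suc m)) * (exp (pi * a * p) * (1 + x\<^sup>2) powr (- a))"
        using phi_le[of "real (Suc m)" x] True by (simp add: norm_mult mult_left_mono)
    qed
    hence "summable (\<lambda>m. s (Suc m) * \<phi> (real (Suc m)) x)" by (rule summable_norm_cancel)
    hence "(\<Sum>m. of_real (x powr (2*c - 1) * Phi n x) * (s (Suc m) * \<phi> (real (Suc m)) x)) = of_real (x powr (2*c - 1) * Phi n x) * f x"
      unfolding f_def by (rule suminf_mult)
    thus ?thesis using True by (simp add: F_def mult_ac)
  qed (simp add: F_def)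
  have AE_sm: "AE x in lborel. summable (\<lambda>m. norm (F m x))" using sm by simp
  show "set_integrable lborel {0<..} (\<lambda>x. of_real (x powr (2*c - 1) * Phi n x) * f x)"
    unfolding set_integrable_def sumF[symmetric] by (rule integrable_suminf[OF F_int AE_sm sm_int])
  have "(\<lambda>m. \<integral>x. F m x \<partial>lborel) sums (LINT x:{0<..}|lborel. of_real (x powr (2*c - 1) * Phi n x) * f x)"
    unfolding set_lebesgue_integral_def sumF[symmetric] by (rule sums_integral[OF F_int AE_sm sm_int])
  \<comment> \<open>The summation index starts at 0 and stands for \<open>Suc m\<close>, so the
    surviving summand sits at n - 1.\<close>
  moreover have "(\<integral>x. F m x \<partial>lborel) = (if m = n - 1 then s n * of_real (pi * K n) else 0)" for m
  proof -
    have "(\<integral>x. F m x \<partial>lborel) = s (Suc m) * (LINT x:{0<..}|lborel. of_real (x powr (2*c - 1) * Phi n x) * \<phi> (real (Suc m)) x)"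
      unfolding F_def set_lebesgue_integral_def by (rule integral_mult_right_zero)
    also have "\<dots> = s (Suc m) * (if Suc m = n then of_real (pi * K n) else 0)"
      by (subst pairing_Phi) (use n in auto)
    finally show ?thesis using n by auto
  qed
  ultimately have "(\<lambda>m. if m = n - 1 then s n * of_real (pi * K n) else 0) sums (LINT x:{0<..}|lborel. of_real (x powr (2*c - 1) * Phi n x) * f x)"
    by simp
  from sums_unique2[OF this sums_single] show "(LINT x:{0<..}|lborel. of_real (x powr (2*c - 1) * Phi n x) * f x) = s n * of_real (pi * K n)" .
qed

end

theorem theorem1:
  fixes a c \<delta> :: real and s :: "nat \<Rightarrow> complex"
  assumes a_pos: "a > 0"
    and c_low: "max (1/2) (2*a - 1/2) < c" and c_up: "c < 2*a + 1/2"
    and c_half: "c = 1/2 \<longrightarrow> 0 < a \<and> a < 1/2"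
    and \<delta>_range: "0 \<le> \<delta>" "\<delta> < pi/2"
    and summ: "summable (\<lambda>m. norm (s (Suc m)) * exp (- \<delta> * real (Suc m))
                 / (norm (Gamma (complex_of_real a + \<i> * of_nat (Suc m) / 2))) ^ 2)"
  defines "f \<equiv> (\<lambda>x::real. \<Sum>m. s (Suc m) *
              hyp2F1 (complex_of_real a + \<i> * of_nat (Suc m) / 2)
                     (complex_of_real a - \<i> * of_nat (Suc m) / 2)
                     (complex_of_real c) (- (x ^ 2)))"
    and "\<Phi> \<equiv> (\<lambda>(n::nat) (x::real). integral {-pi..pi} (\<lambda>u.
              hyp2F1 (complex_of_real (c - a + 1/2)) (complex_of_real (c - a + 1))
                     (complex_of_real c) (- (x ^ 2) / (cosh u) ^ 2)
              * complex_of_real (tanh u * sin (real n * u) / (cosh u) powr (2*(c - a)))))"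
  assumes n_pos: "n \<ge> 1"
  shows "(\<lambda>x. complex_of_real (x powr (2*c - 1)) * \<Phi> n x * f x) absolutely_integrable_on {0<..}
     \<and> s n = complex_of_real (4 powr (a - c) / pi ^ 2 * Gamma (2*(c - a) + 1)
              * (norm (Gamma (complex_of_real a + \<i> * of_nat n / 2) / Gamma (complex_of_real c))) ^ 2
              * sinh (pi * real n))
            * integral {0<..} (\<lambda>x. complex_of_real (x powr (2*c - 1)) * \<Phi> n x * f x)"
proof -
  \<comment> \<open>a is the mean of 1/2 and 2a - 1/2, so the two lower bounds on c give a <
    c.\<close>
  interpret jacobi_kernels a c
    by standard (use a_pos c_low in auto)
  \<comment> \<open>By \<open>Gamma_exp_bounded\<close>, 1 <= C exp(-\<delta> m)/|Gamma(a +
    im/2)|^2, so |s(m)| is at most C times the corresponding term of the weighted series.\<close>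
  have sum_s: "summable (\<lambda>m. norm (s (Suc m)))"
  proof -
    obtain C where C: "C > 0" "\<And>m::nat. m \<ge> 1 \<Longrightarrow> (norm (Gamma (complex_of_real a + \<i> * of_nat m / 2)))\<^sup>2 * exp (\<delta> * real m) \<le> C"
      by (rule Gamma_exp_bounded[OF a_pos \<delta>_range(2)]) blast
    show ?thesis
    proof (rule summable_comparison_test'[OF summable_mult[OF summ, of C]])
      fix m :: nat
      define N where "N = (norm (Gamma (complex_of_real a + \<i> * of_nat (Suc m) / 2)))\<^sup>2"
      have "complex_of_real a + \<i> * of_nat (Suc m) / 2 \<notin> \<int>\<^sub>\<le>\<^sub>0"
        using a_pos by (auto elim!: nonpos_Ints_cases simp: complex_eq_iff)
      hence N: "N > 0" by (simp add: N_def Gamma_eq_zero_iff del: of_nat_Suc)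
      have "N * exp (\<delta> * real (Suc m)) \<le> C" unfolding N_def by (rule C(2)) simp
      hence "1 \<le> C * (exp (- \<delta> * real (Suc m)) / N)"
        using N by (simp add: exp_minus field_simps del: of_nat_Suc)
      hence "norm (s (Suc m)) * 1 \<le> norm (s (Suc m)) * (C * (exp (- \<delta> * real (Suc m)) / N))"
        by (intro mult_left_mono) auto
      thus "norm (norm (s (Suc m))) \<le> C * (norm (s (Suc m)) * exp (- \<delta> * real (Suc m)) / (norm (Gamma (complex_of_real a + \<i> * of_nat (Suc m) / 2))) ^ 2)"
        unfolding N_def[symmetric] by (simp add: mult_ac del: of_nat_Suc)
    qed
  qed
  have f_eq: "f = (\<lambda>x. \<Sum>m. s (Suc m) * \<phi> (real (Suc m)) x)"
    unfolding f_def hyp2F1_eq_Y2F1 \<phi>_def of_real_of_nat_eq ..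
  have Phi_eq: "\<Phi> n x = of_real (Phi n x)" for x
  proof -
    have i: "set_integrable lborel {-pi..pi} (\<lambda>u. complex_of_real (G.ker (cosh u) x * sinh u * sin (real n * u)))"
      using integrable_of_real[OF kernel_integrable[unfolded set_integrable_def]]
      by (simp add: set_integrable_def scaleR_conv_of_real)
    show ?thesis unfolding \<Phi>_def integrand_eq Phi_def
      unfolding set_borel_integral_eq_integral(2)[OF i, symmetric] set_integral_complex_of_real ..
  qed
  have eq: "complex_of_real (x powr (2*c - 1)) * \<Phi> n x * f x
      = of_real (x powr (2*c - 1) * Phi n x) * (\<Sum>m. s (Suc m) * \<phi> (real (Suc m)) x)" for x
    unfolding Phi_eq f_eq by simp
  note cf = coefficient_formula[OF sum_s n_pos]
  \<comment> \<open>Absolute integrability refers to the completed measure; Borel measurability of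
    the integrand carries the result over from \<open>lborel\<close>.\<close>
  have 1: "(\<lambda>x. complex_of_real (x powr (2*c - 1)) * \<Phi> n x * f x) absolutely_integrable_on {0<..}"
    unfolding eq set_integrable_def
    by (rule integrable_completion[THEN iffD2, OF borel_measurable_integrable]) (rule cf(1)[unfolded set_integrable_def])+
  have 2: "integral {0<..} (\<lambda>x. complex_of_real (x powr (2*c - 1)) * \<Phi> n x * f x) = s n * of_real (pi * K n)"
    unfolding eq set_borel_integral_eq_integral(2)[OF cf(1), symmetric] by (rule cf(2))
  have 3: "complex_of_real A * (s n * of_real B) = s n" if "A * B = 1" for A B :: real
  proof -
    have "complex_of_real A * (s n * of_real B) = s n * of_real (A * B)" by simp
    thus ?thesis unfolding that by simp
  qed
  show ?thesis unfolding 2 3[OF K_eq[OF n_pos]] using 1 by simp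
qed

end
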